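(* Let $X$ be a symmetric space on $[0,1]$ such that $X\supset G$, and let $w$ be a positive measurable function on $[0,1]$ such that $L_\infty\subset X(w)\subset L_1$. Then: (i) the sequence of Rademacher functions $\{r_k\}$ spans $\ell_2$ in $X(w)$ if and only if $w\in\mathcal{M}(X)$, where $\mathcal{M}(X)$ is the Rademacher multiplicator space of $X$; (ii) $X(w)\supset G$ if and only if $w\in \mathrm{Sym}(X)$, where $\mathrm{Sym}(X)$ is the symmetric kernel of $\mathcal{M}(X)$.
   Context: All functions are (classes of) real measurable, a.e. finite functions on $[0,1]$; $m$ is Lebesgue measure; $L_p=L_p[0,1]$. The decreasing rearrangement $x^*$ of $x$ is the right-continuous inverse of $n_x(\tau)=m\{t:|x(t)|>\tau\}$; $x,y$ are equimeasurable if $n_x=n_y$ on $(0,\infty)$. A Banach function lattice $E$ on $[0,1]$ is a Banach space of such functions such that $x\in E$, $|y|\le|x|$ imply $y\in E$, $\|y\|_E\le\|x\|_E$. Its Köthe dual $E'$ is the space of all $y$ with $\int_0^1|xy|\,dt<\infty$ for all $x\in E$, with norm $\|y\|_{E'}=\sup\{\int_0^1 xy\,dt:\|x\|_E\le1\}$; $E''=(E')'$. A symmetric space $X$ is a (nonzero) Banach space of such functions such that $y^*\le x^*$, $x\in X$ imply $y\in X$ and $\|y\|_X\le\|x\|_X$. Then $L_\infty\subset X\subset L_1$ continuously. Standing assumption: the natural inclusion of $X$ into $X''$ is isometric, i.e. $\|x\|_X=\|x\|_{X''}$ for $x\in X$. Weighted space: $X(w)=\{f: fw\in X\}$ with $\|f\|_{X(w)}=\|fw\|_X$.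 $\mathrm{Exp}\,L^2$ is the Orlicz space $L_{N_2}$ on $[0,1]$ (Luxemburg norm), where $N_2$ is an Orlicz function equivalent to $\exp(t^2)-1$. $G$ is the closure of $L_\infty$ in $\mathrm{Exp}\,L^2$. Rademacher functions: $r_k(t)=\mathrm{sign}\,\sin(2^k\pi t)$, $t\in[0,1]$, $k\ge1$. "$\{r_k\}$ spans $\ell_2$ in a function lattice $E$" means that $\{r_k\}$ is equivalent in $E$ to the unit vector basis of $\ell_2$: there are constants $c,C>0$ with $c\|(a_k)\|_{\ell_2}\le\|\sum_{k=1}^\infty a_kr_k\|_E\le C\|(a_k)\|_{\ell_2}$ for all $(a_k)\in\ell_2$. Rademacher multiplicator space $\mathcal{M}(X)$: all measurable $f:[0,1]\to\mathbb{R}$ such that $f\cdot\sum_{k=1}^\infty a_kr_k\in X$ for every Rademacher sum $\sum_{k=1}^\infty a_kr_k\in X$, with norm $\|f\|_{\mathcal{M}(X)}=\sup\{\|f\sum a_kr_k\|_X:\|\sum a_kr_k\|_X\le1\}$. Symmetric kernel $\mathrm{Sym}(X)$: all $f\in\mathcal{M}(X)$ such that every $g$ equimeasurable with $f$ also belongs to $\mathcal{M}(X)$, with norm $\|f\|_{\mathrm{Sym}(X)}=\sup\|g\|_{\mathcal{M}(X)}$ over all $g$ equimeasurable with $f$. *)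

theory Defs
  imports "HOL-Analysis.Analysis"
begin

abbreviation leb01 :: "real measure" where
  "leb01 \<equiv> lebesgue_on {0..1}"

text \<open>
  Classes of a.e. equal functions on $[0,1]$ are represented by all their representatives, as total
  functions on the reals whose values outside $[0,1]$ are irrelevant. Accordingly the norm of a
  space vanishes exactly at the functions that are a.e. zero. The field \<open>nrm\<close> is meaningful only on \<open>carr\<close>.
\<close>

record fspace =
  carr :: "(real \<Rightarrow> real) set"
  nrm :: "(real \<Rightarrow> real) \<Rightarrow> real"

definition banach_function_space :: "fspace \<Rightarrow> bool" where
  "banach_function_space E \<longleftrightarrow>
     carr E \<subseteq> borel_measurable leb01 \<and>
     (\<lambda>t. 0) \<in> carr E \<and>
     (\<forall>x\<in>carr E. \<forall>y\<in>carr E. (\<lambda>t. x t + y t) \<in> carr E \<and> nrm E (\<lambda>t. x t + y t) \<le> nrm E x + nrm E y) \<and>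
     (\<forall>x\<in>carr E. \<forall>c. (\<lambda>t. c * x t) \<in> carr E \<and> nrm E (\<lambda>t. c * x t) = \<bar>c\<bar> * nrm E x) \<and>
     (\<forall>x\<in>carr E. \<forall>y\<in>borel_measurable leb01. (AE t in leb01. x t = y t) \<longrightarrow> y \<in> carr E \<and> nrm E y = nrm E x) \<and>
     (\<forall>x\<in>carr E. 0 \<le> nrm E x \<and> (nrm E x = 0 \<longleftrightarrow> (AE t in leb01. x t = 0))) \<and>
     (\<forall>f. (\<forall>n::nat. f n \<in> carr E) \<and>
          (\<forall>e>0. \<exists>M. \<forall>m\<ge>M. \<forall>n\<ge>M. nrm E (\<lambda>t. f m t - f n t) < e) \<longrightarrow>
          (\<exists>x\<in>carr E. (\<lambda>n. nrm E (\<lambda>t. f n t - x t)) \<longlonglongrightarrow> 0))"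

definition distr_fun :: "(real \<Rightarrow> real) \<Rightarrow> real \<Rightarrow> real" where
  "distr_fun x \<tau> = measure leb01 {t \<in> {0..1}. \<bar>x t\<bar> > \<tau>}"

text \<open>The decreasing rearrangement, used only for $0 < s < 1$, where the infimum is over a nonempty set.\<close>

definition rearr :: "(real \<Rightarrow> real) \<Rightarrow> real \<Rightarrow> real" where
  "rearr x s = Inf {\<tau>. 0 \<le> \<tau> \<and> distr_fun x \<tau> \<le> s}"

definition equimeasurable :: "(real \<Rightarrow> real) \<Rightarrow> (real \<Rightarrow> real) \<Rightarrow> bool" where
  "equimeasurable x y \<longleftrightarrow> (\<forall>\<tau>>0. distr_fun x \<tau> = distr_fun y \<tau>)"

definition symmetric_space :: "fspace \<Rightarrow> bool" where
  "symmetric_space X \<longleftrightarrow>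
     banach_function_space X \<and>
     (\<exists>x\<in>carr X. \<not> (AE t in leb01. x t = 0)) \<and>
     (\<forall>x\<in>carr X. \<forall>y\<in>borel_measurable leb01.
        (\<forall>s\<in>{0<..<1}. rearr y s \<le> rearr x s) \<longrightarrow> y \<in> carr X \<and> nrm X y \<le> nrm X x)"

definition koethe_dual :: "fspace \<Rightarrow> fspace" where
  "koethe_dual E =
     \<lparr>carr = {y \<in> borel_measurable leb01. \<forall>x\<in>carr E. integrable leb01 (\<lambda>t. x t * y t)},
      nrm = (\<lambda>y. Sup {(LINT t|leb01. x t * y t) | x. x \<in> carr E \<and> nrm E x \<le> 1})\<rparr>"

definition weighted_space :: "fspace \<Rightarrow> (real \<Rightarrow> real) \<Rightarrow> fspace" where
  "weighted_space X w =
     \<lparr>carr = {f \<in> borel_measurable leb01. (\<lambda>t. f t * w t) \<in> carr X},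
      nrm = (\<lambda>f. nrm X (\<lambda>t. f t * w t))\<rparr>"

definition L_1 :: "(real \<Rightarrow> real) set" where
  "L_1 = {x. integrable leb01 x}"

definition L_inf :: "(real \<Rightarrow> real) set" where
  "L_inf = {x \<in> borel_measurable leb01. \<exists>C. AE t in leb01. \<bar>x t\<bar> \<le> C}"

text \<open>Orlicz functions are considered on $[0,\infty)$ only; continuity and monotonicity follow from these conditions.\<close>

definition orlicz_function :: "(real \<Rightarrow> real) \<Rightarrow> bool" where
  "orlicz_function N \<longleftrightarrow> convex_on {0..} N \<and> N 0 = 0 \<and> (\<forall>u>0. N u > 0)"

text \<open>Equivalence at infinity, the one that determines an Orlicz space over a finite measure space.\<close>

definition orlicz_equivalent :: "(real \<Rightarrow> real) \<Rightarrow> (real \<Rightarrow> real) \<Rightarrow> bool" where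
  "orlicz_equivalent N M \<longleftrightarrow>
     (\<exists>c>0. \<exists>C>0. \<exists>u0\<ge>0. \<forall>u\<ge>u0. M (c * u) \<le> N u \<and> N u \<le> M (C * u))"

definition orlicz_space :: "(real \<Rightarrow> real) \<Rightarrow> fspace" where
  "orlicz_space N =
     \<lparr>carr = {x \<in> borel_measurable leb01. \<exists>l>0. (\<integral>\<^sup>+t. ennreal (N (\<bar>x t\<bar> / l)) \<partial>leb01) < \<infinity>},
      nrm = (\<lambda>x. Inf {l. 0 < l \<and> (\<integral>\<^sup>+t. ennreal (N (\<bar>x t\<bar> / l)) \<partial>leb01) \<le> 1})\<rparr>"

definition closure_L_inf :: "fspace \<Rightarrow> (real \<Rightarrow> real) set" where
  "closure_L_inf E = {x \<in> carr E. \<forall>e>0. \<exists>y\<in>L_inf \<inter> carr E. nrm E (\<lambda>t. x t - y t) < e}"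

definition rademacher :: "nat \<Rightarrow> real \<Rightarrow> real" where
  "rademacher k t = sgn (sin (2 ^ k * pi * t))"

text \<open>
  The coefficient \<open>a k\<close> belongs to the Rademacher function with index \<open>k + 1\<close>. A coefficient sequence
  defines a Rademacher sum only if the series converges a.e.; where it diverges, \<open>suminf\<close> is an
  arbitrary constant, so \<open>rad_convergent\<close> must accompany \<open>rad_sum\<close>, unless the
  coefficients are square summable, when a.e. convergence is automatic.
\<close>

definition rad_convergent :: "(nat \<Rightarrow> real) \<Rightarrow> bool" where
  "rad_convergent a \<longleftrightarrow> (AE t in leb01. summable (\<lambda>k. a k * rademacher (Suc k) t))"

definition rad_sum :: "(nat \<Rightarrow> real) \<Rightarrow> real \<Rightarrow> real" where
  "rad_sum a t = (\<Sum>k. a k * rademacher (Suc k) t)"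

definition rademacher_spans_l2 :: "fspace \<Rightarrow> bool" where
  "rademacher_spans_l2 E \<longleftrightarrow>
     (\<exists>c>0. \<exists>C>0. \<forall>a. summable (\<lambda>k. (a k)\<^sup>2) \<longrightarrow>
        rad_sum a \<in> carr E \<and>
        c * sqrt (\<Sum>k. (a k)\<^sup>2) \<le> nrm E (rad_sum a) \<and>
        nrm E (rad_sum a) \<le> C * sqrt (\<Sum>k. (a k)\<^sup>2))"

definition multiplicator_space :: "fspace \<Rightarrow> fspace" where
  "multiplicator_space X =
     \<lparr>carr = {f \<in> borel_measurable leb01.
        \<forall>a. rad_convergent a \<and> rad_sum a \<in> carr X \<longrightarrow> (\<lambda>t. f t * rad_sum a t) \<in> carr X},
      nrm = (\<lambda>f. Sup {nrm X (\<lambda>t. f t * rad_sum a t) | a.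
        rad_convergent a \<and> rad_sum a \<in> carr X \<and> nrm X (rad_sum a) \<le> 1})\<rparr>"

definition symmetric_kernel :: "fspace \<Rightarrow> fspace" where
  "symmetric_kernel X =
     \<lparr>carr = {f \<in> carr (multiplicator_space X).
        \<forall>g\<in>borel_measurable leb01. equimeasurable g f \<longrightarrow> g \<in> carr (multiplicator_space X)},
      nrm = (\<lambda>f. Sup {nrm (multiplicator_space X) g | g.
        g \<in> borel_measurable leb01 \<and> equimeasurable g f})\<rparr>"

end

theory Submission
  imports Defs
begin

text \<open>
  A Rademacher series that converges a.e. has square-summable coefficients, and its sum then has
  Gaussian tails of every order, which is exactly membership in \<open>G\<close>. Hence \<open>w\<close> is a multiplicator iff
  \<open>w S \<in> X\<close> for all Rademacher sums \<open>S\<close> with \<open>\<ell>\<^sub>2\<close> coefficients. The upper \<open>\<ell>\<^sub>2\<close>-estimate in \<open>X(w)\<close> follows from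
  the uniform boundedness principle for the functionals \<open>S \<mapsto> \<integral> w S y\<close>, \<open>y\<close> in the unit ball of \<open>X'\<close>, and
  \<open>X \<subseteq> X''\<close> isometrically; the lower one from \<open>X(w) \<subseteq> L\<^sub>1\<close> and the Khintchine inequality in \<open>L\<^sub>1\<close>.

  For the second part, the distribution of a product \<open>f g\<close> is, up to a factor 2, largest when \<open>f\<close> and \<open>g\<close>
  are comonotone, and \<open>X\<close> is invariant under dilations. Therefore \<open>w\<close> is in the symmetric kernel iff
  the comonotone product of \<open>w\<close> with each \<open>S\<close> is in \<open>X\<close>. Since every \<open>f \<in> G\<close> is dominated in distribution
  by a single Rademacher sum, the same holds with \<open>S\<close> replaced by \<open>f\<close>.
\<close>

subsection \<open>Distribution functions and comonotone rearrangements\<close>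

text \<open>Uniform boundedness needs functionals already known to be bounded on
  \<open>\<ell>\<^sub>2\<close>, and \<open>\<integral> w S y\<close> is not known to be so. It is
  therefore cut off to \<open>|w y| \<le> n\<close>, where the bound \<open>n\<close> is trivial,
  and the family is indexed by both \<open>y\<close> and \<open>n\<close>. Independence enters only
  through the maps \<open>t / 2\<close> and \<open>(1 + t) / 2\<close>, which prepend a sign to the
  sign sequence of \<open>t\<close>: moments, the maximal inequality and products of tails are
  inductions that remove the first sign, mostly with a free offset \<open>x\<close> that absorbs it.
  The delicate point is the domination of \<open>f\<close> by one series. Tails of a Rademacher sum
  also decay faster than every Gaussian, so the series has to be built after \<open>f\<close>: block
  \<open>j\<close> has norm \<open>2^-j\<close>, and its length is chosen so that it covers all
  heights up to those where the next, smaller block is already strong enough against the tail of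
  \<open>f\<close>. The constant 12 comes from a fourth-moment argument: \<open>|S|\<close> is at
  least half its norm with measure 1/6, and symmetry halves this. The factor 144 consists of two
  such factors, spent on the terms before and after the block in use.\<close>

abbreviation prob :: "real set \<Rightarrow> real" where
  "prob \<equiv> measure leb01"

abbreviation meas01 :: "(real \<Rightarrow> real) set" where
  "meas01 \<equiv> borel_measurable leb01"

lemma prob_leb01: "prob {0..1} = 1" "finite_measure leb01" "space leb01 = {0..1::real}"
  by (auto simp: measure_restrict_space space_restrict_space emeasure_restrict_space intro!: finite_measureI)

interpretation leb01: finite_measure leb01
  by (rule prob_leb01)

lemmas prob_mono = leb01.finite_measure_mono

lemma prob_le_1: "prob A \<le> 1"
  using leb01.bounded_measure[of A] by (simp add: prob_leb01)

lemma sets_Collect01: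
  assumes "Measurable.pred leb01 P"
  shows "{t \<in> {0..1}. P t} \<in> sets leb01" "{t. 0 \<le> t \<and> t \<le> 1 \<and> P t} \<in> sets leb01"
proof -
  have "{t \<in> space leb01. P t} \<in> sets leb01" using assms by (rule predE)
  then show "{t \<in> {0..1}. P t} \<in> sets leb01" "{t. 0 \<le> t \<and> t \<le> 1 \<and> P t} \<in> sets leb01"
    by (simp_all add: prob_leb01)
qed

lemma measurable_ident_leb01: "(\<lambda>s. s) \<in> meas01"
  by (intro measurable_restrict_space1 measurable_completion) simp

lemma sets_superlevel [measurable]:
  fixes x :: "real \<Rightarrow> real"
  assumes [measurable]: "x \<in> meas01"
  shows "{t \<in> {0..1}. \<bar>x t\<bar> > \<tau>} \<in> sets leb01"
  by (rule sets_Collect01) measurable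

lemma distr_fun_bounds: "0 \<le> distr_fun x \<tau>" "distr_fun x \<tau> \<le> 1"
  by (simp_all add: distr_fun_def prob_le_1)

lemma distr_fun_mono_AE:
  assumes [measurable]: "x \<in> meas01" "y \<in> meas01"
    and "AE t in leb01. \<bar>y t\<bar> > \<sigma> \<longrightarrow> \<bar>x t\<bar> > \<tau>"
  shows "distr_fun y \<sigma> \<le> distr_fun x \<tau>"
  unfolding distr_fun_def
proof (rule leb01.finite_measure_mono_AE)
  show "{t \<in> {0..1}. \<bar>x t\<bar> > \<tau>} \<in> sets leb01" by (rule sets_superlevel) fact
qed (use assms(3) in auto)

lemma distr_fun_antimono:
  assumes "x \<in> meas01" "\<sigma> \<le> \<tau>"
  shows "distr_fun x \<tau> \<le> distr_fun x \<sigma>"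
  by (rule distr_fun_mono_AE) (use assms in auto)

text \<open>The sets \<open>{|x| > \<sigma>}\<close> increase to \<open>{|x| > \<tau>}\<close> as
  \<open>\<sigma>\<close> decreases to \<open>\<tau>\<close>. This carries estimates known at
  positive levels to level 0, and to the infimum that defines \<open>rearr\<close>.\<close>

lemma distr_fun_right_continuous:
  assumes [measurable]: "x \<in> meas01"
    and *: "\<And>\<sigma>. \<sigma> > \<tau> \<Longrightarrow> distr_fun x \<sigma> \<le> p"
  shows "distr_fun x \<tau> \<le> p"
proof -
  let ?A = "\<lambda>n::nat. {t \<in> {0..1}. \<bar>x t\<bar> > \<tau> + 1 / real (Suc n)}"
  have "(\<lambda>n. prob (?A n)) \<longlonglongrightarrow> prob (\<Union>n. ?A n)"
  proof (rule leb01.finite_Lim_measure_incseq)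
    show "range ?A \<subseteq> sets leb01" by (blast intro: sets_superlevel assms)
    show "incseq ?A"
    proof (rule incseq_SucI, safe)
      fix n t assume "\<tau> + 1 / real (Suc n) < \<bar>x t\<bar>"
      moreover have "1 / real (Suc (Suc n)) \<le> 1 / real (Suc n)" by (simp add: frac_le)
      ultimately show "\<tau> + 1 / real (Suc (Suc n)) < \<bar>x t\<bar>" by linarith
    qed
  qed
  moreover have "(\<Union>n. ?A n) = {t \<in> {0..1}. \<bar>x t\<bar> > \<tau>}"
  proof safe
    fix t n assume "\<tau> + 1 / real (Suc n) < \<bar>x t\<bar>"
    moreover have "0 < 1 / real (Suc n)" by simp
    ultimately show "\<tau> < \<bar>x t\<bar>" by linarith
  next
    fix t assume t: "t \<in> {0..1}" "\<tau> < \<bar>x t\<bar>"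
    then obtain n where "inverse (real (Suc n)) < \<bar>x t\<bar> - \<tau>"
      using reals_Archimedean[of "\<bar>x t\<bar> - \<tau>"] by auto
    then show "t \<in> (\<Union>n. ?A n)" using t by (auto simp: field_simps intro!: exI[of _ n])
  qed
  ultimately have "(\<lambda>n. distr_fun x (\<tau> + 1 / real (Suc n))) \<longlonglongrightarrow> distr_fun x \<tau>"
    by (simp add: distr_fun_def)
  then show ?thesis
    by (rule LIMSEQ_le_const2) (auto intro!: *)
qed

text \<open>Values are real numbers, so the sets \<open>{|x| > n}\<close> decrease to the empty set.
  Hence the infimum in \<open>rearr x s\<close> is over a nonempty set when
  \<open>s > 0\<close>.\<close>

lemma distr_fun_small:
  assumes [measurable]: "x \<in> meas01" and "s > 0"
  obtains \<tau> where "0 \<le> \<tau>" "distr_fun x \<tau> \<le> s"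
proof -
  let ?A = "\<lambda>n::nat. {t \<in> {0..1}. \<bar>x t\<bar> > real n}"
  have "(\<lambda>n. prob (?A n)) \<longlonglongrightarrow> prob (\<Inter>n. ?A n)"
  proof (rule leb01.finite_Lim_measure_decseq)
    show "range ?A \<subseteq> sets leb01" by (blast intro: sets_superlevel assms)
  qed (auto intro!: decseq_SucI)
  moreover have "(\<Inter>n. ?A n) = {}"
  proof -
    have "\<exists>n. \<not> real n < \<bar>x t\<bar>" for t
      using reals_Archimedean2[of "\<bar>x t\<bar>"] by (metis less_asym)
    then show ?thesis by fastforce
  qed
  ultimately have "(\<lambda>n. distr_fun x (real n)) \<longlonglongrightarrow> 0"
    by (simp add: distr_fun_def)
  then have "eventually (\<lambda>n. distr_fun x (real n) < s) sequentially"
    using \<open>s > 0\<close> by (rule order_tendstoD)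
  then obtain n where "distr_fun x (real n) < s"
    by (auto simp: eventually_sequentially)
  then show thesis using that[of "real n"] by simp
qed

lemma rearr_attained:
  assumes x: "x \<in> meas01" and "0 \<le> \<tau>" "distr_fun x \<tau> \<le> s"
  shows "0 \<le> rearr x s" "distr_fun x (rearr x s) \<le> s" "rearr x s \<le> \<tau>"
proof -
  let ?A = "{\<tau>. 0 \<le> \<tau> \<and> distr_fun x \<tau> \<le> s}"
  have ne: "?A \<noteq> {}" using assms by auto
  have bdd: "bdd_below ?A" by (intro bdd_belowI[of _ 0]) auto
  show "0 \<le> rearr x s" unfolding rearr_def using ne by (intro cInf_greatest) auto
  show "rearr x s \<le> \<tau>" unfolding rearr_def using bdd assms by (intro cInf_lower) auto
  show "distr_fun x (rearr x s) \<le> s"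
  proof (rule distr_fun_right_continuous[OF x])
    fix \<sigma> assume "rearr x s < \<sigma>"
    then obtain \<rho> where "\<rho> \<in> ?A" "\<rho> < \<sigma>"
      unfolding rearr_def using ne by (meson cInf_lessD)
    then show "distr_fun x \<sigma> \<le> s"
      using distr_fun_antimono[OF x, of \<rho> \<sigma>] by auto
  qed
qed

text \<open>The Galois connection between a distribution function and its generalized inverse; it
  turns superlevel sets of functions built from \<open>rearr\<close> into intervals or rank
  conditions.\<close>

lemma less_rearr_iff:
  assumes x: "x \<in> meas01" and "0 < s" "0 \<le> \<tau>"
  shows "\<tau> < rearr x s \<longleftrightarrow> s < distr_fun x \<tau>"
proof -
  obtain \<sigma> where \<sigma>: "0 \<le> \<sigma>" "distr_fun x \<sigma> \<le> s" using distr_fun_small[OF x \<open>0 < s\<close>] .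
  show ?thesis
    using rearr_attained[OF x \<sigma>] rearr_attained(3)[OF x \<open>0 \<le> \<tau>\<close>, of s]
      distr_fun_antimono[OF x, of "rearr x s" \<tau>] by force
qed

lemma rearr_nonneg: "x \<in> meas01 \<Longrightarrow> 0 < s \<Longrightarrow> 0 \<le> rearr x s"
  by (metis distr_fun_small rearr_attained(1))

lemma rearr_mono:
  assumes x: "x \<in> meas01" and y: "y \<in> meas01" and "0 < s"
    and le: "\<And>\<tau>. \<tau> > 0 \<Longrightarrow> distr_fun y \<tau> \<le> distr_fun x \<tau>"
  shows "rearr y s \<le> rearr x s"
proof (rule ccontr)
  assume "\<not> ?thesis"
  then have lt: "rearr x s < rearr y s" by simp
  \<comment> \<open>The midpoint is positive even if \<open>rearr x s = 0\<close>; the hypothesis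
    speaks of positive levels.\<close>
  define \<tau> where "\<tau> = (rearr x s + rearr y s) / 2"
  have \<tau>: "\<tau> > 0" "rearr x s < \<tau>" "\<tau> < rearr y s"
    using lt rearr_nonneg[OF x \<open>0 < s\<close>] by (auto simp: \<tau>_def)
  then have "s < distr_fun y \<tau>" using less_rearr_iff[OF y \<open>0 < s\<close>, of \<tau>] by simp
  also have "\<dots> \<le> distr_fun x \<tau>" using le \<tau> by simp
  finally show False using less_rearr_iff[OF x \<open>0 < s\<close>, of \<tau>] \<tau> by simp
qed

lemma distr_fun_scale:
  assumes "c > 0"
  shows "distr_fun (\<lambda>t. c * x t) \<tau> = distr_fun x (\<tau> / c)"
  using assms by (simp add: distr_fun_def abs_mult field_simps)

text \<open>
  The lexicographic order by \<open>(\<bar>u t\<bar>, - t)\<close> has no ties, so ranking by it is measure preserving even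
  when \<open>\<bar>u\<bar>\<close> has level sets of positive measure.
\<close>

definition rank_fun :: "(real \<Rightarrow> real) \<Rightarrow> real \<Rightarrow> real" where
  "rank_fun u t = prob {s \<in> {0..1}. \<bar>u s\<bar> > \<bar>u t\<bar> \<or> (\<bar>u s\<bar> = \<bar>u t\<bar> \<and> s < t)}"

lemma rank_fun_set_measurable [measurable]:
  fixes u :: "real \<Rightarrow> real"
  assumes [measurable]: "u \<in> meas01"
  shows "{s \<in> {0..1}. \<bar>u s\<bar> > \<bar>u t\<bar> \<or> (\<bar>u s\<bar> = \<bar>u t\<bar> \<and> s < t)} \<in> sets leb01"
  using measurable_ident_leb01[measurable] by (intro sets_Collect01) measurable

text \<open>The rank is the measure of a section of a measurable subset of the square.\<close>

lemma rank_fun_measurable [measurable]: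
  assumes u[measurable]: "u \<in> meas01"
  shows "rank_fun u \<in> meas01"
proof -
  note measurable_ident_leb01[measurable]
  let ?Q = "{p \<in> space (leb01 \<Otimes>\<^sub>M leb01). \<bar>u (snd p)\<bar> > \<bar>u (fst p)\<bar> \<or>
     (\<bar>u (snd p)\<bar> = \<bar>u (fst p)\<bar> \<and> snd p < fst p)}"
  have "?Q \<in> sets (leb01 \<Otimes>\<^sub>M leb01)"
    by measurable
  then have "(\<lambda>t. emeasure leb01 (Pair t -` ?Q)) \<in> borel_measurable leb01"
    by (rule leb01.measurable_emeasure_Pair)
  then have "(\<lambda>t. enn2real (emeasure leb01 (Pair t -` ?Q))) \<in> borel_measurable leb01"
    by measurable
  moreover have "enn2real (emeasure leb01 (Pair t -` ?Q)) = rank_fun u t" if "t \<in> space leb01" for t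
  proof -
    have "Pair t -` ?Q = {s \<in> {0..1}. \<bar>u s\<bar> > \<bar>u t\<bar> \<or> (\<bar>u s\<bar> = \<bar>u t\<bar> \<and> s < t)}"
      using that by (auto simp: space_pair_measure prob_leb01)
    then show ?thesis by (simp add: rank_fun_def measure_def)
  qed
  ultimately show ?thesis
    by (subst measurable_cong[of _ _ "\<lambda>t. enn2real (emeasure leb01 (Pair t -` ?Q))"]) auto
qed

lemma rank_fun_mono:
  assumes "u \<in> meas01" and "\<bar>u s\<bar> > \<bar>u t\<bar>"
  shows "rank_fun u s \<le> rank_fun u t"
  unfolding rank_fun_def
  by (intro prob_mono rank_fun_set_measurable) (use assms in auto)

text \<open>The measure of \<open>E \<inter> {..<t}\<close> is 1-Lipschitz in \<open>t\<close>, so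
  the intermediate value theorem applies. It serves to cut a level set of positive measure at the
  right place.\<close>

lemma initial_part_of_measure:
  assumes E: "E \<in> sets leb01" and "0 \<le> \<delta>" "\<delta> \<le> prob E"
  obtains t where "prob (E \<inter> {..<t}) = \<delta>" "0 \<le> t" "t \<le> 1"
proof -
  let ?\<phi> = "\<lambda>t. prob (E \<inter> {..<t})"
  have E01: "E \<subseteq> {0..1}" using sets.sets_into_space[OF E] by (simp add: prob_leb01)
  have [measurable]: "E \<in> sets leb01" by fact
  have meas: "E \<inter> A \<in> sets leb01" if "A \<in> sets borel" for A
  proof -
    have "E \<inter> A = E \<inter> (A \<inter> {0..1})" using E01 by auto
    moreover have "A \<inter> {0..1} \<in> sets leb01"
      using that by (auto simp: sets_restrict_space_iff)
    ultimately show ?thesis using E by auto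
  qed
  have lip: "?\<phi> t \<le> ?\<phi> s + (t - s)" if "s \<le> t" "0 \<le> s" "t \<le> 1" for s t
  proof -
    have "E \<inter> {..<t} = (E \<inter> {..<s}) \<union> (E \<inter> {s..<t})" using that by auto
    then have "?\<phi> t \<le> ?\<phi> s + prob (E \<inter> {s..<t})"
      by (metis measure_Un_le meas lessThan_borel atLeastLessThan_borel)
    also have "prob (E \<inter> {s..<t}) \<le> prob {s..<t}"
      using that by (intro prob_mono) (auto simp: sets_restrict_space_iff)
    also have "\<dots> = t - s"
      using that by (subst measure_restrict_space) auto
    finally show ?thesis by simp
  qed
  have mono: "?\<phi> s \<le> ?\<phi> t" if "s \<le> t" for s t
    using that by (intro prob_mono meas) auto
  have "continuous_on {0..1} ?\<phi>"
  proof (rule continuous_on_iff[THEN iffD2], intro ballI allI impI)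
    fix s :: real and e :: real assume "s \<in> {0..1}" "e > 0"
    have "dist (?\<phi> t) (?\<phi> s) < e" if "t \<in> {0..1}" "dist t s < e" for t
      using lip[of s t] lip[of t s] mono[of s t] mono[of t s] that \<open>s \<in> {0..1}\<close>
      by (cases "s \<le> t") (auto simp: dist_real_def abs_if)
    then show "\<exists>d>0. \<forall>t\<in>{0..1}. dist t s < d \<longrightarrow> dist (?\<phi> t) (?\<phi> s) < e"
      using \<open>e > 0\<close> by auto
  qed
  moreover have "?\<phi> 0 \<le> \<delta>"
  proof -
    have "E \<inter> {..<0} = {}" using E01 by auto
    then show ?thesis using assms by simp
  qed
  moreover have "\<delta> \<le> ?\<phi> 1"
  proof -
    have "prob E \<le> prob ((E \<inter> {..<1}) \<union> {1})"
      using E01 by (intro prob_mono sets.Un meas) (auto simp: sets_restrict_space_iff)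
    also have "\<dots> \<le> ?\<phi> 1 + prob {1}"
      by (intro measure_Un_le meas) (auto simp: sets_restrict_space_iff)
    also have "prob {1::real} = 0" by (subst measure_restrict_space) auto
    finally show ?thesis using assms by simp
  qed
  ultimately show thesis using IVT'[of ?\<phi> 0 \<delta> 1] that by auto
qed

text \<open>\<open>I\<close> is an initial segment of the lexicographic order: all of
  \<open>{|u| > \<tau>}\<close> with \<open>\<tau> = rearr u r\<close>, and the leftmost piece of
  \<open>{|u| = \<tau>}\<close> that fills it up to measure \<open>r\<close>.\<close>

lemma rank_fun_sandwich:
  assumes u[measurable]: "u \<in> meas01" and "0 < r" "r < 1"
  shows "\<exists>I\<in>sets leb01. prob I = r \<and> {t \<in> {0..1}. rank_fun u t < r} \<subseteq> I \<and> I \<subseteq> {t \<in> {0..1}. rank_fun u t \<le> r}"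
proof -
  define \<tau> where "\<tau> = rearr u r"
  obtain \<sigma> where "0 \<le> \<sigma>" "distr_fun u \<sigma> \<le> r" using distr_fun_small[OF u \<open>0 < r\<close>] .
  then have \<tau>: "0 \<le> \<tau>" "distr_fun u \<tau> \<le> r"
    using rearr_attained[OF u] by (auto simp: \<tau>_def)
  have below: "r < distr_fun u \<sigma>" if "0 \<le> \<sigma>" "\<sigma> < \<tau>" for \<sigma>
    using that less_rearr_iff[OF u \<open>0 < r\<close>] by (simp add: \<tau>_def)
  define H where "H = {t \<in> {0..1}. \<bar>u t\<bar> > \<tau>}"
  define E where "E = {t \<in> {0..1}. \<bar>u t\<bar> = \<tau>}"
  have H[measurable]: "H \<in> sets leb01" unfolding H_def by (intro sets_superlevel u)
  have "{t \<in> space leb01. \<bar>u t\<bar> = \<tau>} \<in> sets leb01" by measurable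
  then have E[measurable]: "E \<in> sets leb01" by (simp add: E_def prob_leb01)
  \<comment> \<open>The level set suffices to reach measure \<open>r\<close>: at levels below
    \<open>\<tau>\<close> the superlevel sets have measure above \<open>r\<close>, and they decrease
    to \<open>{|u| \<ge> \<tau>}\<close>.\<close>
  have HE: "prob (H \<union> E) \<ge> r"
  proof (cases "\<tau> = 0")
    case True
    then have "H \<union> E = {0..1}" by (auto simp: H_def E_def)
    then show ?thesis using \<open>r < 1\<close> by (simp add: prob_leb01)
  next
    case False
    then have "\<tau> > 0" using \<tau> by simp
    let ?A = "\<lambda>n::nat. {t \<in> {0..1}. \<bar>u t\<bar> > \<tau> - \<tau> / real (Suc n)}"
    have "(\<lambda>n. prob (?A n)) \<longlonglongrightarrow> prob (\<Inter>n. ?A n)"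
    proof (rule leb01.finite_Lim_measure_decseq)
      show "range ?A \<subseteq> sets leb01" by (blast intro: sets_superlevel assms)
      show "decseq ?A"
      proof (rule decseq_SucI, safe)
        fix n t assume "\<tau> - \<tau> / real (Suc (Suc n)) < \<bar>u t\<bar>"
        moreover have "\<tau> / real (Suc (Suc n)) \<le> \<tau> / real (Suc n)"
          using \<open>\<tau> > 0\<close> by (intro divide_left_mono) auto
        ultimately show "\<tau> - \<tau> / real (Suc n) < \<bar>u t\<bar>" by linarith
      qed
    qed
    moreover have "r \<le> prob (?A n)" for n
    proof -
      have "\<tau> / real (Suc n) \<le> \<tau>" "\<tau> / real (Suc n) > 0"
        using \<open>\<tau> > 0\<close> by (auto simp: field_simps)
      then show ?thesis using below[of "\<tau> - \<tau> / real (Suc n)"] by (simp add: distr_fun_def)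
    qed
    ultimately have "r \<le> prob (\<Inter>n. ?A n)"
      by (intro LIMSEQ_le_const) auto
    also have "(\<Inter>n. ?A n) \<subseteq> H \<union> E"
    proof
      fix t assume t: "t \<in> (\<Inter>n. ?A n)"
      have "(\<lambda>n. \<tau> - \<tau> / real (Suc n)) \<longlonglongrightarrow> \<tau> - 0"
        by (intro tendsto_diff tendsto_const LIMSEQ_Suc lim_const_over_n)
      then have "\<tau> - 0 \<le> \<bar>u t\<bar>"
        by (rule LIMSEQ_le_const2) (use t in \<open>auto intro: less_imp_le\<close>)
      then show "t \<in> H \<union> E" using t by (auto simp: H_def E_def)
    qed
    then have "prob (\<Inter>n. ?A n) \<le> prob (H \<union> E)"
      by (intro prob_mono) auto
    finally show ?thesis .
  qed
  have disj: "H \<inter> E = {}" by (auto simp: H_def E_def)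
  have mH: "prob H = distr_fun u \<tau>" by (simp add: H_def distr_fun_def)
  have "prob (H \<union> E) = prob H + prob E"
    using disj by (intro leb01.finite_measure_Union) auto
  then obtain t0 where t0: "prob (E \<inter> {..<t0}) = r - prob H" "0 \<le> t0" "t0 \<le> 1"
    using initial_part_of_measure[OF E, of "r - prob H"] HE \<tau> mH by auto
  define I where "I = H \<union> (E \<inter> {..<t0})"
  have E0: "E \<inter> {..<t} \<in> sets leb01" for t
  proof -
    have "E \<inter> {..<t} = E \<inter> ({..<t} \<inter> {0..1})" by (auto simp: E_def)
    moreover have "{..<t} \<inter> {0..1} \<in> sets leb01" by (auto simp: sets_restrict_space_iff)
    ultimately show ?thesis using E by auto
  qed
  have I: "I \<in> sets leb01" using H E0 by (auto simp: I_def)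
  have mI: "prob I = r"
    unfolding I_def using t0 disj E0 by (subst leb01.finite_measure_Union) auto
  have rE: "rank_fun u t = prob H + prob (E \<inter> {..<t})" if "t \<in> E" for t
  proof -
    have "{s \<in> {0..1}. \<bar>u s\<bar> > \<bar>u t\<bar> \<or> (\<bar>u s\<bar> = \<bar>u t\<bar> \<and> s < t)} = H \<union> (E \<inter> {..<t})"
      using that by (auto simp: H_def E_def)
    then show ?thesis unfolding rank_fun_def
      using disj E0 by (subst leb01.finite_measure_Union[symmetric]) auto
  qed
  have "I \<subseteq> {t \<in> {0..1}. rank_fun u t \<le> r}"
  proof
    fix t assume "t \<in> I"
    then consider "t \<in> H" | "t \<in> E" "t < t0" by (auto simp: I_def)
    then show "t \<in> {t \<in> {0..1}. rank_fun u t \<le> r}"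
    proof cases
      case 1
      then have "rank_fun u t \<le> prob H"
        unfolding rank_fun_def by (intro prob_mono[OF _ H]) (auto simp: H_def)
      then show ?thesis using 1 mH \<tau> by (auto simp: H_def)
    next
      case 2
      have "prob (E \<inter> {..<t}) \<le> prob (E \<inter> {..<t0})"
        using 2 E0 by (intro prob_mono) auto
      then show ?thesis using rE[OF 2(1)] t0 2 by (auto simp: E_def)
    qed
  qed
  moreover have "{t \<in> {0..1}. rank_fun u t < r} \<subseteq> I"
  proof safe
    fix t assume t: "t \<in> {0..1::real}" "rank_fun u t < r"
    show "t \<in> I"
    proof (rule ccontr)
      assume "t \<notin> I"
      then consider "\<bar>u t\<bar> < \<tau>" | "t \<in> E" "t0 \<le> t"
        using t by (force simp: I_def H_def E_def)
      then show False
      proof cases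
        case 1
        have "distr_fun u \<bar>u t\<bar> \<le> rank_fun u t"
          unfolding rank_fun_def distr_fun_def
          by (intro prob_mono rank_fun_set_measurable u) auto
        then show False using below[of "\<bar>u t\<bar>"] 1 t by auto
      next
        case 2
        have "prob (E \<inter> {..<t0}) \<le> prob (E \<inter> {..<t})"
          using 2 E0 by (intro prob_mono) auto
        then show False using rE[OF 2(1)] t0 t by auto
      qed
    qed
  qed
  ultimately show ?thesis using I mI by blast
qed

section \<open>Uniform distribution of the rank\<close>

lemma measurable_sublevel01:
  assumes [measurable]: "f \<in> meas01"
  shows "{t \<in> {0..1}. f t < (r::real)} \<in> sets leb01" "{t \<in> {0..1}. f t \<le> r} \<in> sets leb01"
proof -
  have "Measurable.pred leb01 (\<lambda>t. f t < r)" "Measurable.pred leb01 (\<lambda>t. f t \<le> r)" by measurable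
  then show "{t \<in> {0..1}. f t < r} \<in> sets leb01" "{t \<in> {0..1}. f t \<le> r} \<in> sets leb01"
    by (auto intro: sets_Collect01(1) simp del: atLeastAtMost_iff)
qed

lemma measure_rank_fun_le:
  assumes u[measurable]: "u \<in> meas01" and "0 \<le> r"
  shows "prob {t \<in> {0..1}. rank_fun u t \<le> r} \<le> r"
proof (rule field_le_epsilon)
  fix e :: real assume "e > 0"
  show "prob {t \<in> {0..1}. rank_fun u t \<le> r} \<le> r + e"
  proof (cases "r + e < 1")
    case True
    then obtain I where I: "I \<in> sets leb01" "prob I = r + e"
        "{t \<in> {0..1}. rank_fun u t < r + e} \<subseteq> I"
      using rank_fun_sandwich[OF u, of "r + e"] \<open>e > 0\<close> \<open>0 \<le> r\<close> by auto
    have "prob {t \<in> {0..1}. rank_fun u t \<le> r} \<le> prob I"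
      using I \<open>e > 0\<close> by (intro prob_mono) auto
    then show ?thesis using I by simp
  next
    case False
    then show ?thesis using prob_le_1[of "{t \<in> {0..1}. rank_fun u t \<le> r}"] by simp
  qed
qed

text \<open>Squeezed between the sets of the sandwich at \<open>r - e\<close> and
  \<open>r + e\<close>. Rank 0 is a null set and is left out because \<open>rearr\<close> is used at
  positive arguments only.\<close>

lemma measure_rank_fun_less:
  assumes u[measurable]: "u \<in> meas01" and "0 \<le> r" "r \<le> 1"
  shows "prob {t \<in> {0..1}. 0 < rank_fun u t \<and> rank_fun u t < r} = r"
proof -
  have zero: "prob {t \<in> {0..1}. rank_fun u t \<le> 0} = 0"
    using measure_rank_fun_le[OF u, of 0] by (simp add: measure_le_0_iff)
  have "prob {t \<in> {0..1}. rank_fun u t < r} \<le> prob {t \<in> {0..1}. rank_fun u t \<le> r}"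
    by (intro prob_mono measurable_sublevel01) auto
  then have le: "prob {t \<in> {0..1}. rank_fun u t < r} \<le> r"
    using measure_rank_fun_le[OF u \<open>0 \<le> r\<close>] by simp
  have ge: "r \<le> prob {t \<in> {0..1}. rank_fun u t < r}"
  proof (rule field_le_epsilon)
    fix e :: real assume "e > 0"
    show "r \<le> prob {t \<in> {0..1}. rank_fun u t < r} + e"
    proof (cases "0 < r - e")
      case True
      then obtain I where I: "I \<in> sets leb01" "prob I = r - e"
          "I \<subseteq> {t \<in> {0..1}. rank_fun u t \<le> r - e}"
        using rank_fun_sandwich[OF u, of "r - e"] \<open>e > 0\<close> \<open>r \<le> 1\<close> by auto
      have "prob I \<le> prob {t \<in> {0..1}. rank_fun u t < r}"
        using I \<open>e > 0\<close> by (intro prob_mono measurable_sublevel01) auto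
      then show ?thesis using I by simp
    next
      case False
      then show ?thesis
        using measure_nonneg[of leb01 "{t \<in> {0..1}. rank_fun u t < r}"] by linarith
    qed
  qed
  have split: "{t \<in> {0..1}. 0 < rank_fun u t \<and> rank_fun u t < r} =
      {t \<in> {0..1}. rank_fun u t < r} - {t \<in> {0..1}. rank_fun u t \<le> 0}" by auto
  show ?thesis
  proof (cases "r = 0")
    case False
    then have "{t \<in> {0..1}. rank_fun u t \<le> 0} \<subseteq> {t \<in> {0..1}. rank_fun u t < r}"
      using \<open>0 \<le> r\<close> by auto
    then show ?thesis unfolding split
      using le ge zero
      by (subst leb01.finite_measure_Diff[OF measurable_sublevel01(1) measurable_sublevel01(2)]) auto
  next
    case True
    then have "{t \<in> {0..1}. 0 < rank_fun u t \<and> rank_fun u t < r} = {}" by auto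
    then show ?thesis using True by (metis measure_empty)
  qed
qed

text \<open>The minimum is the Frechet-Hoeffding bound for a joint tail with given marginals. So for
  \<open>v'\<close> equimeasurable with \<open>v\<close> this says that \<open>|u|\<close> and
  \<open>|v'|\<close> are large together as much as their distributions permit.\<close>

definition comonotone_bound :: "(real \<Rightarrow> real) \<Rightarrow> (real \<Rightarrow> real) \<Rightarrow> (real \<Rightarrow> real) \<Rightarrow> bool" where
  "comonotone_bound u v v' \<longleftrightarrow> (\<forall>\<alpha>\<ge>0. \<forall>\<beta>\<ge>0.
     min (distr_fun u \<alpha>) (distr_fun v \<beta>) \<le> prob {t \<in> {0..1}. \<bar>u t\<bar> > \<alpha> \<and> \<bar>v' t\<bar> > \<beta>})"

text \<open>Composing the decreasing rearrangement of \<open>v\<close> with the uniformly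
  distributed rank of \<open>u\<close> keeps the distribution of \<open>v\<close> and makes the
  superlevel sets of both functions initial segments of one order, hence nested up to null
  sets.\<close>

lemma comonotone_rearrangement:
  assumes u[measurable]: "u \<in> meas01" and v[measurable]: "v \<in> meas01"
  obtains v' where "v' \<in> meas01" "equimeasurable v' v" "comonotone_bound u v v'"
proof -
  define v' where "v' t = (if 0 < rank_fun u t then rearr v (rank_fun u t) else 0)" for t
  have pos: "0 \<le> v' t" for t using rearr_nonneg[OF v] by (simp add: v'_def)
  have lev: "\<beta> < \<bar>v' t\<bar> \<longleftrightarrow> 0 < rank_fun u t \<and> rank_fun u t < distr_fun v \<beta>" if "0 \<le> \<beta>" for \<beta> t
    using less_rearr_iff[OF v _ that, of "rank_fun u t"] pos[of t] that by (auto simp: v'_def)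
  have meas: "v' \<in> meas01"
  proof (rule borel_measurable_iff_greater[THEN iffD2], intro allI)
    fix \<beta>
    show "{t \<in> space leb01. \<beta> < v' t} \<in> sets leb01"
    proof (cases "0 \<le> \<beta>")
      case True
      then have "{t \<in> space leb01. \<beta> < v' t} =
          {t \<in> space leb01. 0 < rank_fun u t \<and> rank_fun u t < distr_fun v \<beta>}"
        using lev[OF True] pos by auto
      also have "\<dots> \<in> sets leb01" by measurable
      finally show ?thesis .
    next
      case False
      then have "{t \<in> space leb01. \<beta> < v' t} = space leb01"
        using pos by (auto intro: less_le_trans[of _ 0])
      then show ?thesis by simp
    qed
  qed
  have d: "distr_fun v' \<beta> = distr_fun v \<beta>" if "0 \<le> \<beta>" for \<beta>
    using measure_rank_fun_less[OF u distr_fun_bounds, of v \<beta>] lev[OF that]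
    by (simp add: distr_fun_def)
  show thesis
  proof (rule that[OF meas])
    show "equimeasurable v' v" using d by (simp add: equimeasurable_def)
    show "comonotone_bound u v v'" unfolding comonotone_bound_def
    proof (intro allI impI)
      fix \<alpha> \<beta> :: real assume "0 \<le> \<alpha>" "0 \<le> \<beta>"
      let ?M = "{t \<in> {0..1}. \<bar>u t\<bar> > \<alpha> \<and> \<bar>v' t\<bar> > \<beta>}"
      have "{t \<in> space leb01. \<bar>u t\<bar> > \<alpha> \<and> \<bar>v' t\<bar> > \<beta>} \<in> sets leb01"
        using meas by measurable
      then have M: "?M \<in> sets leb01" by (simp add: prob_leb01)
      \<comment> \<open>If a point outside \<open>{|u| > \<alpha>}\<close> has rank below
        \<open>distr_fun v \<beta>\<close>, then so has all of \<open>{|u| > \<alpha>}\<close>,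
        which thus lies in \<open>{|v'| > \<beta>}\<close> up to rank 0; otherwise the inclusion
        goes the other way.\<close>
      show "min (distr_fun u \<alpha>) (distr_fun v \<beta>) \<le> prob ?M"
      proof (cases "\<exists>t\<in>{0..1}. \<bar>u t\<bar> \<le> \<alpha> \<and> rank_fun u t < distr_fun v \<beta>")
        case True
        then obtain t where t: "t \<in> {0..1}" "\<bar>u t\<bar> \<le> \<alpha>" "rank_fun u t < distr_fun v \<beta>" by auto
        have "distr_fun u \<alpha> \<le> prob (?M \<union> {s \<in> {0..1}. rank_fun u s \<le> 0})"
          unfolding distr_fun_def
        proof (intro prob_mono sets.Un M measurable_sublevel01 rank_fun_measurable u, safe)
          fix s assume "\<alpha> < \<bar>u s\<bar>" "\<not> rank_fun u s \<le> 0"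
          then show "\<beta> < \<bar>v' s\<bar>"
            using rank_fun_mono[OF u, of t s] t lev[OF \<open>0 \<le> \<beta>\<close>, of s] by auto
        qed
        also have "\<dots> \<le> prob ?M + prob {s \<in> {0..1}. rank_fun u s \<le> 0}"
          by (intro measure_Un_le M measurable_sublevel01) auto
        finally show ?thesis using measure_rank_fun_le[OF u, of 0] by simp
      next
        case False
        have "distr_fun v \<beta> = distr_fun v' \<beta>" using d \<open>0 \<le> \<beta>\<close> by simp
        also have "\<dots> \<le> prob ?M"
          unfolding distr_fun_def using False lev[OF \<open>0 \<le> \<beta>\<close>]
          by (intro prob_mono M) force
        finally show ?thesis by simp
      qed
    qed
  qed
qed

text \<open>With \<open>p\<close> the measure of \<open>{|u v'| > \<tau>}\<close>, levels with
  product at least \<open>\<tau>\<close> satisfy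
  \<open>min (distr_fun u \<alpha>) (distr_fun v \<beta>) \<le> p\<close>. At the critical level
  \<open>\<alpha> = rearr u p\<close> both \<open>distr_fun u \<alpha>\<close> and
  \<open>distr_fun v (\<tau> / \<alpha>)\<close> are at most \<open>p\<close>. Since
  \<open>|f g| > \<tau>\<close> forces \<open>|f| > \<alpha>\<close> or
  \<open>|g| > \<tau> / \<alpha>\<close>, the factor 2 results.\<close>

lemma distr_fun_mult_le:
  assumes meas[measurable]: "u \<in> meas01" "v \<in> meas01"
      "v' \<in> meas01" "f \<in> meas01" "g \<in> meas01"
    and como: "comonotone_bound u v v'"
    and "0 \<le> C"
    and f: "\<And>\<tau>. \<tau> > 0 \<Longrightarrow> distr_fun f \<tau> \<le> C * distr_fun u \<tau>"
    and g: "\<And>\<tau>. \<tau> > 0 \<Longrightarrow> distr_fun g \<tau> \<le> C * distr_fun v \<tau>"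
    and "\<tau> > 0"
  shows "distr_fun (\<lambda>t. f t * g t) \<tau> \<le> 2 * C * distr_fun (\<lambda>t. u t * v' t) \<tau>"
proof -
  define p where "p = distr_fun (\<lambda>t. u t * v' t) \<tau>"
  have "0 \<le> p" by (simp add: p_def distr_fun_bounds)
  have mn: "min (distr_fun u \<alpha>) (distr_fun v \<beta>) \<le> p" if "0 \<le> \<alpha>" "0 \<le> \<beta>" "\<tau> \<le> \<alpha> * \<beta>" for \<alpha> \<beta>
  proof -
    have "min (distr_fun u \<alpha>) (distr_fun v \<beta>) \<le> prob {t \<in> {0..1}. \<bar>u t\<bar> > \<alpha> \<and> \<bar>v' t\<bar> > \<beta>}"
      using como that by (simp add: comonotone_bound_def)
    also have "\<dots> \<le> p" unfolding p_def distr_fun_def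
    proof (intro prob_mono sets_superlevel, safe)
      fix t assume "\<alpha> < \<bar>u t\<bar>" "\<beta> < \<bar>v' t\<bar>"
      then have "\<alpha> * \<beta> < \<bar>u t\<bar> * \<bar>v' t\<bar>" using that by (intro mult_strict_mono') auto
      then show "\<tau> < \<bar>u t * v' t\<bar>" using that by (simp add: abs_mult)
    qed measurable
    finally show ?thesis .
  qed
  have f0: "distr_fun f \<alpha> \<le> C * p" if "0 \<le> \<alpha>" "distr_fun u \<alpha> \<le> p" for \<alpha>
  proof (rule distr_fun_right_continuous)
    fix \<sigma> assume "\<alpha> < \<sigma>"
    then have "distr_fun f \<sigma> \<le> C * distr_fun u \<sigma>" using f that by simp
    also have "\<dots> \<le> C * p" using distr_fun_antimono[OF meas(1), of \<alpha> \<sigma>] \<open>\<alpha> < \<sigma>\<close> that \<open>0 \<le> C\<close>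
      by (intro mult_left_mono) auto
    finally show "distr_fun f \<sigma> \<le> C * p" .
  qed fact
  have g0: "distr_fun g \<alpha> \<le> C * p" if "0 \<le> \<alpha>" "distr_fun v \<alpha> \<le> p" for \<alpha>
  proof (rule distr_fun_right_continuous)
    fix \<sigma> assume "\<alpha> < \<sigma>"
    then have "distr_fun g \<sigma> \<le> C * distr_fun v \<sigma>" using g that by simp
    also have "\<dots> \<le> C * p" using distr_fun_antimono[OF meas(2), of \<alpha> \<sigma>] \<open>\<alpha> < \<sigma>\<close> that \<open>0 \<le> C\<close>
      by (intro mult_left_mono) auto
    finally show "distr_fun g \<sigma> \<le> C * p" .
  qed fact
  have Cp: "0 \<le> C * p" using \<open>0 \<le> C\<close> \<open>0 \<le> p\<close> by simp
  have "distr_fun (\<lambda>t. f t * g t) \<tau> \<le> 2 * (C * p)"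
  proof (cases "\<exists>\<alpha>\<ge>0. distr_fun u \<alpha> \<le> p")
    \<comment> \<open>Possible only if \<open>p = 0\<close> and \<open>u\<close> is essentially
      unbounded; then \<open>v\<close>, and with it \<open>g\<close>, vanishes almost
      everywhere.\<close>
    case False
    have "distr_fun v \<beta> \<le> p" if "\<beta> > 0" for \<beta>
    proof -
      have "0 \<le> \<tau> / \<beta>" using that \<open>\<tau> > 0\<close> by simp
      then have "\<not> distr_fun u (\<tau> / \<beta>) \<le> p" using False by blast
      then show ?thesis using mn[of "\<tau> / \<beta>" \<beta>] that \<open>\<tau> > 0\<close> by (simp add: min_le_iff_disj)
    qed
    then have "distr_fun v 0 \<le> p" by (rule distr_fun_right_continuous[OF meas(2)])
    then have "distr_fun g 0 \<le> C * p" by (intro g0) simp_all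
    moreover have "distr_fun (\<lambda>t. f t * g t) \<tau> \<le> distr_fun g 0"
    proof (rule distr_fun_mono_AE[OF meas(5)])
      show "AE t in leb01. \<tau> < \<bar>f t * g t\<bar> \<longrightarrow> 0 < \<bar>g t\<bar>" using \<open>\<tau> > 0\<close> by (intro AE_I2) auto
    qed measurable
    ultimately show ?thesis using Cp by simp
  next
    case True
    then obtain \<sigma> where \<sigma>: "0 \<le> \<sigma>" "distr_fun u \<sigma> \<le> p" by auto
    define \<alpha> where "\<alpha> = rearr u p"
    have \<alpha>: "0 \<le> \<alpha>" "distr_fun u \<alpha> \<le> p" using rearr_attained[OF meas(1) \<sigma>] by (auto simp: \<alpha>_def)
    show ?thesis
    proof (cases "\<alpha> = 0")
      \<comment> \<open>\<open>\<tau> / \<alpha>\<close> makes no sense here, but the support of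
        \<open>f\<close> alone is small enough.\<close>
      case True
      have "distr_fun (\<lambda>t. f t * g t) \<tau> \<le> distr_fun f 0"
      proof (rule distr_fun_mono_AE[OF meas(4)])
        show "AE t in leb01. \<tau> < \<bar>f t * g t\<bar> \<longrightarrow> 0 < \<bar>f t\<bar>" using \<open>\<tau> > 0\<close> by (intro AE_I2) auto
      qed measurable
      then show ?thesis using f0[of \<alpha>] \<alpha> True Cp by simp
    next
      case False
      then have "\<alpha> > 0" using \<alpha> by simp
      \<comment> \<open>For \<open>\<beta> > \<tau> / \<alpha>\<close> the level
        \<open>\<tau> / \<beta>\<close> is below the critical one, where \<open>distr_fun u\<close>
        exceeds \<open>p\<close>; so the minimum that is at most \<open>p\<close> must be
        \<open>distr_fun v \<beta>\<close>.\<close>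
      have "distr_fun v (\<tau> / \<alpha>) \<le> p"
      proof (rule distr_fun_right_continuous)
        fix \<beta> assume \<beta>: "\<tau> / \<alpha> < \<beta>"
        have "0 < \<tau> / \<alpha>" using \<open>\<alpha> > 0\<close> \<open>\<tau> > 0\<close> by simp
        then have "\<beta> > 0" using \<beta> by linarith
        then have "\<tau> / \<beta> < \<alpha>" using \<beta> \<open>\<alpha> > 0\<close> by (simp add: field_simps)
        then have "p < distr_fun u (\<tau> / \<beta>)"
          using rearr_attained(3)[OF meas(1), of "\<tau> / \<beta>" p] \<open>\<beta> > 0\<close> \<open>\<tau> > 0\<close>
          by (cases "distr_fun u (\<tau> / \<beta>) \<le> p") (simp_all add: \<alpha>_def[symmetric])
        then show "distr_fun v \<beta> \<le> p"
          using mn[of "\<tau> / \<beta>" \<beta>] \<open>\<beta> > 0\<close> \<open>\<tau> > 0\<close>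
          by (simp add: min_le_iff_disj)
      qed fact
      then have "distr_fun g (\<tau> / \<alpha>) \<le> C * p" using \<open>\<alpha> > 0\<close> \<open>\<tau> > 0\<close> by (intro g0) simp_all
      moreover have "distr_fun f \<alpha> \<le> C * p" using \<alpha> by (intro f0) simp_all
      moreover have "distr_fun (\<lambda>t. f t * g t) \<tau> \<le> distr_fun f \<alpha> + distr_fun g (\<tau> / \<alpha>)"
      proof -
        have "distr_fun (\<lambda>t. f t * g t) \<tau> \<le>
            prob ({t \<in> {0..1}. \<bar>f t\<bar> > \<alpha>} \<union> {t \<in> {0..1}. \<bar>g t\<bar> > \<tau> / \<alpha>})"
          unfolding distr_fun_def
        proof (intro prob_mono sets.Un sets_superlevel, safe)
          fix t assume "\<tau> < \<bar>f t * g t\<bar>" "\<not> \<tau> / \<alpha> < \<bar>g t\<bar>"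
          then have g: "\<bar>g t\<bar> \<le> \<tau> / \<alpha>" by simp
          show "\<alpha> < \<bar>f t\<bar>"
          proof (rule ccontr)
            assume "\<not> ?thesis"
            then have "\<bar>f t\<bar> * \<bar>g t\<bar> \<le> \<alpha> * (\<tau> / \<alpha>)" using g \<open>\<alpha> > 0\<close> by (intro mult_mono) auto
            then show False using \<open>\<tau> < \<bar>f t * g t\<bar>\<close> \<open>\<alpha> > 0\<close> by (simp add: abs_mult)
          qed
        qed measurable
        also have "\<dots> \<le> distr_fun f \<alpha> + distr_fun g (\<tau> / \<alpha>)"
          unfolding distr_fun_def by (intro measure_Un_le sets_superlevel) auto
        finally show ?thesis .
      qed
      ultimately show ?thesis by linarith
    qed
  qed
  then show ?thesis by (simp add: p_def)
qed

subsection \<open>Symmetric spaces and the Koethe dual\<close>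

lemma geometric_half_sum:
  "M \<le> N \<Longrightarrow> (\<Sum>k=M..<N. (1/2::real) ^ k) = 2 * (1/2) ^ M - 2 * (1/2) ^ N"
  by (induction N rule: dec_induct) auto

context
  fixes X :: fspace
  assumes X: "symmetric_space X"
begin

section \<open>Elementary properties of a symmetric space\<close>

lemma banach_X: "banach_function_space X"
  using X by (simp add: symmetric_space_def)

lemma carr_measurable: "x \<in> carr X \<Longrightarrow> x \<in> meas01"
  using banach_X unfolding banach_function_space_def by blast

lemma zero_in_carr: "(\<lambda>t. 0) \<in> carr X"
  using banach_X unfolding banach_function_space_def by blast

lemma add_in_carr: "x \<in> carr X \<Longrightarrow> y \<in> carr X \<Longrightarrow> (\<lambda>t. x t + y t) \<in> carr X"
  and nrm_triangle: "x \<in> carr X \<Longrightarrow> y \<in> carr X \<Longrightarrow> nrm X (\<lambda>t. x t + y t) \<le> nrm X x + nrm X y"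
  and scale_in_carr: "x \<in> carr X \<Longrightarrow> (\<lambda>t. c * x t) \<in> carr X"
  and nrm_scale: "x \<in> carr X \<Longrightarrow> nrm X (\<lambda>t. c * x t) = \<bar>c\<bar> * nrm X x"
  and nrm_nonneg: "x \<in> carr X \<Longrightarrow> 0 \<le> nrm X x"
  and nrm_eq_0_iff: "x \<in> carr X \<Longrightarrow> nrm X x = 0 \<longleftrightarrow> (AE t in leb01. x t = 0)"
  using banach_X unfolding banach_function_space_def by blast+

lemma complete_X:
  assumes "\<And>n::nat. f n \<in> carr X"
    and "\<And>e. e > 0 \<Longrightarrow> \<exists>M. \<forall>m\<ge>M. \<forall>n\<ge>M. nrm X (\<lambda>t. f m t - f n t) < e"
  obtains x where "x \<in> carr X" "(\<lambda>n. nrm X (\<lambda>t. f n t - x t)) \<longlonglongrightarrow> 0"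
  using banach_X assms unfolding banach_function_space_def by blast

lemma carr_distr_mono:
  assumes "x \<in> carr X" "y \<in> meas01"
    and "\<And>\<tau>. \<tau> > 0 \<Longrightarrow> distr_fun y \<tau> \<le> distr_fun x \<tau>"
  shows "y \<in> carr X" "nrm X y \<le> nrm X x"
proof -
  have "\<forall>s\<in>{0<..<1}. rearr y s \<le> rearr x s"
    using assms carr_measurable by (auto intro!: rearr_mono)
  then show "y \<in> carr X" "nrm X y \<le> nrm X x"
    using X assms(1,2) unfolding symmetric_space_def by blast+
qed

lemma carr_AE_mono:
  assumes "x \<in> carr X" "y \<in> meas01" "AE t in leb01. \<bar>y t\<bar> \<le> \<bar>x t\<bar>"
  shows "y \<in> carr X" "nrm X y \<le> nrm X x"
proof -
  have "distr_fun y \<tau> \<le> distr_fun x \<tau>" for \<tau>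
    by (rule distr_fun_mono_AE[OF carr_measurable[OF assms(1)] assms(2)])
       (use assms(3) in \<open>auto elim!: eventually_mono\<close>)
  then show "y \<in> carr X" "nrm X y \<le> nrm X x"
    using carr_distr_mono assms by blast+
qed

lemma diff_in_carr: "x \<in> carr X \<Longrightarrow> y \<in> carr X \<Longrightarrow> (\<lambda>t. x t - y t) \<in> carr X"
  using add_in_carr[of x "\<lambda>t. (-1) * y t"] scale_in_carr[of y "-1"] by simp

lemma sum_in_carr:
  assumes "finite I" "\<And>i. i \<in> I \<Longrightarrow> f i \<in> carr X"
  shows "(\<lambda>t. \<Sum>i\<in>I. f i t) \<in> carr X \<and> nrm X (\<lambda>t. \<Sum>i\<in>I. f i t) \<le> (\<Sum>i\<in>I. nrm X (f i))"
  using assms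
proof (induction I rule: finite_induct)
  case empty
  have "nrm X (\<lambda>t. 0) = 0" using nrm_eq_0_iff[OF zero_in_carr] by simp
  then show ?case using zero_in_carr by simp
next
  case (insert i I)
  then show ?case
    using add_in_carr[of "f i" "\<lambda>t. \<Sum>i\<in>I. f i t"] nrm_triangle[of "f i" "\<lambda>t. \<Sum>i\<in>I. f i t"]
    by auto
qed

text \<open>Two copies of the decreasing rearrangement, cut to length 1/2, are placed side by side.
  Neither has a larger distribution function than \<open>x\<close>, so both belong to
  \<open>X\<close>, and so does their sum.\<close>

lemma carr_doubling:
  assumes x: "x \<in> carr X"
  obtains h where "h \<in> carr X" "\<And>\<tau>. \<tau> > 0 \<Longrightarrow> min 1 (2 * distr_fun x \<tau>) \<le> distr_fun h \<tau>"
proof -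
  note xm = carr_measurable[OF x]
  define g :: "real \<Rightarrow> real \<Rightarrow> real"
    where "g a t = (if 0 < t - a \<and> t - a < 1/2 then rearr x (t - a) else 0)" for a t
  have g0: "0 \<le> g a t" for a t using rearr_nonneg[OF xm] by (simp add: g_def)
  have lev: "\<beta> < g a t \<longleftrightarrow> t \<in> {a<..<a + min (1/2) (distr_fun x \<beta>)}" if "0 \<le> \<beta>" for a t \<beta>
    using less_rearr_iff[OF xm _ that, of "t - a"] that by (auto simp: g_def)
  have gm: "g a \<in> meas01" for a
  proof (rule borel_measurable_iff_greater[THEN iffD2], intro allI)
    fix \<beta>
    show "{t \<in> space leb01. \<beta> < g a t} \<in> sets leb01"
    proof (cases "0 \<le> \<beta>")
      case True
      have "Measurable.pred leb01 (\<lambda>t. t \<in> {a<..<a + min (1/2) (distr_fun x \<beta>)})"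
        using measurable_ident_leb01 by measurable
      then show ?thesis using lev[OF True] by (simp add: pred_def)
    next
      case False
      then have "{t \<in> space leb01. \<beta> < g a t} = space leb01"
        using g0 by (auto intro: less_le_trans[of _ 0])
      then show ?thesis by simp
    qed
  qed
  have ival: "prob {a<..<a + b} = b" "{a<..<a + b} \<in> sets leb01"
    if "0 \<le> a" "0 \<le> b" "a + b \<le> 1" for a b
  proof -
    have "{a<..<a + b} \<subseteq> {0..1}" using that by auto
    then show "prob {a<..<a + b} = b" "{a<..<a + b} \<in> sets leb01"
      using that by (auto simp: measure_restrict_space sets_restrict_space_iff)
  qed
  have dg: "distr_fun (g a) \<tau> = min (1/2) (distr_fun x \<tau>)" if "0 \<le> a" "a \<le> 1/2" "\<tau> > 0" for a \<tau>
  proof -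
    have "{t \<in> {0..1}. \<tau> < \<bar>g a t\<bar>} = {a<..<a + min (1/2) (distr_fun x \<tau>)}"
      using that lev[of \<tau> a] g0[of a] by auto
    then show ?thesis unfolding distr_fun_def[of "g a"]
      using that distr_fun_bounds[of x \<tau>] by (simp only:) (intro ival, auto)
  qed
  have gX: "g a \<in> carr X" if "0 \<le> a" "a \<le> 1/2" for a
    using carr_distr_mono(1)[OF x gm] dg[OF that] by simp
  define h where "h t = g 0 t + g (1/2) t" for t
  have "h \<in> carr X" unfolding h_def using gX by (intro add_in_carr) auto
  moreover have "min 1 (2 * distr_fun x \<tau>) \<le> distr_fun h \<tau>" if "\<tau> > 0" for \<tau>
  proof -
    let ?b = "min (1/2) (distr_fun x \<tau>)"
    have b: "0 \<le> ?b" "?b \<le> 1/2" using distr_fun_bounds[of x \<tau>] by auto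
    have "min 1 (2 * distr_fun x \<tau>) = ?b + ?b" by (auto simp: min_def)
    also have "\<dots> = prob {0<..<0 + ?b} + prob {1/2<..<1/2 + ?b}"
      using b by (subst (1 2) ival) auto
    also have "\<dots> = prob ({0<..<0 + ?b} \<union> {1/2<..<1/2 + ?b})"
      using b ival(2)[of 0 ?b] ival(2)[of "1/2" ?b] by (subst leb01.finite_measure_Union) auto
    also have "\<dots> \<le> distr_fun h \<tau>"
      unfolding distr_fun_def[of h]
    proof (intro prob_mono sets_superlevel)
      show "h \<in> meas01" unfolding h_def using gm by measurable
      show "{0<..<0 + ?b} \<union> {1/2<..<1/2 + ?b} \<subseteq> {t \<in> {0..1}. \<tau> < \<bar>h t\<bar>}"
      proof
        fix t assume "t \<in> {0<..<0 + ?b} \<union> {1/2<..<1/2 + ?b}"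
        then have "\<tau> < g 0 t \<or> \<tau> < g (1/2) t" "t \<in> {0..1}"
          using lev[of \<tau> 0 t] lev[of \<tau> "1/2" t] that b by auto
        then show "t \<in> {t \<in> {0..1}. \<tau> < \<bar>h t\<bar>}"
          using g0[of 0 t] g0[of "1/2" t] by (auto simp: h_def)
      qed
    qed
    finally show ?thesis .
  qed
  ultimately show thesis using that by blast
qed

text \<open>Iterated doubling; its truncation at 1 is harmless because distribution functions never
  exceed 1.\<close>

lemma carr_dilation_pow2:
  assumes "x \<in> carr X" "y \<in> meas01"
    and "\<And>\<tau>. \<tau> > 0 \<Longrightarrow> distr_fun y \<tau> \<le> 2 ^ k * distr_fun x \<tau>"
  shows "y \<in> carr X"
  using assms
proof (induction k arbitrary: x)
  case 0
  then show ?case using carr_distr_mono(1)[of x y] by simp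
next
  case (Suc k)
  obtain h where h: "h \<in> carr X" "\<And>\<tau>. \<tau> > 0 \<Longrightarrow> min 1 (2 * distr_fun x \<tau>) \<le> distr_fun h \<tau>"
    using carr_doubling[OF Suc.prems(1)] by blast
  have "distr_fun y \<tau> \<le> 2 ^ k * distr_fun h \<tau>" if "\<tau> > 0" for \<tau>
  proof -
    have "distr_fun y \<tau> \<le> 2 ^ k * min 1 (2 * distr_fun x \<tau>)"
    proof (cases "2 * distr_fun x \<tau> \<le> 1")
      case True
      then show ?thesis using Suc.prems(3)[OF that] by (simp add: min_def mult.commute mult.left_commute)
    next
      case False
      have "distr_fun y \<tau> \<le> 1" by (rule distr_fun_bounds)
      also have "(1::real) \<le> 2 ^ k" by simp
      finally show ?thesis using False by (simp add: min_def)
    qed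
    also have "\<dots> \<le> 2 ^ k * distr_fun h \<tau>" using h(2)[OF that] by (intro mult_left_mono) auto
    finally show ?thesis .
  qed
  then show ?case using Suc.IH[OF h(1)] Suc.prems by blast
qed

lemma carr_dilation:
  assumes "x \<in> carr X" "y \<in> meas01"
    and le: "\<And>\<tau>. \<tau> > 0 \<Longrightarrow> distr_fun y \<tau> \<le> C * distr_fun x \<tau>"
  shows "y \<in> carr X"
proof -
  obtain k :: nat where k: "C < 2 ^ k" using real_arch_pow[of 2 C] by auto
  have "distr_fun y \<tau> \<le> 2 ^ k * distr_fun x \<tau>" if "\<tau> > 0" for \<tau>
    using le[OF that] mult_right_mono[of C "2 ^ k" "distr_fun x \<tau>"] k distr_fun_bounds[of x \<tau>] by linarith
  then show ?thesis using carr_dilation_pow2 assms by blast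
qed

text \<open>Gliding hump: if no \<open>C\<close> works, a sum of scaled \<open>|x n|\<close>
  converges in \<open>X\<close> to some \<open>u\<close> that dominates every summand, and the
  integral of \<open>|u y|\<close> exceeds every \<open>2 ^ n\<close>. The lemma serves the Koethe
  dual norm and, with \<open>y = 1 / w\<close>, the weighted space.\<close>

lemma integral_functional_bounded:
  assumes y[measurable]: "y \<in> meas01"
    and int: "\<And>x. x \<in> carr X \<Longrightarrow> integrable leb01 (\<lambda>t. x t * y t)"
  obtains C where "0 \<le> C" "\<And>x. x \<in> carr X \<Longrightarrow> (LINT t|leb01. \<bar>x t * y t\<bar>) \<le> C * nrm X x"
proof (rule ccontr)
  assume "\<not> thesis"
  then have "\<exists>x\<in>carr X. 4 ^ n * nrm X x < (LINT t|leb01. \<bar>x t * y t\<bar>)" for n :: nat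
    using that[of "4 ^ n"] by (force simp: not_le)
  then obtain x where x: "\<And>n::nat. x n \<in> carr X"
      and big: "\<And>n. 4 ^ n * nrm X (x n) < (LINT t|leb01. \<bar>x n t * y t\<bar>)"
    by metis
  have pos: "nrm X (x n) > 0" for n
  proof (rule ccontr)
    assume "\<not> ?thesis"
    then have 0: "nrm X (x n) = 0" using nrm_nonneg[OF x, of n] by simp
    then have "AE t in leb01. x n t = 0" using nrm_eq_0_iff[OF x] by simp
    then have "AE t in leb01. \<bar>x n t * y t\<bar> = 0" by (auto elim!: eventually_mono)
    then have "(LINT t|leb01. \<bar>x n t * y t\<bar>) = 0" by (rule integral_eq_zero_AE)
    then show False using big[of n] 0 by simp
  qed
  \<comment> \<open>The norms become \<open>2^-n\<close>, so the series converges, while the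
    integrals stay above \<open>4 ^ n / 2 ^ n\<close>.\<close>
  define c where "c n = 1 / (2 ^ n * nrm X (x n))" for n
  have c: "c n > 0" for n using pos by (simp add: c_def)
  define z where "z n t = c n * \<bar>x n t\<bar>" for n t
  have z0: "0 \<le> z n t" for n t using c[of n] by (simp add: z_def)
  have zX: "z n \<in> carr X" and nz: "nrm X (z n) \<le> (1/2) ^ n" for n
  proof -
    have m: "z n \<in> meas01"
      using carr_measurable[OF x, of n] unfolding z_def by measurable
    have ae: "AE t in leb01. \<bar>z n t\<bar> \<le> \<bar>c n * x n t\<bar>" by (simp add: z_def abs_mult)
    have cx: "(\<lambda>t. c n * x n t) \<in> carr X" by (rule scale_in_carr[OF x])
    show "z n \<in> carr X" by (rule carr_AE_mono[OF cx m ae])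
    have "nrm X (z n) \<le> nrm X (\<lambda>t. c n * x n t)" by (rule carr_AE_mono[OF cx m ae])
    also have "\<dots> = c n * nrm X (x n)" using c[of n] by (simp add: nrm_scale[OF x])
    also have "\<dots> = (1/2) ^ n" using pos[of n] by (simp add: c_def power_one_over)
    finally show "nrm X (z n) \<le> (1/2) ^ n" .
  qed
  have bigz: "2 ^ n < (LINT t|leb01. z n t * \<bar>y t\<bar>)" for n
  proof -
    have "(LINT t|leb01. z n t * \<bar>y t\<bar>) = (LINT t|leb01. c n * \<bar>x n t * y t\<bar>)"
      by (simp add: z_def abs_mult mult.assoc)
    also have "\<dots> = c n * (LINT t|leb01. \<bar>x n t * y t\<bar>)" by simp
    also have "\<dots> > c n * (4 ^ n * nrm X (x n))" using big[of n] c[of n] by (rule mult_strict_left_mono)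
    also have "c n * (4 ^ n * nrm X (x n)) = 2 ^ n"
      using pos[of n] by (simp add: c_def field_simps flip: power_mult_distrib)
    finally show ?thesis .
  qed
  define T where "T n t = (\<Sum>k<n. z k t)" for n :: nat and t
  have TX: "T n \<in> carr X" for n
    unfolding T_def using sum_in_carr[of "{..<n}" z] zX by simp
  have cauchy: "\<exists>M. \<forall>m\<ge>M. \<forall>n\<ge>M. nrm X (\<lambda>t. T m t - T n t) < e" if "e > 0" for e
  proof -
    obtain M where M: "(1/2::real) ^ M < e / 2" using real_arch_pow_inv[of "e/2" "1/2"] \<open>e > 0\<close> by auto
    have "nrm X (\<lambda>t. T m t - T n t) < e" if mn: "m \<ge> M" "n \<ge> M" for m n
    proof -
      let ?S = "\<lambda>t. \<Sum>k=M..<max m n. z k t"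
      have S: "?S \<in> carr X" "nrm X ?S \<le> (\<Sum>k=M..<max m n. nrm X (z k))"
        using sum_in_carr[of "{M..<max m n}" z] zX by auto
      have Tm: "T j t \<le> T M t + ?S t \<and> T M t \<le> T j t" if "M \<le> j" "j \<le> max m n" for j t
      proof -
        have "T j t = T M t + (\<Sum>k=M..<j. z k t)"
          using sum.atLeastLessThan_concat[of 0 M j "\<lambda>k. z k t"] that
          by (simp add: T_def lessThan_atLeast0)
        moreover have "(\<Sum>k=M..<j. z k t) \<le> ?S t" using that z0 by (intro sum_mono2) auto
        moreover have "0 \<le> (\<Sum>k=M..<j. z k t)" using z0 by (intro sum_nonneg) auto
        ultimately show ?thesis by linarith
      qed
      have bnd: "\<bar>T m t - T n t\<bar> \<le> \<bar>?S t\<bar>" for t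
      proof -
        have "0 \<le> ?S t" using z0 by (intro sum_nonneg) auto
        then show ?thesis using Tm[of m t] Tm[of n t] mn by (auto simp: abs_le_iff)
      qed
      have "nrm X (\<lambda>t. T m t - T n t) \<le> nrm X ?S"
      proof (rule carr_AE_mono(2)[OF S(1)])
        show "(\<lambda>t. T m t - T n t) \<in> meas01"
          using carr_measurable[OF TX] by measurable
      qed (use bnd in simp)
      also have "\<dots> \<le> (\<Sum>k=M..<max m n. (1/2) ^ k)"
        using S(2) sum_mono[of "{M..<max m n}" "\<lambda>k. nrm X (z k)" "\<lambda>k. (1/2) ^ k"] nz by fastforce
      also have "\<dots> = 2 * (1/2) ^ M - 2 * (1/2) ^ max m n"
        using mn by (intro geometric_half_sum) auto
      also have "\<dots> \<le> 2 * (1/2) ^ M" by simp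
      also have "\<dots> < e" using M by simp
      finally show ?thesis .
    qed
    then show ?thesis by blast
  qed
  obtain u where u: "u \<in> carr X" "(\<lambda>n. nrm X (\<lambda>t. T n t - u t)) \<longlonglongrightarrow> 0"
    using complete_X[of T, OF TX cauchy] .
  have zu: "AE t in leb01. z n t \<le> \<bar>u t\<bar>" for n
  proof -
    \<comment> \<open>Norm convergence gives no pointwise limit directly. Instead, the positive part
      of \<open>z n - |u|\<close> is dominated by \<open>|T m - u|\<close> for all
      \<open>m > n\<close>, whose norm tends to 0.\<close>
    let ?p = "\<lambda>t. max 0 (z n t - \<bar>u t\<bar>)"
    have pm: "?p \<in> meas01"
      using carr_measurable[OF zX, of n] carr_measurable[OF u(1)] by measurable
    have *: "?p \<in> carr X \<and> nrm X ?p \<le> nrm X (\<lambda>t. T m t - u t)" if "m > n" for m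
    proof -
      have "z n t \<le> T m t" for t
        unfolding T_def using that z0 by (intro member_le_sum) auto
      moreover have "\<bar>max 0 (p - \<bar>q\<bar>)\<bar> \<le> \<bar>r - q\<bar>" if "p \<le> r" for p q r :: real
        using that by (auto simp: max_def; linarith)
      ultimately have "\<bar>?p t\<bar> \<le> \<bar>T m t - u t\<bar>" for t by blast
      then show ?thesis
        using carr_AE_mono[OF diff_in_carr[OF TX u(1)] pm, of m] by auto
    qed
    have "nrm X ?p \<le> 0"
      by (rule LIMSEQ_le_const[OF u(2)]) (use * in \<open>auto intro!: exI[of _ "Suc n"]\<close>)
    then have "AE t in leb01. ?p t = 0"
      using * nrm_nonneg[of ?p] nrm_eq_0_iff[of ?p] by (metis lessI order_antisym)
    then show ?thesis by (auto elim!: eventually_mono)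
  qed
  have "2 ^ n < (LINT t|leb01. \<bar>u t * y t\<bar>)" for n :: nat
  proof -
    have "(LINT t|leb01. z n t * \<bar>y t\<bar>) \<le> (LINT t|leb01. \<bar>u t * y t\<bar>)"
    proof (rule integral_mono_AE)
      have "integrable leb01 (\<lambda>t. \<bar>z n t * y t\<bar>)" using int[OF zX] by simp
      then show "integrable leb01 (\<lambda>t. z n t * \<bar>y t\<bar>)" using z0 by (simp add: abs_mult)
      show "integrable leb01 (\<lambda>t. \<bar>u t * y t\<bar>)" using int[OF u(1)] by simp
      show "AE t in leb01. z n t * \<bar>y t\<bar> \<le> \<bar>u t * y t\<bar>"
        using zu[of n] by (auto elim!: eventually_mono simp: abs_mult intro: mult_right_mono)
    qed
    then show ?thesis using bigz[of n] by linarith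
  qed
  moreover obtain n :: nat where "(LINT t|leb01. \<bar>u t * y t\<bar>) < 2 ^ n"
    using real_arch_pow[of 2] by auto
  ultimately show False by (meson less_asym)
qed

section \<open>The Koethe dual and the bidual norm\<close>

lemma koethe_dual_carr:
  "y \<in> carr (koethe_dual X) \<longleftrightarrow>
     y \<in> meas01 \<and> (\<forall>x\<in>carr X. integrable leb01 (\<lambda>t. x t * y t))"
  by (simp add: koethe_dual_def)

text \<open>The dual norm is a real \<open>Sup\<close>, which is informative only for a set bounded
  above; the gliding hump provides that bound. Homogeneity then leads from the unit ball to all
  \<open>x\<close>.\<close>

lemma koethe_dual_holder:
  assumes y: "y \<in> carr (koethe_dual X)" and "nrm (koethe_dual X) y \<le> 1" and x: "x \<in> carr X"
  shows "\<bar>LINT t|leb01. x t * y t\<bar> \<le> nrm X x"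
proof -
  let ?S = "{(LINT t|leb01. x t * y t) | x. x \<in> carr X \<and> nrm X x \<le> 1}"
  have int: "integrable leb01 (\<lambda>t. x t * y t)" if "x \<in> carr X" for x
    using y that by (simp add: koethe_dual_carr)
  obtain C where C: "0 \<le> C" "\<And>x. x \<in> carr X \<Longrightarrow> (LINT t|leb01. \<bar>x t * y t\<bar>) \<le> C * nrm X x"
    using integral_functional_bounded[of y] y by (auto simp: koethe_dual_carr)
  have "bdd_above ?S"
  proof (rule bdd_aboveI[of _ C], safe)
    fix x assume x: "x \<in> carr X" "nrm X x \<le> 1"
    have "(LINT t|leb01. x t * y t) \<le> (LINT t|leb01. \<bar>x t * y t\<bar>)"
      using int[OF x(1)] by (intro integral_mono) auto
    also have "\<dots> \<le> C * nrm X x" by (rule C(2)[OF x(1)])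
    also have "\<dots> \<le> C * 1" using C(1) x by (intro mult_left_mono) auto
    finally show "(LINT t|leb01. x t * y t) \<le> C" by simp
  qed
  then have unit: "(LINT t|leb01. x t * y t) \<le> 1" if "x \<in> carr X" "nrm X x \<le> 1" for x
  proof -
    have "(LINT t|leb01. x t * y t) \<le> Sup ?S" using that \<open>bdd_above ?S\<close> by (intro cSup_upper) auto
    then show ?thesis using assms(2) by (simp add: koethe_dual_def)
  qed
  show ?thesis
  proof (cases "nrm X x = 0")
    case True
    then have "AE t in leb01. x t = 0" using nrm_eq_0_iff[OF x] by simp
    then have "AE t in leb01. x t * y t = 0" by (auto elim!: eventually_mono)
    then have "(LINT t|leb01. x t * y t) = 0" by (rule integral_eq_zero_AE)
    then show ?thesis using True by simp
  next
    case False
    then have pos: "nrm X x > 0" using nrm_nonneg[OF x] by simp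
    have "c * (LINT t|leb01. x t * y t) \<le> 1" if "\<bar>c\<bar> = 1 / nrm X x" for c
    proof -
      have "(LINT t|leb01. (c * x t) * y t) \<le> 1"
        using scale_in_carr[OF x] nrm_scale[OF x, of c] that pos by (intro unit) auto
      then show ?thesis by (simp add: mult.assoc)
    qed
    from this[of "1 / nrm X x"] this[of "- 1 / nrm X x"] pos show ?thesis
      by (simp add: field_simps abs_le_iff)
  qed
qed

lemma nrm_le_via_bidual:
  assumes bidual: "nrm X x = nrm (koethe_dual (koethe_dual X)) x"
    and x: "x \<in> carr X"
    and le: "\<And>y. y \<in> carr (koethe_dual X) \<Longrightarrow> nrm (koethe_dual X) y \<le> 1 \<Longrightarrow> (LINT t|leb01. x t * y t) \<le> K"
  shows "nrm X x \<le> K"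
proof -
  let ?S = "{(LINT t|leb01. y t * x t) | y. y \<in> carr (koethe_dual X) \<and> nrm (koethe_dual X) y \<le> 1}"
  have "Sup ?S \<le> K"
  proof (rule cSup_least)
    \<comment> \<open>The zero functional makes the set nonempty; its dual norm is the
      \<open>Sup\<close> of \<open>{0}\<close>.\<close>
    have "(\<lambda>t. 0) \<in> carr (koethe_dual X)" by (simp add: koethe_dual_carr)
    moreover have "{(LINT t|leb01. x t * 0) | x. x \<in> carr X \<and> nrm X x \<le> 1} = {0}"
    proof -
      have "nrm X (\<lambda>t. 0) = 0" using nrm_eq_0_iff[OF zero_in_carr] by simp
      then show ?thesis using zero_in_carr by (auto intro!: exI[of _ "\<lambda>t. 0"])
    qed
    then have "nrm (koethe_dual X) (\<lambda>t. 0) \<le> 1" by (simp add: koethe_dual_def)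
    ultimately show "?S \<noteq> {}" by blast
  qed (use le in \<open>auto simp: mult.commute\<close>)
  then show ?thesis using bidual by (simp add: koethe_dual_def[of "koethe_dual X"])
qed

text \<open>The inclusion in \<open>L_1\<close> says that \<open>1 / w\<close> belongs to the Koethe
  dual of \<open>X\<close>; integration against it is a bounded functional.\<close>

lemma weighted_L1_bound:
  assumes w[measurable]: "w \<in> meas01" and pos: "AE t in leb01. w t > 0"
    and L1: "carr (weighted_space X w) \<subseteq> L_1"
  obtains C where "C > 0" "\<And>f. f \<in> carr (weighted_space X w) \<Longrightarrow>
     (LINT t|leb01. \<bar>f t\<bar>) \<le> C * nrm X (\<lambda>t. f t * w t)"
proof -
  have int: "integrable leb01 (\<lambda>t. x t * (1 / w t))" if x: "x \<in> carr X" for x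
  proof -
    have xm[measurable]: "x \<in> meas01" by (rule carr_measurable[OF x])
    have "(\<lambda>t. x t * (1 / w t) * w t) \<in> carr X"
      by (rule carr_AE_mono(1)[OF x]) (use pos in \<open>auto elim!: eventually_mono\<close>)
    then have "(\<lambda>t. x t * (1 / w t)) \<in> carr (weighted_space X w)"
      by (simp add: weighted_space_def)
    then show ?thesis using L1 by (auto simp: L_1_def)
  qed
  have m: "(\<lambda>t. 1 / w t) \<in> meas01" by measurable
  obtain C where C: "0 \<le> C" "\<And>x. x \<in> carr X \<Longrightarrow> (LINT t|leb01. \<bar>x t * (1 / w t)\<bar>) \<le> C * nrm X x"
    using integral_functional_bounded[OF m int] by blast
  have "(LINT t|leb01. \<bar>f t\<bar>) \<le> (C + 1) * nrm X (\<lambda>t. f t * w t)"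
    if f: "f \<in> carr (weighted_space X w)" for f
  proof -
    have fm[measurable]: "f \<in> meas01" and fw: "(\<lambda>t. f t * w t) \<in> carr X"
      using f by (auto simp: weighted_space_def)
    have "(LINT t|leb01. \<bar>f t\<bar>) = (LINT t|leb01. \<bar>f t * w t * (1 / w t)\<bar>)"
      by (rule integral_cong_AE) (use pos in \<open>auto elim!: eventually_mono\<close>)
    also have "\<dots> \<le> C * nrm X (\<lambda>t. f t * w t)" by (rule C(2)[OF fw])
    also have "\<dots> \<le> (C + 1) * nrm X (\<lambda>t. f t * w t)"
      using nrm_nonneg[OF fw] by (intro mult_right_mono) auto
    finally show ?thesis .
  qed
  then show thesis using that[of "C + 1"] C(1) by auto
qed

end

subsection \<open>Finite Rademacher sums\<close>

abbreviation l2_seq :: "(nat \<Rightarrow> real) \<Rightarrow> bool" where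
  "l2_seq a \<equiv> summable (\<lambda>k. (a k)\<^sup>2)"

definition l2_norm :: "(nat \<Rightarrow> real) \<Rightarrow> real" where
  "l2_norm a = sqrt (\<Sum>k. (a k)\<^sup>2)"

text \<open>The sign sequence of \<open>t\<close> as one object, indexed like the coefficients in
  \<open>rad_sum\<close>, so that halving \<open>t\<close> becomes prepending an entry with
  \<open>case_nat\<close>.\<close>

definition signs :: "real \<Rightarrow> nat \<Rightarrow> real" where
  "signs t k = rademacher (Suc k) t"

definition partial_sum :: "nat \<Rightarrow> (nat \<Rightarrow> real) \<Rightarrow> (nat \<Rightarrow> real) \<Rightarrow> real" where
  "partial_sum n a r = (\<Sum>k<n. a k * r k)"

lemma signs_measurable [measurable]: "(\<lambda>t. signs t k) \<in> borel_measurable borel"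
  unfolding signs_def rademacher_def by measurable

lemma borel_leb01: "f \<in> borel_measurable borel \<Longrightarrow> f \<in> meas01"
  by (intro measurable_restrict_space1 measurable_completion) simp

lemma abs_signs_le: "\<bar>signs t k\<bar> \<le> 1"
  by (auto simp: signs_def rademacher_def sgn_if)

text \<open>The two inverse branches of the doubling map shift the sine arguments by one index; on
  the right branch this adds a multiple of \<open>2 * pi\<close>, and for the first sign
  \<open>pi\<close> itself. At the endpoints the sine vanishes and the sign is 0.\<close>

lemma signs_half:
  assumes "0 < t" "t < 1"
  shows "signs (t / 2) = case_nat 1 (signs t)" "signs ((1 + t) / 2) = case_nat (-1) (signs t)"
proof -
  have pos: "0 < sin (pi * t)" using assms by (intro sin_gt_zero) auto
  have *: "sin (2 ^ Suc (Suc k) * pi * ((1 + t) / 2)) = sin (2 ^ Suc k * pi * t)" for k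
  proof -
    have "2 ^ Suc (Suc k) * pi * ((1 + t) / 2) = 2 ^ Suc k * pi * t + of_int (2 ^ k) * (2 * pi)"
      by (simp add: field_simps)
    also have "sin \<dots> = sin (2 ^ Suc k * pi * t)"
      using sin.plus_of_int[of "2 ^ Suc k * pi * t" "2 ^ k"] by (simp only: of_real_eq_id id_apply)
    finally show ?thesis .
  qed
  have "signs (t / 2) k = case_nat 1 (signs t) k" for k
  proof (cases k)
    case 0
    have "2 ^ Suc 0 * pi * (t / 2) = pi * t" by simp
    then show ?thesis using pos 0 by (simp only: signs_def rademacher_def) simp
  next
    case (Suc j)
    have "2 ^ Suc (Suc j) * pi * (t / 2) = 2 ^ Suc j * pi * t" by simp
    then show ?thesis using Suc by (simp only: signs_def rademacher_def nat.case)
  qed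
  then show "signs (t / 2) = case_nat 1 (signs t)" by blast
  have "signs ((1 + t) / 2) k = case_nat (-1) (signs t) k" for k
  proof (cases k)
    case 0
    have "2 ^ Suc 0 * pi * ((1 + t) / 2) = pi * t + pi" by (simp add: field_simps)
    then show ?thesis using pos 0 by (simp only: signs_def rademacher_def) (simp add: sin_add)
  next
    case (Suc j)
    then show ?thesis using *[of j] by (simp only: signs_def rademacher_def nat.case)
  qed
  then show "signs ((1 + t) / 2) = case_nat (-1) (signs t)" by blast
qed

lemma nn_integral_leb01:
  "(\<integral>\<^sup>+t. F t \<partial>leb01) = (\<integral>\<^sup>+t. F t * indicator {0..1} t \<partial>lborel)"
  by (simp add: nn_integral_restrict_space nn_integral_completion)

lemma AE_leb01_interior: "AE t in leb01. 0 < t \<and> t < 1"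
proof -
  have "AE t in lborel. t \<noteq> (0::real)" "AE t in lborel. t \<noteq> (1::real)" by (rule AE_lborel_singleton)+
  then have "AE t in lborel. t \<in> {0..1} \<longrightarrow> 0 < t \<and> t < (1::real)" by eventually_elim auto
  then have "AE t in lebesgue. t \<in> {0..1} \<longrightarrow> 0 < t \<and> t < (1::real)" by (rule AE_completion)
  then show ?thesis by (subst AE_restrict_space_iff) (auto elim!: eventually_mono)
qed

lemma nn_integral_halves:
  assumes [measurable]: "F \<in> borel_measurable borel"
  shows "(\<integral>\<^sup>+t. F t \<partial>leb01) = ((\<integral>\<^sup>+t. F (t / 2) \<partial>leb01) + (\<integral>\<^sup>+t. F ((1 + t) / 2) \<partial>leb01)) / 2"
proof -
  have half: "ennreal \<bar>1/2\<bar> * x = x / 2" for x :: ennreal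
  proof -
    have "ennreal (1/2) = inverse 2" using inverse_ennreal[of 2] by (simp add: inverse_eq_divide)
    then show ?thesis by (simp add: divide_ennreal_def mult.commute)
  qed
  have "(\<integral>\<^sup>+t. F t \<partial>leb01) =
      (\<integral>\<^sup>+t. F t * indicator {0..<1/2} t + F t * indicator {1/2..1} t \<partial>lborel)"
    unfolding nn_integral_leb01
    by (intro nn_integral_cong) (auto split: split_indicator)
  also have "\<dots> = (\<integral>\<^sup>+t. F t * indicator {0..<1/2} t \<partial>lborel) + (\<integral>\<^sup>+t. F t * indicator {1/2..1} t \<partial>lborel)"
    by (rule nn_integral_add) measurable
  also have "(\<integral>\<^sup>+t. F t * indicator {0..<1/2} t \<partial>lborel) = (\<integral>\<^sup>+t. F (t / 2) \<partial>leb01) / 2"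
  proof -
    have "(\<integral>\<^sup>+t. F t * indicator {0..<1/2} t \<partial>lborel) =
        ennreal \<bar>1/2\<bar> * (\<integral>\<^sup>+t. F (0 + 1/2 * t) * indicator {0..<1/2} (0 + 1/2 * t) \<partial>lborel)"
      by (rule nn_integral_real_affine) auto
    also have "(\<integral>\<^sup>+t. F (0 + 1/2 * t) * indicator {0..<1/2} (0 + 1/2 * t) \<partial>lborel) =
        (\<integral>\<^sup>+t. F (t / 2) \<partial>leb01)"
      unfolding nn_integral_leb01
    proof (rule nn_integral_cong_AE)
      show "AE t in lborel. F (0 + 1/2 * t) * indicator {0..<1/2} (0 + 1/2 * t) = F (t / 2) * indicator {0..1} t"
        using AE_lborel_singleton[of "1::real"] by eventually_elim (auto split: split_indicator)
    qed
    finally show ?thesis by (simp only: half)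
  qed
  also have "(\<integral>\<^sup>+t. F t * indicator {1/2..1} t \<partial>lborel) = (\<integral>\<^sup>+t. F ((1 + t) / 2) \<partial>leb01) / 2"
  proof -
    have "(\<integral>\<^sup>+t. F t * indicator {1/2..1} t \<partial>lborel) =
        ennreal \<bar>1/2\<bar> * (\<integral>\<^sup>+t. F (1/2 + 1/2 * t) * indicator {1/2..1} (1/2 + 1/2 * t) \<partial>lborel)"
      by (rule nn_integral_real_affine) auto
    also have "(\<integral>\<^sup>+t. F (1/2 + 1/2 * t) * indicator {1/2..1} (1/2 + 1/2 * t) \<partial>lborel) =
        (\<integral>\<^sup>+t. F ((1 + t) / 2) \<partial>leb01)"
      unfolding nn_integral_leb01
      by (intro nn_integral_cong) (auto split: split_indicator simp: add_divide_distrib)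
    finally show ?thesis by (simp only: half)
  qed
  finally show ?thesis by (simp add: add_divide_distrib_ennreal)
qed

text \<open>Conditioning on the first sign: the form in which independence of the Rademacher
  functions is used.\<close>

lemma nn_integral_signs_split:
  fixes F :: "(nat \<Rightarrow> real) \<Rightarrow> ennreal"
  assumes "(\<lambda>t. F (signs t)) \<in> borel_measurable borel"
  shows "(\<integral>\<^sup>+t. F (signs t) \<partial>leb01) =
    ((\<integral>\<^sup>+t. F (case_nat 1 (signs t)) \<partial>leb01) + (\<integral>\<^sup>+t. F (case_nat (-1) (signs t)) \<partial>leb01)) / 2"
proof -
  have "(\<integral>\<^sup>+t. F (signs (t / 2)) \<partial>leb01) = (\<integral>\<^sup>+t. F (case_nat 1 (signs t)) \<partial>leb01)"
    by (intro nn_integral_cong_AE eventually_mono[OF AE_leb01_interior]) (simp add: signs_half)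
  moreover have "(\<integral>\<^sup>+t. F (signs ((1 + t) / 2)) \<partial>leb01) = (\<integral>\<^sup>+t. F (case_nat (-1) (signs t)) \<partial>leb01)"
    by (intro nn_integral_cong_AE eventually_mono[OF AE_leb01_interior]) (simp add: signs_half)
  ultimately show ?thesis using nn_integral_halves[OF assms] by simp
qed

lemma ennreal_half_add: "0 \<le> p \<Longrightarrow> 0 \<le> q \<Longrightarrow> (ennreal p + ennreal q) / 2 = ennreal ((p + q) / 2)"
  by (metis add_nonneg_nonneg divide_ennreal ennreal_numeral ennreal_plus zero_le_numeral zero_less_numeral)

lemma measure_signs_split:
  fixes P :: "(nat \<Rightarrow> real) \<Rightarrow> bool"
  assumes "Measurable.pred borel (\<lambda>t. P (signs t))"
    and "Measurable.pred leb01 (\<lambda>t. P (case_nat 1 (signs t)))"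
    and "Measurable.pred leb01 (\<lambda>t. P (case_nat (-1) (signs t)))"
  shows "prob {t \<in> {0..1}. P (signs t)} =
    (prob {t \<in> {0..1}. P (case_nat 1 (signs t))} +
     prob {t \<in> {0..1}. P (case_nat (-1) (signs t))}) / 2"
proof -
  define F :: "(nat \<Rightarrow> real) \<Rightarrow> ennreal" where "F r = (if P r then 1 else 0)" for r
  have eq: "(\<integral>\<^sup>+t. F (h t) \<partial>leb01) = ennreal (prob {t \<in> {0..1}. P (h t)})"
    if "Measurable.pred leb01 (\<lambda>t. P (h t))" for h
  proof -
    have "(\<integral>\<^sup>+t. F (h t) \<partial>leb01) = (\<integral>\<^sup>+t. indicator {t \<in> {0..1}. P (h t)} t \<partial>leb01)"
      by (intro nn_integral_cong) (auto simp: F_def prob_leb01 split: split_indicator)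
    also have "\<dots> = emeasure leb01 {t \<in> {0..1}. P (h t)}"
      using sets_Collect01(1)[OF that] by simp
    finally show ?thesis by (simp add: leb01.emeasure_eq_measure)
  qed
  have "Measurable.pred leb01 (\<lambda>t. P (signs t))"
    using assms(1) by (intro measurable_restrict_space1 measurable_completion) simp
  moreover have "(\<lambda>t. F (signs t)) \<in> borel_measurable borel"
    using assms(1) unfolding F_def by measurable
  ultimately have "ennreal (prob {t \<in> {0..1}. P (signs t)}) =
      (ennreal (prob {t \<in> {0..1}. P (case_nat 1 (signs t))}) +
       ennreal (prob {t \<in> {0..1}. P (case_nat (-1) (signs t))})) / 2"
    using nn_integral_signs_split[of F] eq assms(2,3) by simp
  then show ?thesis by (simp add: ennreal_half_add)
qed

abbreviation rad_partial :: "nat \<Rightarrow> (nat \<Rightarrow> real) \<Rightarrow> real \<Rightarrow> real" where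
  "rad_partial n a t \<equiv> partial_sum n a (signs t)"

abbreviation sq_sum :: "nat \<Rightarrow> (nat \<Rightarrow> real) \<Rightarrow> real" where
  "sq_sum n a \<equiv> \<Sum>k<n. (a k)\<^sup>2"

section \<open>Moments, maximal inequality and tails of finite sums\<close>

lemma partial_sum_case_nat:
  "partial_sum (Suc n) a (case_nat e r) = a 0 * e + partial_sum n (\<lambda>k. a (Suc k)) r"
  by (simp add: partial_sum_def sum.lessThan_Suc_shift del: sum.lessThan_Suc)

lemma partial_sum_0 [simp]: "partial_sum 0 a r = 0"
  by (simp add: partial_sum_def)

lemma partial_sum_measurable [measurable]:
  "(\<lambda>t. rad_partial n a t) \<in> borel_measurable borel"
  "(\<lambda>t. rad_partial n a t) \<in> meas01"
  unfolding partial_sum_def by (auto intro!: borel_leb01)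

lemma measure_leb01_Collect [simp]: "prob {t. 0 \<le> t \<and> t \<le> 1} = 1"
proof -
  have "{t. 0 \<le> t \<and> t \<le> 1} = {0..1::real}" by auto
  then show ?thesis by (simp only: prob_leb01(1))
qed

lemma emeasure_leb01 [simp]: "emeasure leb01 {0..1} = 1"
  by (simp add: emeasure_restrict_space)

text \<open>The offset \<open>x\<close> makes the induction possible: removing the first sign
  replaces it by \<open>x + a 0\<close> and \<open>x - a 0\<close>.\<close>

lemma moment2_partial_sum:
  "(\<integral>\<^sup>+t. ennreal ((x + rad_partial n a t)\<^sup>2) \<partial>leb01) = ennreal (x\<^sup>2 + sq_sum n a)"
proof (induction n arbitrary: x a)
  case 0
  then show ?case by simp
next
  case (Suc n)
  let ?a = "\<lambda>k. a (Suc k)" let ?V = "\<Sum>k<n. (a (Suc k))\<^sup>2"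
  have "0 \<le> ?V" by (intro sum_nonneg) auto
  have "(\<integral>\<^sup>+t. ennreal ((x + rad_partial (Suc n) a t)\<^sup>2) \<partial>leb01) =
      ((\<integral>\<^sup>+t. ennreal ((x + a 0 + rad_partial n ?a t)\<^sup>2) \<partial>leb01) +
       (\<integral>\<^sup>+t. ennreal ((x - a 0 + rad_partial n ?a t)\<^sup>2) \<partial>leb01)) / 2"
    by (subst nn_integral_signs_split) (simp_all add: partial_sum_case_nat algebra_simps)
  also have "\<dots> = (ennreal ((x + a 0)\<^sup>2 + ?V) + ennreal ((x - a 0)\<^sup>2 + ?V)) / 2"
    by (simp only: Suc.IH)
  also have "\<dots> = ennreal (((x + a 0)\<^sup>2 + ?V + ((x - a 0)\<^sup>2 + ?V)) / 2)"
    using \<open>0 \<le> ?V\<close> by (intro ennreal_half_add) auto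
  also have "((x + a 0)\<^sup>2 + ?V + ((x - a 0)\<^sup>2 + ?V)) / 2 = x\<^sup>2 + sq_sum (Suc n) a"
    by (simp only: sum.lessThan_Suc_shift) (simp add: power2_eq_square algebra_simps)
  finally show ?case .
qed

text \<open>Averaging the bounds at \<open>x + a 0\<close> and \<open>x - a 0\<close> gives the next
  bound minus \<open>2 * a 0 ^ 4\<close>, which is dropped.\<close>

lemma moment4_partial_sum:
  "(\<integral>\<^sup>+t. ennreal ((x + rad_partial n a t) ^ 4) \<partial>leb01) \<le>
     ennreal (x ^ 4 + 6 * x\<^sup>2 * sq_sum n a + 3 * (sq_sum n a)\<^sup>2)"
proof (induction n arbitrary: x a)
  case 0
  then show ?case by simp
next
  case (Suc n)
  let ?a = "\<lambda>k. a (Suc k)" let ?V = "\<Sum>k<n. (a (Suc k))\<^sup>2"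
  let ?B = "\<lambda>y. y ^ 4 + 6 * y\<^sup>2 * ?V + 3 * ?V\<^sup>2"
  have V: "0 \<le> ?V" by (intro sum_nonneg) auto
  then have B: "0 \<le> ?B y" for y by simp
  have "(\<integral>\<^sup>+t. ennreal ((x + rad_partial (Suc n) a t) ^ 4) \<partial>leb01) =
      ((\<integral>\<^sup>+t. ennreal ((x + a 0 + rad_partial n ?a t) ^ 4) \<partial>leb01) +
       (\<integral>\<^sup>+t. ennreal ((x - a 0 + rad_partial n ?a t) ^ 4) \<partial>leb01)) / 2"
    by (subst nn_integral_signs_split) (simp_all add: partial_sum_case_nat algebra_simps)
  also have "\<dots> \<le> (ennreal (?B (x + a 0)) + ennreal (?B (x - a 0))) / 2"
    by (intro divide_right_mono_ennreal add_mono Suc.IH)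
  also have "\<dots> = ennreal ((?B (x + a 0) + ?B (x - a 0)) / 2)"
    by (intro ennreal_half_add B)
  also have "\<dots> \<le> ennreal (x ^ 4 + 6 * x\<^sup>2 * sq_sum (Suc n) a + 3 * (sq_sum (Suc n) a)\<^sup>2)"
  proof (rule ennreal_leI)
    have "(?B (x + a 0) + ?B (x - a 0)) / 2 = x ^ 4 + 6 * x\<^sup>2 * ((a 0)\<^sup>2 + ?V) + 3 * ((a 0)\<^sup>2 + ?V)\<^sup>2 - 2 * a 0 ^ 4"
      by (simp add: power2_eq_square power4_eq_xxxx algebra_simps)
    also have "\<dots> \<le> x ^ 4 + 6 * x\<^sup>2 * ((a 0)\<^sup>2 + ?V) + 3 * ((a 0)\<^sup>2 + ?V)\<^sup>2" by simp
    finally show "(?B (x + a 0) + ?B (x - a 0)) / 2 \<le> x ^ 4 + 6 * x\<^sup>2 * sq_sum (Suc n) a + 3 * (sq_sum (Suc n) a)\<^sup>2"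
      by (simp only: sum.lessThan_Suc_shift)
  qed
  finally show ?case .
qed

lemma cosh_le_exp_square: "cosh (x::real) \<le> exp (x\<^sup>2)"
proof -
  have pos: "cosh y \<le> exp (y\<^sup>2)" if y: "0 \<le> y" for y :: real
  proof (cases "y \<le> 1")
    case True
    have up: "exp y \<le> 1 + y + y\<^sup>2" by (rule exp_bound[OF y True])
    \<comment> \<open>\<open>1 - y + y^2\<close> times the lower Taylor bound of
      \<open>exp y\<close> is at least 1, which bounds the reciprocal of
      \<open>exp y\<close>.\<close>
    have "exp (-y) \<le> 1 - y + y\<^sup>2"
    proof -
      have 1: "1 + y + y\<^sup>2 / 2 \<le> exp y" by (rule exp_lower_Taylor_quadratic[OF y])
      have "(1 + y + y\<^sup>2 / 2) * (1 - y + y\<^sup>2) = 1 + (y\<^sup>2 + y ^ 3 + y ^ 4) / 2"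
        by (simp add: power2_eq_square power3_eq_cube power4_eq_xxxx field_simps)
      then have "1 \<le> (1 + y + y\<^sup>2 / 2) * (1 - y + y\<^sup>2)" using y by simp
      also have "\<dots> \<le> exp y * (1 - y + y\<^sup>2)" using True 1 by (intro mult_right_mono) auto
      finally show ?thesis by (simp add: exp_minus field_simps)
    qed
    with up have "cosh y \<le> 1 + y\<^sup>2" by (simp add: cosh_def)
    also have "\<dots> \<le> exp (y\<^sup>2)" by (rule exp_ge_add_one_self)
    finally show ?thesis .
  next
    case False
    have "exp (-y) \<le> exp y" using y by simp
    then have "cosh y \<le> exp y" by (simp add: cosh_def)
    also have "\<dots> \<le> exp (y\<^sup>2)" using False by (simp add: power2_eq_square)
    finally show ?thesis .
  qed
  have "cosh x = cosh \<bar>x\<bar>" by (simp add: abs_if)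
  then show ?thesis using pos[of "\<bar>x\<bar>"] by simp
qed

text \<open>Each sign contributes a factor \<open>cosh (a k) \<le> exp ((a k)^2)\<close>; this crude
  bound is the origin of the 4 in the later Gaussian exponents.\<close>

lemma exp_moment_partial_sum:
  "(\<integral>\<^sup>+t. ennreal (exp (x + rad_partial n a t)) \<partial>leb01) \<le> ennreal (exp (x + sq_sum n a))"
proof (induction n arbitrary: x a)
  case 0
  then show ?case by simp
next
  case (Suc n)
  let ?a = "\<lambda>k. a (Suc k)" let ?V = "\<Sum>k<n. (a (Suc k))\<^sup>2"
  have "(\<integral>\<^sup>+t. ennreal (exp (x + rad_partial (Suc n) a t)) \<partial>leb01) =
      ((\<integral>\<^sup>+t. ennreal (exp (x + a 0 + rad_partial n ?a t)) \<partial>leb01) +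
       (\<integral>\<^sup>+t. ennreal (exp (x - a 0 + rad_partial n ?a t)) \<partial>leb01)) / 2"
    by (subst nn_integral_signs_split) (simp_all add: partial_sum_case_nat algebra_simps)
  also have "\<dots> \<le> (ennreal (exp (x + a 0 + ?V)) + ennreal (exp (x - a 0 + ?V))) / 2"
    by (intro divide_right_mono_ennreal add_mono Suc.IH)
  also have "\<dots> = ennreal ((exp (x + a 0 + ?V) + exp (x - a 0 + ?V)) / 2)"
    by (intro ennreal_half_add) auto
  also have "(exp (x + a 0 + ?V) + exp (x - a 0 + ?V)) / 2 = exp (x + ?V) * cosh (a 0)"
    by (simp add: cosh_def exp_add exp_diff exp_minus field_simps)
  also have "ennreal \<dots> \<le> ennreal (exp (x + ?V) * exp ((a 0)\<^sup>2))"
    by (intro ennreal_leI mult_left_mono cosh_le_exp_square) auto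
  also have "exp (x + ?V) * exp ((a 0)\<^sup>2) = exp (x + sq_sum (Suc n) a)"
    by (simp only: sum.lessThan_Suc_shift) (simp add: add_ac flip: exp_add)
  finally show ?case .
qed

text \<open>Kolmogorov's inequality without a stopping time: if \<open>|x| \<ge> \<tau>\<close>, the
  right side is at least 1; otherwise index 0 cannot contribute, and the bounds at
  \<open>x + a 0\<close> and \<open>x - a 0\<close> average exactly to the claim.\<close>

lemma maximal_inequality:
  assumes "\<tau> > 0"
  shows "prob {t \<in> {0..1}. \<exists>k\<le>n. \<tau> \<le> \<bar>x + rad_partial k a t\<bar>} \<le> (x\<^sup>2 + sq_sum n a) / \<tau>\<^sup>2"
proof (induction n arbitrary: x a)
  case 0
  show ?case
  proof (cases "\<tau> \<le> \<bar>x\<bar>")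
    case True
    have "\<tau>\<^sup>2 \<le> x\<^sup>2" using True assms by (simp add: abs_le_square_iff[symmetric])
    then show ?thesis using True assms by (simp add: prob_leb01(1))
  next
    case False
    then show ?thesis by simp
  qed
next
  case (Suc n)
  let ?a = "\<lambda>k. a (Suc k)" let ?V = "\<Sum>k<n. (a (Suc k))\<^sup>2"
  have V: "0 \<le> ?V" by (intro sum_nonneg) auto
  show ?case
  proof (cases "\<tau> \<le> \<bar>x\<bar>")
    case True
    have "\<tau>\<^sup>2 \<le> x\<^sup>2" using True assms by (simp add: abs_le_square_iff[symmetric])
    moreover have "0 \<le> sq_sum (Suc n) a" by (intro sum_nonneg) auto
    ultimately have "1 \<le> (x\<^sup>2 + sq_sum (Suc n) a) / \<tau>\<^sup>2" using assms by simp
    then show ?thesis using prob_le_1 by (meson order_trans)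
  next
    case False
    have ex: "(\<exists>k\<le>Suc n. \<tau> \<le> \<bar>x + partial_sum k a (case_nat e r)\<bar>) \<longleftrightarrow>
        (\<exists>k\<le>n. \<tau> \<le> \<bar>(x + a 0 * e) + partial_sum k ?a r\<bar>)" for e r
    proof
      assume "\<exists>k\<le>Suc n. \<tau> \<le> \<bar>x + partial_sum k a (case_nat e r)\<bar>"
      then obtain k where k: "k \<le> Suc n" "\<tau> \<le> \<bar>x + partial_sum k a (case_nat e r)\<bar>" by blast
      then obtain j where "k = Suc j" using False by (cases k) auto
      then show "\<exists>k\<le>n. \<tau> \<le> \<bar>(x + a 0 * e) + partial_sum k ?a r\<bar>"
        using k by (auto simp: partial_sum_case_nat add.assoc)
    next
      assume "\<exists>k\<le>n. \<tau> \<le> \<bar>(x + a 0 * e) + partial_sum k ?a r\<bar>"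
      then obtain k where "k \<le> n" "\<tau> \<le> \<bar>(x + a 0 * e) + partial_sum k ?a r\<bar>" by blast
      then show "\<exists>k\<le>Suc n. \<tau> \<le> \<bar>x + partial_sum k a (case_nat e r)\<bar>"
        by (intro exI[of _ "Suc k"]) (auto simp: partial_sum_case_nat add.assoc)
    qed
    have "prob {t \<in> {0..1}. \<exists>k\<le>Suc n. \<tau> \<le> \<bar>x + rad_partial k a t\<bar>} =
        (prob {t \<in> {0..1}. \<exists>k\<le>n. \<tau> \<le> \<bar>(x + a 0 * 1) + rad_partial k ?a t\<bar>} +
         prob {t \<in> {0..1}. \<exists>k\<le>n. \<tau> \<le> \<bar>(x + a 0 * -1) + rad_partial k ?a t\<bar>}) / 2"
      by (subst measure_signs_split) (simp_all only: ex, measurable)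
    also have "\<dots> \<le> (((x + a 0 * 1)\<^sup>2 + ?V) / \<tau>\<^sup>2 + ((x + a 0 * -1)\<^sup>2 + ?V) / \<tau>\<^sup>2) / 2"
      by (intro divide_right_mono add_mono Suc.IH) auto
    also have "\<dots> = (x\<^sup>2 + sq_sum (Suc n) a) / \<tau>\<^sup>2"
    proof -
      have "(x + a 0 * 1)\<^sup>2 + ?V + ((x + a 0 * -1)\<^sup>2 + ?V) = 2 * (x\<^sup>2 + sq_sum (Suc n) a)"
        by (simp only: sum.lessThan_Suc_shift) (simp add: power2_eq_square algebra_simps)
      moreover have "(P / d + Q / d) / 2 = R / d" if "P + Q = 2 * R" for P Q R d :: real
        using that by (simp add: add_divide_distrib[symmetric])
      ultimately show ?thesis by blast
    qed
    finally show ?thesis .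
  qed
qed

lemma partial_sum_symmetric:
  "prob {t \<in> {0..1}. c \<le> x + rad_partial n a t} =
   prob {t \<in> {0..1}. c \<le> x - rad_partial n a t}"
proof (induction n arbitrary: x a)
  case (Suc n)
  let ?a = "\<lambda>k. a (Suc k)"
  let ?p = "\<lambda>x. prob {t \<in> {0..1}. c \<le> x + rad_partial n ?a t}"
  let ?m = "\<lambda>x. prob {t \<in> {0..1}. c \<le> x - rad_partial n ?a t}"
  have "prob {t \<in> {0..1}. c \<le> x + rad_partial (Suc n) a t} = (?p (x + a 0) + ?p (x - a 0)) / 2"
    by (subst measure_signs_split) (simp_all add: partial_sum_case_nat algebra_simps)
  also have "\<dots> = (?m (x - a 0) + ?m (x + a 0)) / 2" by (simp only: Suc.IH add.commute)
  also have "\<dots> = prob {t \<in> {0..1}. c \<le> x - rad_partial (Suc n) a t}"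
    by (subst measure_signs_split) (simp_all add: partial_sum_case_nat algebra_simps)
  finally show ?case .
qed simp

text \<open>Paley-Zygmund: the second moment is \<open>V\<close> and the fourth at most
  \<open>3 * V^2\<close>, so \<open>|S| \<ge> sqrt V / 2\<close> has measure at least 1/6; symmetry
  leaves half of it for one sign.\<close>

lemma partial_sum_lower_tail:
  "1 / 12 \<le> prob {t \<in> {0..1}. sqrt (sq_sum n a) / 2 \<le> rad_partial n a t}"
proof -
  define V where "V = sq_sum n a"
  have V0: "0 \<le> V" unfolding V_def by (intro sum_nonneg) auto
  let ?S = "\<lambda>t. rad_partial n a t"
  show ?thesis
  proof (cases "V = 0")
    case True
    then have "a k = 0" if "k < n" for k
      using that by (simp add: V_def sum_nonneg_eq_0_iff)
    then have "?S t = 0" for t by (simp add: partial_sum_def)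
    then show ?thesis using True by (simp add: V_def[symmetric] prob_leb01(1))
  next
    case False
    then have "V > 0" using V0 by simp
    have i2: "integrable leb01 (\<lambda>t. (?S t)\<^sup>2)" and e2: "(LINT t|leb01. (?S t)\<^sup>2) = V"
      using moment2_partial_sum[of 0 n a] V0
      by (auto simp: V_def[symmetric] integral_eq_nn_integral intro!: integrableI_nonneg)
    have m4: "(\<integral>\<^sup>+t. ennreal (?S t ^ 4) \<partial>leb01) \<le> ennreal (3 * V\<^sup>2)"
      using moment4_partial_sum[of 0 n a] by (simp add: V_def)
    then have i4: "integrable leb01 (\<lambda>t. ?S t ^ 4)"
      by (intro integrableI_nonneg) (auto intro: le_less_trans)
    have "ennreal (LINT t|leb01. ?S t ^ 4) \<le> ennreal (3 * V\<^sup>2)"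
      using m4 i4 by (simp add: nn_integral_eq_integral)
    then have e4: "(LINT t|leb01. ?S t ^ 4) \<le> 3 * V\<^sup>2" by (simp add: ennreal_le_iff)
    define A where "A = {t \<in> {0..1}. sqrt V / 2 \<le> \<bar>?S t\<bar>}"
    have A: "A \<in> sets leb01" unfolding A_def by (rule sets_Collect01) measurable
    have A01: "A \<inter> {0..1} = A" by (auto simp: A_def)
    have iA: "integrable leb01 (indicator A :: real \<Rightarrow> real)"
      using A by (simp add: leb01.emeasure_eq_measure)
    \<comment> \<open>Integrated, this reads
      \<open>V^2 \<le> V^2 / 4 + V^2 / 2 + 3/2 * V^2 * prob A\<close>. On \<open>A\<close> it
      follows from \<open>(3 * V - S^2)^2 \<ge> 0\<close>, off \<open>A\<close> from
      \<open>S^2 \<le> V / 4\<close>.\<close>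
    have pw: "V * (?S t)\<^sup>2 \<le> V\<^sup>2 / 4 + ?S t ^ 4 / 6 + 3/2 * V\<^sup>2 * indicator A t" if t: "t \<in> space leb01" for t
    proof (cases "t \<in> A")
      case True
      have "0 \<le> (3 * V - (?S t)\<^sup>2)\<^sup>2" by simp
      then have "V * (?S t)\<^sup>2 \<le> ?S t ^ 4 / 6 + 3/2 * V\<^sup>2"
        by (simp add: power2_eq_square power4_eq_xxxx algebra_simps)
      then have "V * (?S t)\<^sup>2 \<le> V\<^sup>2 / 4 + (?S t ^ 4 / 6 + 3/2 * V\<^sup>2)"
        using zero_le_power2[of V] by linarith
      then show ?thesis using True by simp
    next
      case False
      then have "\<bar>?S t\<bar> < sqrt V / 2" using t by (auto simp: A_def prob_leb01)
      then have "(?S t)\<^sup>2 \<le> (sqrt V / 2)\<^sup>2" using V0 by (simp add: abs_le_square_iff[symmetric])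
      also have "\<dots> = V / 4" using V0 by (simp add: power_divide)
      finally have "V * (?S t)\<^sup>2 \<le> V * (V / 4)" using V0 by (rule mult_left_mono)
      moreover have "0 \<le> ?S t ^ 4 / 6" by simp
      ultimately have "V * (?S t)\<^sup>2 \<le> V\<^sup>2 / 4 + ?S t ^ 4 / 6"
        unfolding power2_eq_square by linarith
      then show ?thesis using False by simp
    qed
    have "V * V = (LINT t|leb01. V * (?S t)\<^sup>2)" using e2 by simp
    also have "\<dots> \<le> (LINT t|leb01. V\<^sup>2 / 4 + ?S t ^ 4 / 6 + 3/2 * V\<^sup>2 * indicator A t)"
      using i2 i4 iA pw by (intro integral_mono) auto
    also have "\<dots> = V\<^sup>2 / 4 + (LINT t|leb01. ?S t ^ 4) / 6 + 3/2 * V\<^sup>2 * prob A"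
      using i4 iA A by (simp add: prob_leb01(1) A01)
    also have "\<dots> \<le> V\<^sup>2 / 4 + 3 * V\<^sup>2 / 6 + 3/2 * V\<^sup>2 * prob A"
      using e4 by simp
    finally have "V\<^sup>2 * (1/4) \<le> V\<^sup>2 * (3/2 * prob A)"
      by (simp add: power2_eq_square algebra_simps)
    then have A6: "1/6 \<le> prob A" using \<open>V > 0\<close> by simp
    define B where "B = {t \<in> {0..1}. sqrt V / 2 \<le> ?S t}"
    define B' where "B' = {t \<in> {0..1}. sqrt V / 2 \<le> - ?S t}"
    have B: "B \<in> sets leb01" unfolding B_def by (rule sets_Collect01) measurable
    have B': "B' \<in> sets leb01" unfolding B'_def by (rule sets_Collect01) measurable
    note BB = B B'
    have "prob A \<le> prob (B \<union> B')"
      using BB by (intro prob_mono) (auto simp: A_def B_def B'_def)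
    also have "\<dots> \<le> prob B + prob B'" using BB by (rule measure_Un_le)
    also have "prob B' = prob B"
      using partial_sum_symmetric[of "sqrt V / 2" 0 n a] by (simp add: B_def B'_def)
    finally show ?thesis using A6 by (simp add: B_def V_def)
  qed
qed

subsection \<open>Rademacher series\<close>

lemma l2_norm_nonneg: "l2_seq a \<Longrightarrow> 0 \<le> l2_norm a"
  by (simp add: l2_norm_def suminf_nonneg)

lemma l2_norm_square: "l2_seq a \<Longrightarrow> (l2_norm a)\<^sup>2 = (\<Sum>k. (a k)\<^sup>2)"
  by (simp add: l2_norm_def suminf_nonneg)

lemma sum_square_le: "l2_seq a \<Longrightarrow> (sq_sum n a) \<le> (l2_norm a)\<^sup>2"
  by (simp add: l2_norm_square sum_le_suminf)

definition tail_seq :: "nat \<Rightarrow> (nat \<Rightarrow> real) \<Rightarrow> nat \<Rightarrow> real" where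
  "tail_seq m a k = (if k < m then 0 else a k)"

definition trunc_seq :: "nat \<Rightarrow> (nat \<Rightarrow> real) \<Rightarrow> nat \<Rightarrow> real" where
  "trunc_seq m a k = (if k < m then a k else 0)"

lemma l2_trunc_seq: "l2_seq (trunc_seq m a)"
  by (rule summable_finite[of "{..<m}"]) (auto simp: trunc_seq_def)

lemma l2_tail_seq:
  assumes "l2_seq a"
  shows "l2_seq (tail_seq m a)" "(l2_norm (tail_seq m a))\<^sup>2 = (\<Sum>k. (a k)\<^sup>2) - (sq_sum m a)"
proof -
  have eq: "(tail_seq m a k)\<^sup>2 = (a k)\<^sup>2 - (trunc_seq m a k)\<^sup>2" for k
    by (simp add: tail_seq_def trunc_seq_def)
  show s: "l2_seq (tail_seq m a)" unfolding eq using assms l2_trunc_seq by (rule summable_diff)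
  have "(\<Sum>k. (trunc_seq m a k)\<^sup>2) = (\<Sum>k<m. (trunc_seq m a k)\<^sup>2)"
    by (rule suminf_finite) (auto simp: trunc_seq_def)
  then show "(l2_norm (tail_seq m a))\<^sup>2 = (\<Sum>k. (a k)\<^sup>2) - (sq_sum m a)"
    unfolding l2_norm_square[OF s] eq using assms l2_trunc_seq
    by (subst suminf_diff[symmetric]) (auto simp: trunc_seq_def)
qed

lemma tail_seq_norm_tendsto_0: "l2_seq a \<Longrightarrow> (\<lambda>m. (l2_norm (tail_seq m a))\<^sup>2) \<longlonglongrightarrow> 0"
  using tendsto_diff[OF tendsto_const summable_LIMSEQ, of "\<lambda>k. (a k)\<^sup>2" "\<Sum>k. (a k)\<^sup>2"]
  by (simp add: l2_tail_seq)

lemma partial_sum_tail_seq: "m \<le> n \<Longrightarrow> partial_sum n (tail_seq m a) r = partial_sum n a r - partial_sum m a r"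
proof (induction n rule: dec_induct)
  case base
  then show ?case by (simp add: partial_sum_def tail_seq_def)
next
  case (step n)
  then show ?case by (simp add: partial_sum_def tail_seq_def)
qed

text \<open>Reverse Fatou for sets. It carries measure bounds from partial sums to their limit,
  since a closed condition that holds for infinitely many indices holds in the limit.\<close>

lemma measure_infinitely_often:
  assumes A: "\<And>n::nat. A n \<in> sets leb01" and p: "\<And>n. p \<le> prob (A n)"
  shows "{t \<in> {0..1}. \<forall>N. \<exists>n\<ge>N. t \<in> A n} \<in> sets leb01"
    "p \<le> prob {t \<in> {0..1}. \<forall>N. \<exists>n\<ge>N. t \<in> A n}"
proof -
  let ?U = "\<lambda>N. \<Union>n\<in>{N..}. A n"
  have sub: "A n \<subseteq> {0..1}" for n using sets.sets_into_space[OF A] by (simp add: prob_leb01)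
  have U: "?U N \<in> sets leb01" for N using A by auto
  have eq: "{t \<in> {0..1}. \<forall>N. \<exists>n\<ge>N. t \<in> A n} = (\<Inter>N. ?U N)" using sub by fastforce
  show "{t \<in> {0..1}. \<forall>N. \<exists>n\<ge>N. t \<in> A n} \<in> sets leb01" unfolding eq using U by auto
  have "(\<lambda>N. prob (?U N)) \<longlonglongrightarrow> prob (\<Inter>N. ?U N)"
  proof (rule leb01.finite_Lim_measure_decseq)
    show "range ?U \<subseteq> sets leb01" using U by blast
    show "decseq ?U" by (intro decseq_SucI UN_mono) auto
  qed
  moreover have "p \<le> prob (?U N)" for N
    using p[of N] prob_mono[OF _ U, of "A N" N] by fastforce
  ultimately show "p \<le> prob {t \<in> {0..1}. \<forall>N. \<exists>n\<ge>N. t \<in> A n}"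
    unfolding eq by (intro LIMSEQ_le_const) auto
qed

lemma maximal_inequality_l2:
  assumes "l2_seq a" "\<tau> > 0"
  shows "prob {t \<in> {0..1}. \<exists>k. \<tau> \<le> \<bar>rad_partial k a t\<bar>} \<le> (l2_norm a)\<^sup>2 / \<tau>\<^sup>2"
proof -
  let ?A = "\<lambda>n. {t \<in> {0..1}. \<exists>k\<le>n. \<tau> \<le> \<bar>rad_partial k a t\<bar>}"
  have "(\<lambda>n. prob (?A n)) \<longlonglongrightarrow> prob (\<Union>n. ?A n)"
  proof (rule leb01.finite_Lim_measure_incseq)
    have "?A n \<in> sets leb01" for n by (rule sets_Collect01) measurable
    then show "range ?A \<subseteq> sets leb01" by blast
    show "incseq ?A" by (rule incseq_SucI) (auto intro: le_SucI)
  qed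
  moreover have "(\<Union>n. ?A n) = {t \<in> {0..1}. \<exists>k. \<tau> \<le> \<bar>rad_partial k a t\<bar>}" by auto
  moreover have "prob (?A n) \<le> (l2_norm a)\<^sup>2 / \<tau>\<^sup>2" for n
  proof -
    have "prob (?A n) \<le> sq_sum n a / \<tau>\<^sup>2"
      using maximal_inequality[OF \<open>\<tau> > 0\<close>, of n 0 a] by simp
    also have "\<dots> \<le> (l2_norm a)\<^sup>2 / \<tau>\<^sup>2" using sum_square_le[OF assms(1)] by (intro divide_right_mono) auto
    finally show ?thesis .
  qed
  ultimately show ?thesis by (intro LIMSEQ_le_const2) auto
qed

section \<open>Almost everywhere convergence and square summability\<close>

lemma AE_leb01I:
  assumes "A \<in> sets leb01" "prob A = 0" "\<And>t. t \<in> {0..1} \<Longrightarrow> t \<notin> A \<Longrightarrow> P t"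
  shows "AE t in leb01. P t"
  by (rule AE_I'[of A]) (use assms in \<open>auto simp: null_sets_def leb01.emeasure_eq_measure prob_leb01\<close>)

text \<open>Divergence at \<open>t\<close> means that for some \<open>e\<close> the partial sums
  move by at least \<open>e\<close> after every index \<open>m\<close>; the maximal inequality for
  the series beyond \<open>m\<close> makes the set of such \<open>t\<close> null as \<open>m\<close>
  grows.\<close>

lemma AE_summable_signs:
  assumes a: "l2_seq a"
  shows "AE t in leb01. summable (\<lambda>k. a k * signs t k)"
proof -
  let ?D = "\<lambda>e. {t \<in> {0..1}. \<forall>m. \<exists>k\<ge>m. e \<le> \<bar>rad_partial k a t - rad_partial m a t\<bar>}"
  have D: "?D e \<in> sets leb01" for e by (rule sets_Collect01) measurable
  have D0: "prob (?D e) = 0" if "e > 0" for e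
  proof -
    have "prob (?D e) \<le> (l2_norm (tail_seq m a))\<^sup>2 / e\<^sup>2" for m
    proof -
      have "prob (?D e) \<le> prob {t \<in> {0..1}. \<exists>k. e \<le> \<bar>rad_partial k (tail_seq m a) t\<bar>}"
      proof (intro prob_mono sets_Collect01(1), safe)
        fix t assume "\<forall>m. \<exists>k\<ge>m. e \<le> \<bar>rad_partial k a t - rad_partial m a t\<bar>"
        then obtain k where "k \<ge> m" "e \<le> \<bar>rad_partial k a t - rad_partial m a t\<bar>" by blast
        then show "\<exists>k. e \<le> \<bar>rad_partial k (tail_seq m a) t\<bar>"
          by (intro exI[of _ k]) (simp add: partial_sum_tail_seq)
      qed measurable
      also have "\<dots> \<le> (l2_norm (tail_seq m a))\<^sup>2 / e\<^sup>2"
        using l2_tail_seq(1)[OF a] that by (rule maximal_inequality_l2)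
      finally show ?thesis .
    qed
    moreover have "(\<lambda>m. (l2_norm (tail_seq m a))\<^sup>2 / e\<^sup>2) \<longlonglongrightarrow> 0 / e\<^sup>2"
      using that by (intro tendsto_divide tail_seq_norm_tendsto_0 a tendsto_const) auto
    ultimately have "prob (?D e) \<le> 0 / e\<^sup>2"
      by (intro LIMSEQ_le_const) auto
    then show ?thesis by (simp add: measure_le_0_iff)
  qed
  have "AE t in leb01. \<forall>j::nat. t \<notin> ?D (1 / real (Suc j))"
    unfolding AE_all_countable using D D0 by (intro allI AE_leb01I[of "?D (1 / real (Suc _))"]) auto
  then have "AE t in leb01. t \<in> {0..1} \<and> (\<forall>j::nat. t \<notin> ?D (1 / real (Suc j)))"
    using AE_space[of leb01] by eventually_elim (simp add: prob_leb01)
  then show ?thesis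
  proof eventually_elim
    case (elim t)
    have "Cauchy (\<lambda>n. \<Sum>k<n. a k * signs t k)"
    proof (rule metric_CauchyI)
      fix e :: real assume "e > 0"
      then obtain j where j: "1 / real (Suc j) < e / 2" using nat_approx_posE[of "e/2"] by auto
      obtain M where M: "\<And>k. k \<ge> M \<Longrightarrow> \<bar>rad_partial k a t - rad_partial M a t\<bar> < 1 / real (Suc j)"
      proof -
        have "t \<notin> ?D (1 / real (Suc j))" "t \<in> {0..1}" using elim by blast+
        then obtain m where "\<forall>k\<ge>m. \<not> 1 / real (Suc j) \<le> \<bar>rad_partial k a t - rad_partial m a t\<bar>"
          by blast
        then show thesis using that[of m] by (simp add: not_le)
      qed
      have "dist (\<Sum>k<m. a k * signs t k) (\<Sum>k<n. a k * signs t k) < e" if "m \<ge> M" "n \<ge> M" for m n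
        using M[OF that(1)] M[OF that(2)] j by (simp add: dist_real_def partial_sum_def abs_less_iff)
      then show "\<exists>M. \<forall>m\<ge>M. \<forall>n\<ge>M. dist (\<Sum>k<m. a k * signs t k) (\<Sum>k<n. a k * signs t k) < e" by blast
    qed
    then show "summable (\<lambda>k. a k * signs t k)" by (simp add: summable_iff_convergent Cauchy_convergent_iff)
  qed
qed

lemma rad_sum_signs: "rad_sum a t = (\<Sum>k. a k * signs t k)"
  by (simp add: rad_sum_def signs_def)

lemma rad_convergent_signs: "rad_convergent a \<longleftrightarrow> (AE t in leb01. summable (\<lambda>k. a k * signs t k))"
  by (simp add: rad_convergent_def signs_def)

lemma rad_convergent_l2: "l2_seq a \<Longrightarrow> rad_convergent a"
  using AE_summable_signs by (simp add: rad_convergent_signs)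

lemma AE_rad_sum_LIMSEQ:
  assumes "rad_convergent a"
  shows "AE t in leb01. (\<lambda>n. rad_partial n a t) \<longlonglongrightarrow> rad_sum a t"
  using assms unfolding rad_convergent_signs
  by eventually_elim (simp add: partial_sum_def rad_sum_signs summable_LIMSEQ)

lemma rad_sum_measurable [measurable]:
  "rad_sum a \<in> borel_measurable borel" "rad_sum a \<in> meas01"
proof -
  have "(\<lambda>t. \<Sum>k. a k * signs t k) \<in> borel_measurable borel" by measurable
  then show "rad_sum a \<in> borel_measurable borel" by (simp add: rad_sum_signs[abs_def])
  then show "rad_sum a \<in> meas01" by (rule borel_leb01)
qed

lemma measure_le_AE:
  assumes "A \<in> sets leb01" "B \<in> sets leb01" "AE t in leb01. t \<in> A \<longrightarrow> t \<in> B"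
  shows "prob A \<le> prob B"
  by (rule leb01.finite_measure_mono_AE) (use assms in auto)

text \<open>Otherwise, on a set of measure at least 1/12, infinitely many partial sums exceed half
  of a norm that tends to infinity. The lemma is needed because \<open>multiplicator_space\<close>
  tests against every almost everywhere convergent series.\<close>

lemma l2_of_rad_convergent:
  assumes conv: "rad_convergent a"
  shows "l2_seq a"
proof (rule ccontr)
  assume not: "\<not> l2_seq a"
  define A where "A n = {t \<in> {0..1}. sqrt (sq_sum n a) / 2 \<le> rad_partial n a t}" for n
  have A: "A n \<in> sets leb01" for n unfolding A_def by (rule sets_Collect01) measurable
  have Ap: "1 / 12 \<le> prob (A n)" for n unfolding A_def by (rule partial_sum_lower_tail)
  note io = measure_infinitely_often[of A, OF A Ap]
  have "prob {t \<in> {0..1}. \<forall>N. \<exists>n\<ge>N. t \<in> A n} \<le> prob {}"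
  proof (rule measure_le_AE[OF io(1)])
    show "AE t in leb01. t \<in> {t \<in> {0..1}. \<forall>N. \<exists>n\<ge>N. t \<in> A n} \<longrightarrow> t \<in> {}"
      using AE_rad_sum_LIMSEQ[OF conv]
    proof eventually_elim
      case (elim t)
      then have "Bseq (\<lambda>n. rad_partial n a t)" by (intro convergent_imp_Bseq convergentI)
      then obtain K where K: "\<And>n. \<bar>rad_partial n a t\<bar> \<le> K" by (auto simp: Bseq_def)
      obtain N where N: "(2 * K)\<^sup>2 < (sq_sum N a)"
      proof (rule ccontr)
        assume "\<not> thesis"
        then have "sq_sum n a \<le> (2 * K)\<^sup>2" for n using that by (meson not_le)
        then have "l2_seq a" by (intro summableI_nonneg_bounded) auto
        then show False using not by simp
      qed
      have "t \<notin> A n" if "n \<ge> N" for n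
      proof
        assume "t \<in> A n"
        have "0 \<le> K" using K[of 0] by simp
        have "sq_sum N a \<le> sq_sum n a" using that by (intro sum_mono2) auto
        with N have "2 * K < sqrt (sq_sum n a)" by (intro real_less_rsqrt) simp
        then show False using \<open>t \<in> A n\<close> K[of n] by (simp add: A_def abs_le_iff)
      qed
      then show ?case by auto
    qed
  qed simp
  then show False using io(2) by simp
qed

lemma upper_tail_rad_sum:
  assumes a: "l2_seq a"
  shows "1 / 12 \<le> prob {t \<in> {0..1}. l2_norm a / 2 \<le> rad_sum a t}"
proof -
  define A where "A n = {t \<in> {0..1}. sqrt (sq_sum n a) / 2 \<le> rad_partial n a t}" for n
  have A: "A n \<in> sets leb01" for n unfolding A_def by (rule sets_Collect01) measurable
  have Ap: "1 / 12 \<le> prob (A n)" for n unfolding A_def by (rule partial_sum_lower_tail)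
  note io = measure_infinitely_often[of A, OF A Ap]
  have "prob {t \<in> {0..1}. \<forall>N. \<exists>n\<ge>N. t \<in> A n} \<le> prob {t \<in> {0..1}. l2_norm a / 2 \<le> rad_sum a t}"
  proof (rule measure_le_AE[OF io(1)])
    show "{t \<in> {0..1}. l2_norm a / 2 \<le> rad_sum a t} \<in> sets leb01"
      by (rule sets_Collect01) measurable
    show "AE t in leb01. t \<in> {t \<in> {0..1}. \<forall>N. \<exists>n\<ge>N. t \<in> A n} \<longrightarrow> t \<in> {t \<in> {0..1}. l2_norm a / 2 \<le> rad_sum a t}"
      using AE_rad_sum_LIMSEQ[OF rad_convergent_l2[OF a]]
    proof eventually_elim
      case (elim t)
      have "(\<lambda>n. rad_partial n a t - sqrt (sq_sum n a) / 2) \<longlonglongrightarrow> rad_sum a t - l2_norm a / 2"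
        unfolding l2_norm_def using elim a
        by (intro tendsto_diff tendsto_divide tendsto_real_sqrt summable_LIMSEQ tendsto_const) auto
      moreover have "rad_sum a t - l2_norm a / 2 < 0" if "\<not> l2_norm a / 2 \<le> rad_sum a t" using that by simp
      ultimately have "eventually (\<lambda>n. rad_partial n a t - sqrt (sq_sum n a) / 2 < 0) sequentially"
        if "\<not> l2_norm a / 2 \<le> rad_sum a t" using that by (intro order_tendstoD(2)) auto
      then show ?case by (fastforce simp: eventually_sequentially A_def)
    qed
  qed
  then show ?thesis using io(2) by simp
qed

lemma partial_sum_tail_bound:
  assumes "sq_sum n a \<le> v" "v > 0" "\<tau> \<ge> 0"
  shows "prob {t \<in> {0..1}. \<tau> < \<bar>rad_partial n a t\<bar>} \<le> 2 * exp (- (\<tau>\<^sup>2 / (4 * v)))"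
proof -
  let ?S = "\<lambda>t. rad_partial n a t"
  have one: "prob {t \<in> {0..1}. \<tau> < \<epsilon> * ?S t} \<le> exp (- (\<tau>\<^sup>2 / (4 * v)))" if "\<bar>\<epsilon>\<bar> = 1" for \<epsilon> :: real
  proof -
    \<comment> \<open>Chernoff's parameter: up to the sign \<open>\<epsilon>\<close>, it minimizes
      \<open>- l * \<tau> + l^2 * v\<close>, with minimum
      \<open>- \<tau>^2 / (4 * v)\<close>.\<close>
    define l where "l = \<epsilon> * \<tau> / (2 * v)"
    have e2: "\<epsilon> * \<epsilon> = 1" using that by (simp add: abs_if split: if_splits)
    define A where "A = {t \<in> {0..1}. \<tau> < \<epsilon> * ?S t}"
    have A: "A \<in> sets leb01" unfolding A_def by (rule sets_Collect01) measurable
    have "ennreal (prob A) = (\<integral>\<^sup>+t. indicator A t \<partial>leb01)"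
      using A by (simp add: leb01.emeasure_eq_measure)
    also have "\<dots> \<le> (\<integral>\<^sup>+t. ennreal (exp (- (\<epsilon> * l * \<tau>) + rad_partial n (\<lambda>k. l * a k) t)) \<partial>leb01)"
    proof (rule nn_integral_mono)
      fix t
      have "1 \<le> exp (- (\<epsilon> * l * \<tau>) + rad_partial n (\<lambda>k. l * a k) t)" if "t \<in> A"
      proof -
        have "\<epsilon> * l = \<tau> / (2 * v)" using e2 by (simp add: l_def mult.assoc[symmetric])
        moreover have "rad_partial n (\<lambda>k. l * a k) t = \<tau> / (2 * v) * (\<epsilon> * ?S t)"
          by (simp add: partial_sum_def l_def sum_distrib_left mult_ac)
        moreover have "\<tau> / (2 * v) * \<tau> \<le> \<tau> / (2 * v) * (\<epsilon> * ?S t)"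
          using that assms by (intro mult_left_mono) (auto simp: A_def)
        ultimately show ?thesis by simp
      qed
      then show "indicator A t \<le> ennreal (exp (- (\<epsilon> * l * \<tau>) + rad_partial n (\<lambda>k. l * a k) t))"
        by (cases "t \<in> A") (simp_all add: ennreal_ge_1)
    qed
    also have "\<dots> \<le> ennreal (exp (- (\<epsilon> * l * \<tau>) + (\<Sum>k<n. (l * a k)\<^sup>2)))"
      by (rule exp_moment_partial_sum)
    also have "\<dots> \<le> ennreal (exp (- (\<tau>\<^sup>2 / (4 * v))))"
    proof (rule ennreal_leI)
      have "(\<Sum>k<n. (l * a k)\<^sup>2) = l\<^sup>2 * sq_sum n a" by (simp add: power_mult_distrib sum_distrib_left)
      also have "\<dots> \<le> l\<^sup>2 * v" using assms by (intro mult_left_mono) auto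
      also have "l\<^sup>2 = \<tau>\<^sup>2 / (4 * v\<^sup>2)" using e2 by (simp add: l_def power2_eq_square field_simps)
      also have "\<tau>\<^sup>2 / (4 * v\<^sup>2) * v = \<tau>\<^sup>2 / (4 * v)" using assms by (simp add: power2_eq_square)
      finally have "(\<Sum>k<n. (l * a k)\<^sup>2) \<le> \<tau>\<^sup>2 / (4 * v)" .
      moreover have "\<epsilon> * l * \<tau> = \<tau>\<^sup>2 / (2 * v)" using e2 by (simp add: l_def power2_eq_square mult.assoc[symmetric])
      moreover have "\<tau>\<^sup>2 / (2 * v) = \<tau>\<^sup>2 / (4 * v) + \<tau>\<^sup>2 / (4 * v)" using assms by (simp add: field_simps)
      ultimately show "exp (- (\<epsilon> * l * \<tau>) + (\<Sum>k<n. (l * a k)\<^sup>2)) \<le> exp (- (\<tau>\<^sup>2 / (4 * v)))"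
        unfolding exp_le_cancel_iff by linarith
    qed
    finally show ?thesis by (simp add: A_def)
  qed
  have "prob {t \<in> {0..1}. \<tau> < \<bar>?S t\<bar>} \<le>
      prob ({t \<in> {0..1}. \<tau> < 1 * ?S t} \<union> {t \<in> {0..1}. \<tau> < (-1) * ?S t})"
    by (intro prob_mono sets.Un sets_Collect01(1)) (auto simp: abs_if split: if_splits)
  also have "\<dots> \<le> prob {t \<in> {0..1}. \<tau> < 1 * ?S t} + prob {t \<in> {0..1}. \<tau> < (-1) * ?S t}"
    by (intro measure_Un_le sets_Collect01(1)) auto
  also have "\<dots> \<le> 2 * exp (- (\<tau>\<^sup>2 / (4 * v)))" using one[of 1] one[of "-1"] by simp
  finally show ?thesis .
qed

lemma distr_fun_rad_sum_le:
  assumes a: "l2_seq a" and v: "(l2_norm a)\<^sup>2 \<le> v" "v > 0" and "\<tau> \<ge> 0"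
  shows "distr_fun (rad_sum a) \<tau> \<le> 2 * exp (- (\<tau>\<^sup>2 / (4 * v)))"
proof -
  let ?q = "2 * exp (- (\<tau>\<^sup>2 / (4 * v)))"
  \<comment> \<open>The complement is used because \<open>|S| \<le> \<tau>\<close> is a closed
    condition and survives the limit.\<close>
  define A where "A n = {t \<in> {0..1}. \<bar>rad_partial n a t\<bar> \<le> \<tau>}" for n
  have A: "A n \<in> sets leb01" for n unfolding A_def by (rule sets_Collect01) measurable
  have Ap: "1 - ?q \<le> prob (A n)" for n
  proof -
    have "sq_sum n a \<le> v" using sum_square_le[OF a] v by (meson order_trans)
    then have "prob {t \<in> {0..1}. \<tau> < \<bar>rad_partial n a t\<bar>} \<le> ?q"
      using assms by (intro partial_sum_tail_bound) auto
    moreover have "{t \<in> {0..1}. \<tau> < \<bar>rad_partial n a t\<bar>} = space leb01 - A n"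
      by (auto simp: A_def prob_leb01)
    ultimately show ?thesis using leb01.finite_measure_compl[OF A, of n] by (simp add: prob_leb01)
  qed
  note io = measure_infinitely_often[of A, OF A Ap]
  let ?B = "{t \<in> {0..1}. \<bar>rad_sum a t\<bar> \<le> \<tau>}"
  have B: "?B \<in> sets leb01" by (rule sets_Collect01) measurable
  have "prob {t \<in> {0..1}. \<forall>N. \<exists>n\<ge>N. t \<in> A n} \<le> prob ?B"
  proof (rule measure_le_AE[OF io(1) B])
    show "AE t in leb01. t \<in> {t \<in> {0..1}. \<forall>N. \<exists>n\<ge>N. t \<in> A n} \<longrightarrow> t \<in> ?B"
      using AE_rad_sum_LIMSEQ[OF rad_convergent_l2[OF a]]
    proof eventually_elim
      case (elim t)
      have "eventually (\<lambda>n. \<bar>rad_partial n a t\<bar> > \<tau>) sequentially" if "\<not> \<bar>rad_sum a t\<bar> \<le> \<tau>"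
        using order_tendstoD(1)[OF tendsto_rabs[OF elim], of \<tau>] that by simp
      then show ?case by (fastforce simp: eventually_sequentially A_def)
    qed
  qed
  then have "1 - ?q \<le> prob ?B" using io(2) by simp
  moreover have "{t \<in> {0..1}. \<tau> < \<bar>rad_sum a t\<bar>} = space leb01 - ?B" by (auto simp: prob_leb01)
  ultimately show ?thesis
    using leb01.finite_measure_compl[OF B] by (simp add: distr_fun_def prob_leb01)
qed

lemma AE_rad_sum_linear:
  assumes "l2_seq a" "l2_seq b"
  shows "AE t in leb01. rad_sum (\<lambda>k. a k + c * b k) t = rad_sum a t + c * rad_sum b t"
  using AE_summable_signs[OF assms(1)] AE_summable_signs[OF assms(2)]
proof eventually_elim
  case (elim t)
  have "(\<lambda>k. a k * signs t k + c * (b k * signs t k)) sums (rad_sum a t + c * rad_sum b t)"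
    unfolding rad_sum_signs by (intro sums_add sums_mult summable_sums elim)
  then show ?case unfolding rad_sum_signs by (simp add: sums_iff algebra_simps)
qed

text \<open>Fatou's lemma bounds the second moment by that of the partial sums;
  \<open>2 * |x| * s \<le> x^2 + s^2\<close> leads from there to the first.\<close>

lemma rad_sum_moment:
  assumes a: "l2_seq a"
  shows "integrable leb01 (rad_sum a)" "(LINT t|leb01. \<bar>rad_sum a t\<bar>) \<le> l2_norm a"
proof -
  have "(\<integral>\<^sup>+t. ennreal ((rad_sum a t)\<^sup>2) \<partial>leb01) =
      (\<integral>\<^sup>+t. liminf (\<lambda>n. ennreal ((rad_partial n a t)\<^sup>2)) \<partial>leb01)"
  proof (rule nn_integral_cong_AE)
    show "AE t in leb01. ennreal ((rad_sum a t)\<^sup>2) = liminf (\<lambda>n. ennreal ((rad_partial n a t)\<^sup>2))"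
      using AE_rad_sum_LIMSEQ[OF rad_convergent_l2[OF a]]
    proof eventually_elim
      case (elim t)
      have "(\<lambda>n. ennreal ((rad_partial n a t)\<^sup>2)) \<longlonglongrightarrow> ennreal ((rad_sum a t)\<^sup>2)"
        by (intro tendsto_ennrealI tendsto_power elim)
      then show ?case by (rule lim_imp_Liminf[OF sequentially_bot, symmetric])
    qed
  qed
  also have "\<dots> \<le> liminf (\<lambda>n. \<integral>\<^sup>+t. ennreal ((rad_partial n a t)\<^sup>2) \<partial>leb01)"
    by (rule nn_integral_liminf) measurable
  also have "\<dots> = liminf (\<lambda>n. ennreal (sq_sum n a))"
    using moment2_partial_sum[of 0] by simp
  also have "\<dots> \<le> ennreal ((l2_norm a)\<^sup>2)"
  proof (rule Liminf_le)
    show "eventually (\<lambda>n. ennreal (sq_sum n a) \<le> ennreal ((l2_norm a)\<^sup>2)) sequentially"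
      using sum_square_le[OF a] by (intro always_eventually allI ennreal_leI)
  qed simp
  finally have le: "(\<integral>\<^sup>+t. ennreal ((rad_sum a t)\<^sup>2) \<partial>leb01) \<le> ennreal ((l2_norm a)\<^sup>2)" .
  have i2: "integrable leb01 (\<lambda>t. (rad_sum a t)\<^sup>2)"
    using le by (intro integrableI_nonneg) (auto intro: le_less_trans)
  have e2: "(LINT t|leb01. (rad_sum a t)\<^sup>2) \<le> (l2_norm a)\<^sup>2"
    using le i2 by (simp add: nn_integral_eq_integral)
  have c: "integrable leb01 (\<lambda>t. c::real)" for c by simp
  have pw: "\<bar>x\<bar> \<le> (x\<^sup>2 / s + s) / 2" if "s > 0" for x s :: real
  proof -
    have "0 \<le> (\<bar>x\<bar> - s)\<^sup>2" by simp
    then have "2 * \<bar>x\<bar> * s \<le> x\<^sup>2 + s\<^sup>2" by (simp add: power2_diff)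
    then show ?thesis using that by (simp add: field_simps power2_eq_square)
  qed
  show int: "integrable leb01 (rad_sum a)"
  proof (rule Bochner_Integration.integrable_bound)
    show "integrable leb01 (\<lambda>t. ((rad_sum a t)\<^sup>2 / 1 + 1) / 2)" using i2 by simp
    show "AE t in leb01. norm (rad_sum a t) \<le> norm (((rad_sum a t)\<^sup>2 / 1 + 1) / 2)"
      using pw[of 1 "rad_sum a _"] by (intro AE_I2) (simp add: order.trans[OF _ abs_ge_self])
  qed measurable
  have "(LINT t|leb01. \<bar>rad_sum a t\<bar>) \<le> l2_norm a + e" if "e > 0" for e
  proof -
    \<comment> \<open>Positive even if all coefficients vanish.\<close>
    let ?s = "l2_norm a + e"
    have s: "?s > 0" using that l2_norm_nonneg[OF a] by simp
    have "(LINT t|leb01. \<bar>rad_sum a t\<bar>) \<le> (LINT t|leb01. ((rad_sum a t)\<^sup>2 / ?s + ?s) / 2)"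
      using int i2 pw[OF s] by (intro integral_mono) auto
    also have "\<dots> = ((LINT t|leb01. (rad_sum a t)\<^sup>2) / ?s + ?s) / 2"
      using i2 by (simp add: prob_leb01(1))
    also have "\<dots> \<le> (?s\<^sup>2 / ?s + ?s) / 2"
    proof -
      have "(l2_norm a)\<^sup>2 \<le> ?s\<^sup>2" using that l2_norm_nonneg[OF a] by (intro power_mono) auto
      then show ?thesis using e2 s by (intro divide_right_mono add_mono) auto
    qed
    also have "\<dots> = ?s" using s by (simp add: power2_eq_square)
    finally show ?thesis .
  qed
  then show "(LINT t|leb01. \<bar>rad_sum a t\<bar>) \<le> l2_norm a" by (rule field_le_epsilon)
qed

lemma rad_sum_L1_lower:
  assumes a: "l2_seq a"
  shows "l2_norm a / 24 \<le> (LINT t|leb01. \<bar>rad_sum a t\<bar>)"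
proof -
  define A where "A = {t \<in> {0..1}. l2_norm a / 2 \<le> rad_sum a t}"
  have A: "A \<in> sets leb01" unfolding A_def by (rule sets_Collect01) measurable
  have A01: "A \<inter> {0..1} = A" by (auto simp: A_def)
  have iA: "integrable leb01 (indicator A :: real \<Rightarrow> real)"
    using A by (simp add: leb01.emeasure_eq_measure)
  have "l2_norm a / 24 = l2_norm a / 2 * (1 / 12)" by simp
  also have "\<dots> \<le> l2_norm a / 2 * prob A"
    using upper_tail_rad_sum[OF a] l2_norm_nonneg[OF a] by (intro mult_left_mono) (auto simp: A_def)
  also have "\<dots> = (LINT t|leb01. l2_norm a / 2 * indicator A t)" using A by (simp add: A01)
  also have "\<dots> \<le> (LINT t|leb01. \<bar>rad_sum a t\<bar>)"
  proof (intro integral_mono)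
    show "integrable leb01 (\<lambda>t. l2_norm a / 2 * indicator A t)" using iA by simp
    show "integrable leb01 (\<lambda>t. \<bar>rad_sum a t\<bar>)" using rad_sum_moment[OF a] by simp
    show "l2_norm a / 2 * indicator A t \<le> \<bar>rad_sum a t\<bar>" for t
      by (auto simp: A_def split: split_indicator)
  qed
  finally show ?thesis .
qed

text \<open>One-sided, so that for independent summands reaching \<open>x\<close> and reaching
  \<open>y\<close> together force \<open>x + y\<close>.\<close>

definition upper_tail :: "(nat \<Rightarrow> real) \<Rightarrow> real \<Rightarrow> real" where
  "upper_tail a x = prob {t \<in> {0..1}. x \<le> rad_sum a t}"

lemma upper_tail_antimono: "x \<le> y \<Longrightarrow> upper_tail a y \<le> upper_tail a x"
  unfolding upper_tail_def by (intro prob_mono sets_Collect01(1)) auto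

lemma upper_tail_nonneg: "0 \<le> upper_tail a x"
  by (simp add: upper_tail_def)

lemma upper_tail_step:
  assumes a: "l2_seq a"
  shows "upper_tail a x = (upper_tail (\<lambda>k. a (Suc k)) (x - a 0) + upper_tail (\<lambda>k. a (Suc k)) (x + a 0)) / 2"
proof -
  let ?a = "\<lambda>k. a (Suc k)"
  have a': "l2_seq ?a" using a by (subst summable_Suc_iff)
  have cn[measurable]: "(\<lambda>t. case_nat e (signs t) k) \<in> borel_measurable borel" for e k
    by (cases k) auto
  have m: "(\<lambda>t. \<Sum>k. a k * case_nat e (signs t) k) \<in> borel_measurable borel" for e
    by measurable
  note m'[measurable] = borel_leb01[OF m]
  have eq: "prob {t \<in> {0..1}. x \<le> (\<Sum>k. a k * case_nat e (signs t) k)} = upper_tail ?a (x - a 0 * e)" for e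
    unfolding upper_tail_def
  proof (rule measure_eq_AE)
    show "AE t in leb01. t \<in> {t \<in> {0..1}. x \<le> (\<Sum>k. a k * case_nat e (signs t) k)} \<longleftrightarrow>
        t \<in> {t \<in> {0..1}. x - a 0 * e \<le> rad_sum ?a t}"
      using AE_summable_signs[OF a']
    proof eventually_elim
      case (elim t)
      then have "summable (\<lambda>k. a (Suc k) * case_nat e (signs t) (Suc k))" by simp
      then have "summable (\<lambda>k. a k * case_nat e (signs t) k)" by (rule summable_Suc_iff[THEN iffD1])
      from suminf_split_head[OF this]
      have "(\<Sum>k. a k * case_nat e (signs t) k) = a 0 * e + rad_sum ?a t" by (simp add: rad_sum_signs)
      then show ?case by auto
    qed
    show "{t \<in> {0..1}. x \<le> (\<Sum>k. a k * case_nat e (signs t) k)} \<in> sets leb01"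
      by (rule sets_Collect01(1)) (rule borel_measurable_le[OF borel_measurable_const m', unfolded pred_def[symmetric]])
    show "{t \<in> {0..1}. x - a 0 * e \<le> rad_sum ?a t} \<in> sets leb01"
      by (rule sets_Collect01(1)) measurable
  qed
  show ?thesis
    using measure_signs_split[of "\<lambda>r. x \<le> (\<Sum>k. a k * r k)"] eq[of 1] eq[of "-1"]
    by (simp add: upper_tail_def[of a] rad_sum_signs)
qed

text \<open>Head and tail of the series are independent. Instead of a product measure, the induction
  averages over the first sign of the head; an empty head is the constant 0.\<close>

lemma upper_tail_product:
  assumes "l2_seq a"
  shows "upper_tail (trunc_seq n a) x * upper_tail (\<lambda>k. a (n + k)) y \<le> upper_tail a (x + y)"
  using assms
proof (induction n arbitrary: a x)
  case 0
  have z: "rad_sum (trunc_seq 0 a) t = 0" for t by (simp add: rad_sum_signs trunc_seq_def)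
  show ?case
  proof (cases "x \<le> 0")
    case True
    then have "upper_tail (trunc_seq 0 a) x = 1" by (simp add: upper_tail_def z)
    then show ?thesis using upper_tail_antimono[of "x + y" y a] True by simp
  next
    case False
    then have "upper_tail (trunc_seq 0 a) x = 0" by (simp add: upper_tail_def z)
    then show ?thesis by (simp add: upper_tail_nonneg)
  qed
next
  case (Suc n)
  let ?a = "\<lambda>k. a (Suc k)"
  have a': "l2_seq ?a" using Suc.prems by (subst summable_Suc_iff)
  have tr: "(\<lambda>k. trunc_seq (Suc n) a (Suc k)) = trunc_seq n ?a" "trunc_seq (Suc n) a 0 = a 0"
    by (auto simp: trunc_seq_def)
  have "upper_tail (trunc_seq (Suc n) a) x * upper_tail (\<lambda>k. a (Suc n + k)) y =
      (upper_tail (trunc_seq n ?a) (x - a 0) * upper_tail (\<lambda>k. ?a (n + k)) y +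
       upper_tail (trunc_seq n ?a) (x + a 0) * upper_tail (\<lambda>k. ?a (n + k)) y) / 2"
    by (subst upper_tail_step[OF l2_trunc_seq]) (simp add: tr algebra_simps)
  also have "\<dots> \<le> (upper_tail ?a (x - a 0 + y) + upper_tail ?a (x + a 0 + y)) / 2"
    by (intro divide_right_mono add_mono Suc.IH a') auto
  also have "\<dots> = upper_tail a (x + y)"
    by (subst upper_tail_step[OF Suc.prems]) (simp add: algebra_simps)
  finally show ?case .
qed

subsection \<open>The closure of the bounded functions in the exponential Orlicz space\<close>

abbreviation modular :: "(real \<Rightarrow> real) \<Rightarrow> (real \<Rightarrow> real) \<Rightarrow> real \<Rightarrow> ennreal" where
  "modular N x l \<equiv> \<integral>\<^sup>+t. ennreal (N (\<bar>x t\<bar> / l)) \<partial>leb01"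

text \<open>An intrinsic description of \<open>G\<close>, in terms of the distribution function
  alone and free of the choice of Orlicz function.\<close>

definition gauss_tail :: "(real \<Rightarrow> real) \<Rightarrow> bool" where
  "gauss_tail f \<longleftrightarrow> f \<in> meas01 \<and>
     (\<forall>\<beta>. \<exists>K. \<forall>\<tau>\<ge>0. distr_fun f \<tau> \<le> K * exp (- (\<beta> * \<tau>\<^sup>2)))"

lemma gauss_tail_mono:
  assumes "gauss_tail f" and g: "g \<in> meas01"
    and le: "\<And>\<tau>. \<tau> > 0 \<Longrightarrow> distr_fun g \<tau> \<le> C * distr_fun f \<tau>"
  shows "gauss_tail g"
  unfolding gauss_tail_def
proof (intro conjI allI g)
  fix \<beta>
  obtain K where K: "\<And>\<tau>. \<tau> \<ge> 0 \<Longrightarrow> distr_fun f \<tau> \<le> K * exp (- (\<beta> * \<tau>\<^sup>2))"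
    using assms(1) unfolding gauss_tail_def by blast
  \<comment> \<open>The 1 serves level 0, which the hypothesis does not reach.\<close>
  have "distr_fun g \<tau> \<le> max 1 (\<bar>C\<bar> * K) * exp (- (\<beta> * \<tau>\<^sup>2))" if "\<tau> \<ge> 0" for \<tau>
  proof (cases "\<tau> = 0")
    case True
    then show ?thesis using distr_fun_bounds(2)[of g 0] by simp
  next
    case False
    have "distr_fun g \<tau> \<le> C * distr_fun f \<tau>" using le False that by simp
    also have "\<dots> \<le> \<bar>C\<bar> * distr_fun f \<tau>" by (intro mult_right_mono distr_fun_bounds) auto
    also have "\<dots> \<le> \<bar>C\<bar> * (K * exp (- (\<beta> * \<tau>\<^sup>2)))" using K[OF that] by (intro mult_left_mono) auto
    also have "\<dots> = (\<bar>C\<bar> * K) * exp (- (\<beta> * \<tau>\<^sup>2))" by simp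
    also have "\<dots> \<le> max 1 (\<bar>C\<bar> * K) * exp (- (\<beta> * \<tau>\<^sup>2))" by (intro mult_right_mono) auto
    finally show ?thesis .
  qed
  then show "\<exists>K. \<forall>\<tau>\<ge>0. distr_fun g \<tau> \<le> K * exp (- (\<beta> * \<tau>\<^sup>2))" by blast
qed

text \<open>\<open>(\<tau> - 2 * B)^2 \<ge> 0\<close> gives
  \<open>(\<tau> - B)^2 \<ge> \<tau>^2 / 2 - B^2\<close>. Losing half of the order is harmless when
  every order is available.\<close>

lemma gauss_tail_perturbation:
  assumes f: "f \<in> meas01" and h: "h \<in> meas01"
    and B: "B \<ge> 0" "AE t in leb01. \<bar>f t - h t\<bar> \<le> B"
    and "\<beta> \<ge> 0" and "K \<ge> 0" and K: "\<And>\<tau>. \<tau> \<ge> 0 \<Longrightarrow> distr_fun h \<tau> \<le> K * exp (- (\<beta> * \<tau>\<^sup>2))"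
    and "\<tau> \<ge> 0"
  shows "distr_fun f \<tau> \<le> (1 + K) * exp (\<beta> * B\<^sup>2) * exp (- (\<beta> / 2 * \<tau>\<^sup>2))"
proof (cases "\<tau> \<ge> B")
  case True
  have "distr_fun f \<tau> \<le> distr_fun h (\<tau> - B)"
    by (rule distr_fun_mono_AE[OF h f]) (use B(2) in \<open>auto elim!: eventually_mono\<close>)
  also have "\<dots> \<le> K * exp (- (\<beta> * (\<tau> - B)\<^sup>2))" using True by (intro K) auto
  also have "\<dots> \<le> (1 + K) * exp (\<beta> * B\<^sup>2 + - (\<beta> / 2 * \<tau>\<^sup>2))"
  proof (rule mult_mono)
    have "0 \<le> \<beta> * ((\<tau> - 2 * B)\<^sup>2 / 2)" using \<open>\<beta> \<ge> 0\<close> by simp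
    then show "exp (- (\<beta> * (\<tau> - B)\<^sup>2)) \<le> exp (\<beta> * B\<^sup>2 + - (\<beta> / 2 * \<tau>\<^sup>2))"
      by (simp add: power2_eq_square algebra_simps)
  qed (use \<open>K \<ge> 0\<close> in auto)
  finally show ?thesis by (simp only: exp_add mult.assoc)
next
  case False
  have "distr_fun f \<tau> \<le> 1 * exp 0" using distr_fun_bounds(2)[of f \<tau>] by simp
  also have "\<dots> \<le> (1 + K) * exp (\<beta> * B\<^sup>2 + - (\<beta> / 2 * \<tau>\<^sup>2))"
  proof (rule mult_mono)
    have "\<beta> / 2 * \<tau>\<^sup>2 \<le> \<beta> * B\<^sup>2"
      using False \<open>\<tau> \<ge> 0\<close> \<open>\<beta> \<ge> 0\<close> by (intro mult_mono power_mono) auto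
    then show "exp 0 \<le> exp (\<beta> * B\<^sup>2 + - (\<beta> / 2 * \<tau>\<^sup>2))" by simp
  qed (use \<open>K \<ge> 0\<close> in auto)
  finally show ?thesis by (simp only: exp_add mult.assoc)
qed

lemma partial_sum_bound: "\<bar>rad_partial n a t\<bar> \<le> (\<Sum>k<n. \<bar>a k\<bar>)"
  unfolding partial_sum_def
  by (rule order_trans[OF sum_abs], rule sum_mono) (simp add: abs_mult abs_signs_le mult_left_le)

text \<open>Finitely many terms are bounded, and the remaining series has a norm as small as
  desired, hence a Gaussian tail of any prescribed order.\<close>

lemma gauss_tail_rad_sum:
  assumes a: "l2_seq a"
  shows "gauss_tail (rad_sum a)"
  unfolding gauss_tail_def
proof (intro conjI allI rad_sum_measurable)
  fix \<beta> :: real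
  \<comment> \<open>A squared norm below \<open>v = 1 / (8 * \<gamma>)\<close> gives the exponent
    \<open>1 / (4 * v) = 2 * \<gamma>\<close>, which the bounded perturbation halves to
    \<open>\<gamma> \<ge> \<beta>\<close>.\<close>
  define \<gamma> where "\<gamma> = \<bar>\<beta>\<bar> + 1"
  have "\<gamma> > 0" by (simp add: \<gamma>_def)
  then have "eventually (\<lambda>m. (l2_norm (tail_seq m a))\<^sup>2 < 1 / (8 * \<gamma>)) sequentially"
    by (intro order_tendstoD(2)[OF tail_seq_norm_tendsto_0[OF a]]) simp
  then obtain m where m: "(l2_norm (tail_seq m a))\<^sup>2 < 1 / (8 * \<gamma>)"
    by (auto simp: eventually_sequentially)
  define B where "B = (\<Sum>k<m. \<bar>a k\<bar>)"
  have "B \<ge> 0" unfolding B_def by (intro sum_nonneg) auto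
  have tail: "distr_fun (rad_sum (tail_seq m a)) \<tau> \<le> 2 * exp (- (2 * \<gamma> * \<tau>\<^sup>2))" if "\<tau> \<ge> 0" for \<tau>
    using distr_fun_rad_sum_le[OF l2_tail_seq(1)[OF a], of m "1 / (8 * \<gamma>)" \<tau>] m \<open>\<gamma> > 0\<close> that
    by (simp add: mult.commute mult.left_commute)
  have close: "AE t in leb01. \<bar>rad_sum a t - rad_sum (tail_seq m a) t\<bar> \<le> B"
    using AE_rad_sum_LIMSEQ[OF rad_convergent_l2[OF a]]
      AE_rad_sum_LIMSEQ[OF rad_convergent_l2[OF l2_tail_seq(1)[OF a]], of m]
  proof eventually_elim
    case (elim t)
    have "(\<lambda>n. rad_partial n a t - rad_partial n (tail_seq m a) t) \<longlonglongrightarrow>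
        rad_sum a t - rad_sum (tail_seq m a) t"
      by (intro tendsto_diff elim)
    moreover have "eventually (\<lambda>n. rad_partial n a t - rad_partial n (tail_seq m a) t
        = rad_partial m a t) sequentially"
      using eventually_ge_at_top[of m] by eventually_elim (simp add: partial_sum_tail_seq)
    ultimately have "rad_sum a t - rad_sum (tail_seq m a) t = rad_partial m a t"
      by (blast intro: LIMSEQ_unique tendsto_eventually)
    then show ?case using partial_sum_bound[of m a t] by (simp add: B_def)
  qed
  have "distr_fun (rad_sum a) \<tau> \<le> (1 + 2) * exp (2 * \<gamma> * B\<^sup>2) * exp (- (\<beta> * \<tau>\<^sup>2))" if "\<tau> \<ge> 0" for \<tau>
  proof -
    have "distr_fun (rad_sum a) \<tau> \<le> (1 + 2) * exp (2 * \<gamma> * B\<^sup>2) * exp (- (2 * \<gamma> / 2 * \<tau>\<^sup>2))"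
      using \<open>\<gamma> > 0\<close> that \<open>B \<ge> 0\<close>
      by (intro gauss_tail_perturbation[OF _ _ _ close _ _ tail]) auto
    also have "\<dots> \<le> (1 + 2) * exp (2 * \<gamma> * B\<^sup>2) * exp (- (\<beta> * \<tau>\<^sup>2))"
    proof -
      have "\<beta> * \<tau>\<^sup>2 \<le> 2 * \<gamma> / 2 * \<tau>\<^sup>2" by (rule mult_right_mono) (auto simp: \<gamma>_def)
      then show ?thesis by (intro mult_left_mono) auto
    qed
    finally show ?thesis .
  qed
  then show "\<exists>K. \<forall>\<tau>\<ge>0. distr_fun (rad_sum a) \<tau> \<le> K * exp (- (\<beta> * \<tau>\<^sup>2))" by blast
qed

section \<open>Gaussian tails and exponential integrability\<close>

lemma distr_fun_exp_markov:
  assumes h[measurable]: "h \<in> meas01"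
    and "(\<integral>\<^sup>+t. ennreal (exp (\<beta> * (h t)\<^sup>2)) \<partial>leb01) \<le> ennreal K" "K \<ge> 0" "\<beta> \<ge> 0" "\<tau> \<ge> 0"
  shows "distr_fun h \<tau> \<le> K * exp (- (\<beta> * \<tau>\<^sup>2))"
proof -
  let ?A = "{t \<in> {0..1}. \<tau> < \<bar>h t\<bar>}"
  have A: "?A \<in> sets leb01" by (rule sets_superlevel[OF h])
  have "ennreal (distr_fun h \<tau>) = (\<integral>\<^sup>+t. indicator ?A t \<partial>leb01)"
    using A by (simp only: distr_fun_def leb01.emeasure_eq_measure[symmetric] nn_integral_indicator)
  also have "\<dots> \<le> (\<integral>\<^sup>+t. ennreal (exp (- (\<beta> * \<tau>\<^sup>2))) * ennreal (exp (\<beta> * (h t)\<^sup>2)) \<partial>leb01)"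
  proof (rule nn_integral_mono)
    fix t
    have "1 \<le> exp (- (\<beta> * \<tau>\<^sup>2)) * exp (\<beta> * (h t)\<^sup>2)" if "t \<in> ?A"
    proof -
      have "\<tau>\<^sup>2 \<le> (h t)\<^sup>2" using that \<open>\<tau> \<ge> 0\<close> by (simp add: abs_le_square_iff[symmetric])
      then have "\<beta> * \<tau>\<^sup>2 \<le> \<beta> * (h t)\<^sup>2" using \<open>\<beta> \<ge> 0\<close> by (intro mult_left_mono)
      then show ?thesis by (simp flip: exp_add)
    qed
    then show "indicator ?A t \<le> ennreal (exp (- (\<beta> * \<tau>\<^sup>2))) * ennreal (exp (\<beta> * (h t)\<^sup>2))"
    proof (cases "t \<in> ?A")
      case True
      then show ?thesis
        using \<open>t \<in> ?A \<Longrightarrow> _\<close> by (simp only: ennreal_mult[symmetric] exp_ge_zero indicator_simps ennreal_ge_1)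
    qed simp
  qed
  also have "\<dots> = ennreal (exp (- (\<beta> * \<tau>\<^sup>2))) * (\<integral>\<^sup>+t. ennreal (exp (\<beta> * (h t)\<^sup>2)) \<partial>leb01)"
    by (rule nn_integral_cmult) measurable
  also have "\<dots> \<le> ennreal (exp (- (\<beta> * \<tau>\<^sup>2))) * ennreal K"
    by (intro mult_left_mono assms) auto
  also have "\<dots> = ennreal (K * exp (- (\<beta> * \<tau>\<^sup>2)))"
    using \<open>K \<ge> 0\<close> by (simp add: ennreal_mult[symmetric] mult.commute)
  finally show ?thesis using \<open>K \<ge> 0\<close> by (simp add: ennreal_le_iff)
qed

lemma gauss_tail_exp_integrable:
  assumes f: "gauss_tail f" and "\<beta> \<ge> 0"
  shows "(\<integral>\<^sup>+t. ennreal (exp (\<beta> * (f t)\<^sup>2)) \<partial>leb01) < \<infinity>"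
proof -
  have fm[measurable]: "f \<in> meas01" using f by (simp add: gauss_tail_def)
  \<comment> \<open>Slicing at integers leaves the exponent \<open>\<beta> * (n + 1)^2 - \<mu> * (n
    / 2)^2 = 2 * \<beta> - \<beta> * (n - 1)^2 - n^2\<close>. The level is \<open>n / 2\<close>
    because \<open>A n\<close> has a weak inequality and \<open>distr_fun\<close> a strict
    one.\<close>
  define \<mu> where "\<mu> = 4 * (2 * \<beta> + 1)"
  obtain K0 where K0: "\<And>\<tau>. \<tau> \<ge> 0 \<Longrightarrow> distr_fun f \<tau> \<le> K0 * exp (- (\<mu> * \<tau>\<^sup>2))"
    using f unfolding gauss_tail_def by blast
  define K where "K = max 1 K0"
  have K: "distr_fun f \<tau> \<le> K * exp (- (\<mu> * \<tau>\<^sup>2))" if "\<tau> \<ge> 0" for \<tau>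
  proof -
    have "K0 * exp (- (\<mu> * \<tau>\<^sup>2)) \<le> K * exp (- (\<mu> * \<tau>\<^sup>2))" by (intro mult_right_mono) (auto simp: K_def)
    then show ?thesis using K0[OF that] by linarith
  qed
  define A where "A n = {t \<in> {0..1}. real n \<le> \<bar>f t\<bar>}" for n
  have A[measurable]: "A n \<in> sets leb01" for n unfolding A_def by (rule sets_Collect01) measurable
  have mA: "prob (A n) \<le> K * exp (- (\<mu> * (real n / 2)\<^sup>2))" for n
  proof (cases "n = 0")
    case True
    then show ?thesis using prob_le_1[of "A n"] by (simp add: K_def)
  next
    case False
    have "prob (A n) \<le> distr_fun f (real n / 2)"
      unfolding distr_fun_def using False
      by (intro prob_mono sets_superlevel fm) (auto simp: A_def)
    also have "\<dots> \<le> K * exp (- (\<mu> * (real n / 2)\<^sup>2))" by (intro K) simp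
    finally show ?thesis .
  qed
  let ?c = "\<lambda>n. exp (\<beta> * (real n + 1)\<^sup>2)"
  have "(\<integral>\<^sup>+t. ennreal (exp (\<beta> * (f t)\<^sup>2)) \<partial>leb01) \<le> (\<integral>\<^sup>+t. (\<Sum>n. ennreal (?c n) * indicator (A n) t) \<partial>leb01)"
  proof (rule nn_integral_mono)
    fix t assume t: "t \<in> space leb01"
    define n where "n = nat \<lfloor>\<bar>f t\<bar>\<rfloor>"
    have n: "real n \<le> \<bar>f t\<bar>" "\<bar>f t\<bar> \<le> real n + 1" unfolding n_def by linarith+
    have "(f t)\<^sup>2 \<le> (real n + 1)\<^sup>2" using n by (simp add: abs_le_square_iff[symmetric])
    then have "ennreal (exp (\<beta> * (f t)\<^sup>2)) \<le> ennreal (?c n) * indicator (A n) t"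
      using n t \<open>\<beta> \<ge> 0\<close> by (simp add: A_def prob_leb01 mult_left_mono ennreal_leI)
    also have "\<dots> \<le> (\<Sum>n. ennreal (?c n) * indicator (A n) t)"
    proof -
      have "g n \<le> suminf g" for g :: "nat \<Rightarrow> ennreal" using sum_le_suminf[of g "{n}"] by simp
      then show ?thesis .
    qed
    finally show "ennreal (exp (\<beta> * (f t)\<^sup>2)) \<le> (\<Sum>n. ennreal (?c n) * indicator (A n) t)" .
  qed
  also have "\<dots> = (\<Sum>n. \<integral>\<^sup>+t. ennreal (?c n) * indicator (A n) t \<partial>leb01)"
    by (rule nn_integral_suminf) measurable
  also have "\<dots> = (\<Sum>n. ennreal (?c n * prob (A n)))"
    by (simp add: nn_integral_cmult_indicator A leb01.emeasure_eq_measure ennreal_mult)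
  also have "\<dots> \<le> (\<Sum>n. ennreal (K * exp (2 * \<beta>) * exp (-1) ^ n))"
  proof (intro suminf_le summableI ennreal_leI)
    fix n :: nat
    have "?c n * prob (A n) \<le> ?c n * (K * exp (- (\<mu> * (real n / 2)\<^sup>2)))"
      by (intro mult_left_mono mA) auto
    also have "\<dots> = K * exp (\<beta> * (real n + 1)\<^sup>2 - \<mu> * (real n / 2)\<^sup>2)"
      by (simp only: diff_conv_add_uminus exp_add mult_ac)
    also have "\<dots> \<le> K * exp (2 * \<beta> + real n * (-1))"
    proof (intro mult_left_mono exp_le_cancel_iff[THEN iffD2])
      have "\<beta> * (real n + 1)\<^sup>2 - \<mu> * (real n / 2)\<^sup>2 = 2 * \<beta> - \<beta> * (real n - 1)\<^sup>2 - (real n)\<^sup>2"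
        by (simp add: \<mu>_def power2_eq_square field_simps)
      also have "\<dots> \<le> 2 * \<beta> - (real n)\<^sup>2" using \<open>\<beta> \<ge> 0\<close> by simp
      also have "\<dots> \<le> 2 * \<beta> + real n * (-1)"
        by (cases n) (simp_all add: power2_eq_square algebra_simps)
      finally show "\<beta> * (real n + 1)\<^sup>2 - \<mu> * (real n / 2)\<^sup>2 \<le> 2 * \<beta> + real n * (-1)" .
    qed (simp add: K_def)
    also have "\<dots> = K * exp (2 * \<beta>) * exp (-1) ^ n"
      by (simp only: exp_add exp_of_nat_mult mult.assoc)
    finally show "?c n * prob (A n) \<le> K * exp (2 * \<beta>) * exp (-1) ^ n" .
  qed
  also have "\<dots> < \<infinity>"
  proof -
    have "(\<Sum>n. ennreal (K * exp (2 * \<beta>) * exp (-1) ^ n)) \<noteq> top"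
      by (rule ennreal_suminf_neq_top) (auto simp: K_def intro!: summable_mult summable_geometric)
    then show ?thesis by (simp add: less_top)
  qed
  finally show ?thesis .
qed

section \<open>Orlicz spaces and the Luxemburg norm\<close>

context
  fixes N :: "real \<Rightarrow> real"
  assumes N: "orlicz_function N"
begin

lemma orlicz_scale: "0 \<le> c \<Longrightarrow> c \<le> 1 \<Longrightarrow> 0 \<le> u \<Longrightarrow> N (c * u) \<le> c * N u"
  using N convex_onD[of "{0..}" N c 0 u] by (simp add: orlicz_function_def)

lemma orlicz_nonneg: "0 \<le> u \<Longrightarrow> 0 \<le> N u"
  using N by (cases "u = 0") (auto simp: orlicz_function_def less_eq_real_def)

lemma orlicz_mono:
  assumes "0 \<le> u" "u \<le> v"
  shows "N u \<le> N v"
proof (cases "v = 0")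
  case False
  then have "N (u / v * v) \<le> u / v * N v" using assms by (intro orlicz_scale) auto
  also have "\<dots> \<le> 1 * N v" using assms False orlicz_nonneg by (intro mult_right_mono) auto
  finally show ?thesis using False by simp
qed (use assms in simp)

lemma orlicz_measurable:
  assumes [measurable]: "x \<in> meas01" and "l > 0"
  shows "(\<lambda>t. ennreal (N (\<bar>x t\<bar> / l))) \<in> borel_measurable leb01"
proof -
  have [measurable]: "(\<lambda>u. N (max 0 u)) \<in> borel_measurable borel"
    by (intro borel_measurable_mono monoI orlicz_mono) auto
  have "(\<lambda>t. ennreal (N (max 0 (\<bar>x t\<bar> / l)))) \<in> borel_measurable leb01"
    by (rule measurable_compose[of "\<lambda>t. \<bar>x t\<bar> / l" leb01 borel "\<lambda>u. ennreal (N (max 0 u))"]) measurable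
  then show ?thesis using \<open>l > 0\<close> by simp
qed

lemma orlicz_carr_iff:
  "x \<in> carr (orlicz_space N) \<longleftrightarrow>
     x \<in> meas01 \<and> (\<exists>l>0. modular N x l < \<infinity>)"
  by (simp add: orlicz_space_def)

text \<open>Convexity and \<open>N 0 = 0\<close> give \<open>N (u / k) \<le> N u / k\<close> for
  \<open>k \<ge> 1\<close>, so a finite modular can be scaled below 1. Thus the Luxemburg infimum is
  over a nonempty set.\<close>

lemma orlicz_carr_unit:
  assumes x: "x \<in> carr (orlicz_space N)"
  obtains l where "l > 0" "modular N x l \<le> 1"
proof -
  obtain l where l: "l > 0" "modular N x l < \<infinity>"
    and xm: "x \<in> meas01"
    using x by (auto simp: orlicz_carr_iff)
  then obtain r where r: "0 \<le> r" "modular N x l = ennreal r"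
    by (cases "modular N x l") auto
  define k where "k = max 1 r"
  have k: "k \<ge> 1" "r / k \<le> 1" by (auto simp: k_def)
  have "modular N x (k * l) \<le> (\<integral>\<^sup>+t. ennreal (1 / k) * ennreal (N (\<bar>x t\<bar> / l)) \<partial>leb01)"
  proof (rule nn_integral_mono)
    fix t
    have "N (1 / k * (\<bar>x t\<bar> / l)) \<le> 1 / k * N (\<bar>x t\<bar> / l)" using k l by (intro orlicz_scale) auto
    then show "ennreal (N (\<bar>x t\<bar> / (k * l))) \<le> ennreal (1 / k) * ennreal (N (\<bar>x t\<bar> / l))"
      using k l orlicz_nonneg[of "\<bar>x t\<bar> / l"] by (simp add: ennreal_mult[symmetric] ennreal_leI)
  qed
  also have "\<dots> = ennreal (1 / k) * ennreal r"
    using orlicz_measurable[OF xm l(1)] r by (simp add: nn_integral_cmult)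
  also have "\<dots> = ennreal (r / k)" using k r by (simp add: ennreal_mult[symmetric])
  also have "\<dots> \<le> 1" using k by simp
  finally show thesis using that[of "k * l"] k l by simp
qed

text \<open>\<open>nrm\<close> is meaningful on \<open>carr\<close> only, so membership must be
  settled before closeness in norm can be exploited.\<close>

lemma orlicz_carr_diff_bounded:
  assumes x: "x \<in> carr (orlicz_space N)" and y[measurable]: "y \<in> meas01"
    and B: "AE t in leb01. \<bar>y t\<bar> \<le> B"
  shows "(\<lambda>t. x t - y t) \<in> carr (orlicz_space N)"
proof -
  obtain l where l: "l > 0" "modular N x l \<le> 1"
    using orlicz_carr_unit[OF x] .
  have xm[measurable]: "x \<in> meas01" using x by (simp add: orlicz_carr_iff)
  have "(\<integral>\<^sup>+t. ennreal (N (\<bar>x t - y t\<bar> / (2 * l))) \<partial>leb01) \<le>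
      (\<integral>\<^sup>+t. ennreal (N (\<bar>x t\<bar> / l)) + ennreal (N (\<bar>B\<bar> / l)) \<partial>leb01)"
  proof (rule nn_integral_mono_AE)
    show "AE t in leb01. ennreal (N (\<bar>x t - y t\<bar> / (2 * l))) \<le> ennreal (N (\<bar>x t\<bar> / l)) + ennreal (N (\<bar>B\<bar> / l))"
      using B
    proof eventually_elim
      case (elim t)
      have "N (\<bar>x t - y t\<bar> / (2 * l)) \<le> N (max (\<bar>x t\<bar> / l) (\<bar>B\<bar> / l))"
      proof (rule orlicz_mono)
        have "\<bar>x t - y t\<bar> / (2 * l) \<le> (\<bar>x t\<bar> + \<bar>B\<bar>) / (2 * l)"
          using elim l by (intro divide_right_mono) auto
        also have "\<dots> = (\<bar>x t\<bar> / l + \<bar>B\<bar> / l) / 2" using l by (simp add: field_simps)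
        also have "\<dots> \<le> max (\<bar>x t\<bar> / l) (\<bar>B\<bar> / l)"
        proof -
          have "(p + q) / 2 \<le> max p q" for p q :: real by (simp add: max_def)
          then show ?thesis .
        qed
        finally show "\<bar>x t - y t\<bar> / (2 * l) \<le> max (\<bar>x t\<bar> / l) (\<bar>B\<bar> / l)" .
      qed (use l in simp)
      also have "\<dots> \<le> N (\<bar>x t\<bar> / l) + N (\<bar>B\<bar> / l)"
        using orlicz_nonneg[of "\<bar>x t\<bar> / l"] orlicz_nonneg[of "\<bar>B\<bar> / l"] l by (auto simp: max_def)
      finally show ?case
        using orlicz_nonneg[of "\<bar>x t\<bar> / l"] orlicz_nonneg[of "\<bar>B\<bar> / l"] l
        by (simp add: ennreal_plus[symmetric] ennreal_leI del: ennreal_plus)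
    qed
  qed
  also have "\<dots> = modular N x l + ennreal (N (\<bar>B\<bar> / l))"
    using orlicz_measurable[OF xm l(1)] by (simp add: nn_integral_add)
  also have "\<dots> < \<infinity>" using l(2) by (auto simp: less_top[symmetric] top_unique)
  finally show ?thesis unfolding orlicz_carr_iff using l by (intro conjI exI[of _ "2 * l"]) auto
qed

lemma orlicz_nrm_less:
  assumes x: "x \<in> carr (orlicz_space N)" and "nrm (orlicz_space N) x < e"
  obtains l where "0 < l" "l < e" "modular N x l \<le> 1"
proof -
  let ?S = "{l. 0 < l \<and> modular N x l \<le> 1}"
  have "?S \<noteq> {}" using orlicz_carr_unit[OF x] by blast
  moreover have "Inf ?S < e" using assms(2) by (simp add: orlicz_space_def)
  ultimately show thesis using cInf_lessD[of ?S e] that by blast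
qed

lemma orlicz_nrm_le:
  assumes "0 < l" "modular N x l \<le> 1"
  shows "nrm (orlicz_space N) x \<le> l"
  unfolding orlicz_space_def using assms
  by (auto intro!: cInf_lower bdd_belowI[of _ 0])

text \<open>If a bounded \<open>y\<close> is closer to \<open>f\<close> than \<open>e\<close>, then
  \<open>exp\<close> of \<open>c^2 / l^2\<close> times \<open>(f - y)^2\<close> is integrable for
  some \<open>l < e\<close>; Markov's inequality and a bounded perturbation give the tail of
  \<open>f\<close>.\<close>

lemma gauss_tail_of_closure:
  assumes c: "c > 0" and u0: "u0 \<ge> 0" and low: "\<And>u. u \<ge> u0 \<Longrightarrow> exp ((c * u)\<^sup>2) - 1 \<le> N u"
    and f: "f \<in> closure_L_inf (orlicz_space N)"
  shows "gauss_tail f"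
  unfolding gauss_tail_def
proof (intro conjI allI)
  have fc: "f \<in> carr (orlicz_space N)" using f by (simp add: closure_L_inf_def)
  then show fm[measurable]: "f \<in> meas01" by (simp add: orlicz_carr_iff)
  fix \<kappa> :: real
  \<comment> \<open>So that \<open>c^2 / e^2 = 2 * (|\<kappa>| + 1)\<close>, twice a sufficient
    order: the perturbation halves it.\<close>
  define e where "e = c / sqrt (2 * (\<bar>\<kappa>\<bar> + 1))"
  have e: "e > 0" using c by (simp add: e_def)
  have e2: "c\<^sup>2 / e\<^sup>2 = 2 * (\<bar>\<kappa>\<bar> + 1)" using c by (simp add: e_def power_divide)
  obtain y where y: "y \<in> L_inf" "nrm (orlicz_space N) (\<lambda>t. f t - y t) < e"
    using f e by (auto simp: closure_L_inf_def)
  then obtain B where ym[measurable]: "y \<in> meas01" and B: "AE t in leb01. \<bar>y t\<bar> \<le> B"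
    by (auto simp: L_inf_def)
  obtain l where l: "0 < l" "l < e" "modular N (\<lambda>t. f t - y t) l \<le> 1"
    using orlicz_nrm_less[OF orlicz_carr_diff_bounded[OF fc ym B] y(2)] .
  define \<beta> where "\<beta> = c\<^sup>2 / l\<^sup>2"
  have "e\<^sup>2 \<ge> l\<^sup>2" using l by (intro power_mono) auto
  then have \<beta>: "\<beta> \<ge> 2 * (\<bar>\<kappa>\<bar> + 1)"
    unfolding e2[symmetric] \<beta>_def using c l e by (intro divide_left_mono) auto
  \<comment> \<open>Absorbs the \<open>- 1\<close> and the arguments below \<open>u0\<close>, where
    \<open>N\<close> is not compared with the exponential.\<close>
  define R where "R = 1 + exp ((c * u0)\<^sup>2)"
  have R: "R \<ge> 0" by (simp add: R_def add_nonneg_nonneg)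
  have "(\<integral>\<^sup>+t. ennreal (exp (\<beta> * (f t - y t)\<^sup>2)) \<partial>leb01) \<le>
      (\<integral>\<^sup>+t. ennreal (N (\<bar>f t - y t\<bar> / l)) + ennreal R \<partial>leb01)"
  proof (rule nn_integral_mono)
    fix t
    let ?u = "\<bar>f t - y t\<bar> / l"
    have u: "?u \<ge> 0" using l by simp
    have "\<beta> * (f t - y t)\<^sup>2 = (c * ?u)\<^sup>2" by (simp add: \<beta>_def power_mult_distrib power_divide)
    moreover have "exp ((c * ?u)\<^sup>2) \<le> N ?u + R"
    proof (cases "?u \<ge> u0")
      case True
      then show ?thesis using low[OF True] exp_ge_zero[of "(c * u0)\<^sup>2"] unfolding R_def by linarith
    next
      case False
      then have "(c * ?u)\<^sup>2 \<le> (c * u0)\<^sup>2" using c u by (intro power_mono mult_left_mono mult_nonneg_nonneg) auto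
      then have "exp ((c * ?u)\<^sup>2) \<le> exp ((c * u0)\<^sup>2)" by simp
      then show ?thesis using orlicz_nonneg[OF u] unfolding R_def by linarith
    qed
    ultimately show "ennreal (exp (\<beta> * (f t - y t)\<^sup>2)) \<le> ennreal (N ?u) + ennreal R"
      using orlicz_nonneg[OF u] R by (simp add: ennreal_plus[symmetric] ennreal_leI del: ennreal_plus)
  qed
  also have "\<dots> = modular N (\<lambda>t. f t - y t) l + ennreal R"
    using orlicz_measurable[of "\<lambda>t. f t - y t" l] l(1) by (simp add: nn_integral_add)
  also have "\<dots> \<le> 1 + ennreal R" using l(3) by (rule add_right_mono)
  also have "\<dots> = ennreal (1 + R)" using R by simp
  finally have tail: "distr_fun (\<lambda>t. f t - y t) \<tau> \<le> (1 + R) * exp (- (\<beta> * \<tau>\<^sup>2))" if "\<tau> \<ge> 0" for \<tau>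
    using \<beta> R that by (intro distr_fun_exp_markov) auto
  have "distr_fun f \<tau> \<le> (1 + (1 + R)) * exp (\<beta> * \<bar>B\<bar>\<^sup>2) * exp (- (\<kappa> * \<tau>\<^sup>2))" if "\<tau> \<ge> 0" for \<tau>
  proof -
    have "distr_fun f \<tau> \<le> (1 + (1 + R)) * exp (\<beta> * \<bar>B\<bar>\<^sup>2) * exp (- (\<beta> / 2 * \<tau>\<^sup>2))"
    proof (rule gauss_tail_perturbation[OF fm _ _ _ _ _ tail that])
      show "AE t in leb01. \<bar>f t - (f t - y t)\<bar> \<le> \<bar>B\<bar>" using B by (auto elim!: eventually_mono)
    qed (use \<beta> R in auto)
    also have "\<dots> \<le> (1 + (1 + R)) * exp (\<beta> * \<bar>B\<bar>\<^sup>2) * exp (- (\<kappa> * \<tau>\<^sup>2))"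
    proof -
      have "\<kappa> * \<tau>\<^sup>2 \<le> \<beta> / 2 * \<tau>\<^sup>2" using \<beta> by (intro mult_right_mono) auto
      then show ?thesis using R by (intro mult_left_mono) auto
    qed
    finally show ?thesis .
  qed
  then show "\<exists>K. \<forall>\<tau>\<ge>0. distr_fun f \<tau> \<le> K * exp (- (\<kappa> * \<tau>\<^sup>2))" by blast
qed

text \<open>Clipping at height \<open>M\<close>: where \<open>|f| > M\<close>, raising the
  exponential order from \<open>\<beta>\<close> to \<open>\<beta> + 1\<close> gains a factor
  \<open>exp (- M^2)\<close>, which outweighs the finite integral \<open>J\<close>.\<close>

lemma closure_of_gauss_tail:
  assumes C: "C > 0" and u0: "u0 \<ge> 0" and up: "\<And>u. u \<ge> u0 \<Longrightarrow> N u \<le> exp ((C * u)\<^sup>2) - 1"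
    and f: "gauss_tail f"
  shows "f \<in> closure_L_inf (orlicz_space N)"
proof -
  have carr: "g \<in> carr (orlicz_space N)" if g: "gauss_tail g" for g
  proof -
    have gm[measurable]: "g \<in> meas01" using g by (simp add: gauss_tail_def)
    have "modular N g 1 \<le>
        (\<integral>\<^sup>+t. ennreal (exp (C\<^sup>2 * (g t)\<^sup>2)) + ennreal (N u0) \<partial>leb01)"
    proof (rule nn_integral_mono)
      fix t
      have "N \<bar>g t\<bar> \<le> exp (C\<^sup>2 * (g t)\<^sup>2) + N u0"
      proof (cases "\<bar>g t\<bar> \<ge> u0")
        case True
        then show ?thesis using up[OF True] orlicz_nonneg[OF u0] by (simp add: power_mult_distrib)
      next
        case False
        then have "N \<bar>g t\<bar> \<le> N u0" by (intro orlicz_mono) auto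
        then show ?thesis by (simp add: add_increasing)
      qed
      then show "ennreal (N (\<bar>g t\<bar> / 1)) \<le> ennreal (exp (C\<^sup>2 * (g t)\<^sup>2)) + ennreal (N u0)"
        using orlicz_nonneg[OF u0] by (simp add: ennreal_plus[symmetric] ennreal_leI del: ennreal_plus)
    qed
    also have "\<dots> = (\<integral>\<^sup>+t. ennreal (exp (C\<^sup>2 * (g t)\<^sup>2)) \<partial>leb01) + ennreal (N u0)"
      by (simp add: nn_integral_add)
    also have "\<dots> < \<infinity>" using gauss_tail_exp_integrable[OF g, of "C\<^sup>2"] by simp
    finally show ?thesis unfolding orlicz_carr_iff by (intro conjI gm exI[of _ 1]) auto
  qed
  have fm[measurable]: "f \<in> meas01" using f by (simp add: gauss_tail_def)
  have "\<exists>y\<in>L_inf \<inter> carr (orlicz_space N). nrm (orlicz_space N) (\<lambda>t. f t - y t) < e" if "e > 0" for e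
  proof -
    define l where "l = e / 2"
    have l: "l > 0" "l < e" using that by (auto simp: l_def)
    define \<beta> where "\<beta> = C\<^sup>2 / l\<^sup>2"
    have \<beta>: "\<beta> \<ge> 0" by (simp add: \<beta>_def)
    have "(\<integral>\<^sup>+t. ennreal (exp ((\<beta> + 1) * (f t)\<^sup>2)) \<partial>leb01) < \<infinity>"
      using \<beta> by (intro gauss_tail_exp_integrable f) auto
    then obtain J where J: "J \<ge> 0" "(\<integral>\<^sup>+t. ennreal (exp ((\<beta> + 1) * (f t)\<^sup>2)) \<partial>leb01) = ennreal J"
      by (cases "(\<integral>\<^sup>+t. ennreal (exp ((\<beta> + 1) * (f t)\<^sup>2)) \<partial>leb01)") auto
    \<comment> \<open>\<open>M \<ge> l * u0\<close> brings \<open>|f| > M\<close> into the range of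
      the estimate for \<open>N\<close>; \<open>M \<ge> J + 1\<close> and \<open>M \<ge> 1\<close>
      give \<open>J \<le> exp M \<le> exp (M^2)\<close>.\<close>
    define M where "M = max (l * u0) (max 1 (J + 1))"
    have M: "M \<ge> 1" "M \<ge> l * u0" "M \<ge> J + 1" by (auto simp: M_def)
    have expM: "exp (- M\<^sup>2) * J \<le> 1"
    proof -
      have "J \<le> 1 + M" using M by simp
      also have "\<dots> \<le> exp M" by (rule exp_ge_add_one_self)
      also have "\<dots> \<le> exp (M\<^sup>2)" using M by (simp add: power2_eq_square)
      finally show ?thesis by (simp add: exp_minus field_simps)
    qed
    define y where "y t = max (- M) (min M (f t))" for t
    have ym[measurable]: "y \<in> meas01" unfolding y_def by measurable
    have yM: "\<bar>y t\<bar> \<le> M" "\<bar>y t\<bar> \<le> \<bar>f t\<bar>" "\<bar>f t - y t\<bar> \<le> \<bar>f t\<bar>" "\<bar>f t\<bar> \<le> M \<Longrightarrow> f t - y t = 0" for t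
      using M(1) by (auto simp: y_def max_def min_def; linarith)+
    have "gauss_tail y"
    proof (rule gauss_tail_mono[OF f ym, where C = 1])
      fix \<tau> :: real
      show "distr_fun y \<tau> \<le> 1 * distr_fun f \<tau>"
        using yM(2) by (auto intro!: distr_fun_mono_AE fm ym AE_I2 intro: less_le_trans)
    qed
    then have "y \<in> L_inf \<inter> carr (orlicz_space N)"
      using carr yM(1) by (auto simp: L_inf_def)
    moreover have "nrm (orlicz_space N) (\<lambda>t. f t - y t) \<le> l"
    proof (rule orlicz_nrm_le[OF l(1)])
      have "modular N (\<lambda>t. f t - y t) l \<le>
          (\<integral>\<^sup>+t. ennreal (exp (- M\<^sup>2)) * ennreal (exp ((\<beta> + 1) * (f t)\<^sup>2)) \<partial>leb01)"
      proof (rule nn_integral_mono)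
        fix t
        have "N (\<bar>f t - y t\<bar> / l) \<le> exp (- M\<^sup>2) * exp ((\<beta> + 1) * (f t)\<^sup>2)"
        proof (cases "\<bar>f t\<bar> \<le> M")
          case True
          then show ?thesis using yM(4)[OF True] N by (simp add: orlicz_function_def)
        next
          case False
          have "N (\<bar>f t - y t\<bar> / l) \<le> N (\<bar>f t\<bar> / l)"
            using l yM(3) by (intro orlicz_mono divide_right_mono) auto
          also have "\<dots> \<le> exp ((C * (\<bar>f t\<bar> / l))\<^sup>2)"
          proof -
            have "u0 * l \<le> \<bar>f t\<bar>" using False M(2) by (simp add: mult.commute)
            then show ?thesis using up[of "\<bar>f t\<bar> / l"] l by (simp add: pos_le_divide_eq)
          qed
          also have "(C * (\<bar>f t\<bar> / l))\<^sup>2 = \<beta> * (f t)\<^sup>2"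
            by (simp add: \<beta>_def power_mult_distrib power_divide)
          also have "exp (\<beta> * (f t)\<^sup>2) \<le> exp (- M\<^sup>2 + (\<beta> + 1) * (f t)\<^sup>2)"
          proof -
            have "M\<^sup>2 \<le> (f t)\<^sup>2" using False M(1) by (simp add: abs_le_square_iff[symmetric])
            then show ?thesis by (simp add: algebra_simps)
          qed
          finally show ?thesis by (simp only: exp_add)
        qed
        then show "ennreal (N (\<bar>f t - y t\<bar> / l)) \<le> ennreal (exp (- M\<^sup>2)) * ennreal (exp ((\<beta> + 1) * (f t)\<^sup>2))"
          by (simp add: ennreal_mult[symmetric] ennreal_leI)
      qed
      also have "\<dots> = ennreal (exp (- M\<^sup>2)) * ennreal J"
        by (simp add: nn_integral_cmult J)
      also have "\<dots> \<le> 1" using J(1) expM by (simp add: ennreal_mult[symmetric])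
      finally show "modular N (\<lambda>t. f t - y t) l \<le> 1" .
    qed
    ultimately show ?thesis using l by (intro bexI[of _ y]) auto
  qed
  then show ?thesis using carr[OF f] by (simp add: closure_L_inf_def)
qed

lemma closure_L_inf_iff_gauss_tail:
  assumes "orlicz_equivalent N (\<lambda>u. exp (u\<^sup>2) - 1)"
  shows "f \<in> closure_L_inf (orlicz_space N) \<longleftrightarrow> gauss_tail f"
proof -
  obtain c C u0 where "c > 0" "C > 0" "u0 \<ge> 0"
    "\<And>u. u \<ge> u0 \<Longrightarrow> exp ((c * u)\<^sup>2) - 1 \<le> N u \<and> N u \<le> exp ((C * u)\<^sup>2) - 1"
    using assms unfolding orlicz_equivalent_def by blast
  then show ?thesis using gauss_tail_of_closure closure_of_gauss_tail by metis
qed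

end

subsection \<open>Uniform boundedness on square-summable sequences\<close>

lemma L2_set_le_l2_norm: "l2_seq a \<Longrightarrow> L2_set a {..<n} \<le> l2_norm a"
  unfolding L2_set_def l2_norm_def by (intro real_sqrt_le_mono sum_le_suminf) auto

lemma l2_seqI:
  assumes "\<And>n. L2_set a {..<n} \<le> M"
  shows "l2_seq a" "l2_norm a \<le> M"
proof -
  have M: "M \<ge> 0" using assms[of 0] by simp
  have b: "sq_sum n a \<le> M\<^sup>2" for n
  proof -
    have "(L2_set a {..<n})\<^sup>2 \<le> M\<^sup>2" using assms by (intro power_mono L2_set_nonneg)
    then show ?thesis by (simp add: L2_set_def sum_nonneg)
  qed
  show s: "l2_seq a" by (rule summableI_nonneg_bounded[OF _ b]) simp
  have "(\<Sum>k. (a k)\<^sup>2) \<le> M\<^sup>2" by (rule suminf_le_const[OF s b])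
  then show "l2_norm a \<le> M" unfolding l2_norm_def using M by (intro real_le_lsqrt suminf_nonneg s) auto
qed

lemma L2_set_scale: "L2_set (\<lambda>k. c * a k) A = \<bar>c\<bar> * L2_set a A"
  by (simp add: L2_set_def power_mult_distrib sum_distrib_left[symmetric] real_sqrt_mult)

lemma l2_add_scale:
  assumes "l2_seq a" "l2_seq b"
  shows "l2_seq (\<lambda>k. a k + c * b k)" "l2_norm (\<lambda>k. a k + c * b k) \<le> l2_norm a + \<bar>c\<bar> * l2_norm b"
proof -
  have "L2_set (\<lambda>k. a k + c * b k) {..<n} \<le> l2_norm a + \<bar>c\<bar> * l2_norm b" for n
  proof -
    have "L2_set (\<lambda>k. a k + c * b k) {..<n} \<le> L2_set a {..<n} + L2_set (\<lambda>k. c * b k) {..<n}"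
      by (rule L2_set_triangle_ineq)
    also have "\<dots> \<le> l2_norm a + \<bar>c\<bar> * l2_norm b"
      unfolding L2_set_scale by (intro add_mono mult_left_mono L2_set_le_l2_norm assms) auto
    finally show ?thesis .
  qed
  then show "l2_seq (\<lambda>k. a k + c * b k)" "l2_norm (\<lambda>k. a k + c * b k) \<le> l2_norm a + \<bar>c\<bar> * l2_norm b"
    by (rule l2_seqI)+
qed

lemma l2_scale:
  assumes "l2_seq a"
  shows "l2_seq (\<lambda>k. c * a k)" "l2_norm (\<lambda>k. c * a k) = \<bar>c\<bar> * l2_norm a"
  using assms by (simp_all add: l2_norm_def power_mult_distrib suminf_mult real_sqrt_mult summable_mult)

lemma l2_zero: "l2_seq (\<lambda>k. 0)" "l2_norm (\<lambda>k. 0) = 0"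
  by (simp_all add: l2_norm_def)

text \<open>Completeness with a rate: \<open>3 / 2 * (1/3) ^ n\<close> is the sum of all steps from
  \<open>n\<close> on. Coordinates converge, and bounds on finite sections pass to the
  limit.\<close>

lemma l2_limit:
  assumes x: "\<And>n. l2_seq (x n)" and step: "\<And>n. l2_norm (\<lambda>k. x (Suc n) k - x n k) \<le> (1/3) ^ n"
  shows "\<exists>a. l2_seq a \<and> (\<forall>n. l2_seq (\<lambda>k. a k - x n k) \<and> l2_norm (\<lambda>k. a k - x n k) \<le> 3 / 2 * (1/3) ^ n)"
proof -
  have ds: "l2_seq (\<lambda>k. x (Suc n) k - x n k)" for n
    using l2_add_scale(1)[OF x x, of "Suc n" "-1" n] by simp
  have diff: "L2_set (\<lambda>k. x (n + m) k - x n k) {..<K} \<le> 3 / 2 * (1/3) ^ n - 3 / 2 * (1/3) ^ (n + m)" for n m K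
  proof (induction m)
    case (Suc m)
    have "L2_set (\<lambda>k. x (n + Suc m) k - x n k) {..<K} =
        L2_set (\<lambda>k. (x (n + m) k - x n k) + (x (Suc (n + m)) k - x (n + m) k)) {..<K}" by simp
    also have "\<dots> \<le> L2_set (\<lambda>k. x (n + m) k - x n k) {..<K} + L2_set (\<lambda>k. x (Suc (n + m)) k - x (n + m) k) {..<K}"
      by (rule L2_set_triangle_ineq)
    also have "L2_set (\<lambda>k. x (Suc (n + m)) k - x (n + m) k) {..<K} \<le> (1/3) ^ (n + m)"
      using L2_set_le_l2_norm[OF ds, of "n + m" K] step[of "n + m"] by linarith
    finally show ?case using Suc by simp
  qed (simp add: L2_set_def)
  have coord: "\<bar>x (Suc n) k - x n k\<bar> \<le> (1/3) ^ n" for n k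
  proof -
    have "\<bar>x (Suc n) k - x n k\<bar> \<le> L2_set (\<lambda>k. x (Suc n) k - x n k) {..<Suc k}"
      using member_le_L2_set[of "{..<Suc k}" k "\<lambda>k. x (Suc n) k - x n k"]
        member_le_L2_set[of "{..<Suc k}" k "\<lambda>k. - (x (Suc n) k - x n k)"]
      by (simp add: abs_le_iff L2_set_def power2_commute)
    then show ?thesis using L2_set_le_l2_norm[OF ds, of n "Suc k"] step[of n] by linarith
  qed
  have "convergent (\<lambda>n. x n k)" for k
  proof -
    have "summable (\<lambda>n. (1/3::real) ^ n)" by (intro summable_geometric) simp
    then have "summable (\<lambda>n. x (Suc n) k - x n k)"
      by (rule summable_comparison_test') (use coord in simp)
    then have "convergent (\<lambda>n. \<Sum>i<n. x (Suc i) k - x i k)" by (simp add: summable_iff_convergent)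
    then have "convergent (\<lambda>n. x n k - x 0 k)" by (simp only: sum_lessThan_telescope[of "\<lambda>n. x n k"])
    then show ?thesis using convergent_add[OF _ convergent_const[of "x 0 k"]] by fastforce
  qed
  then obtain a where a: "\<And>k. (\<lambda>n. x n k) \<longlonglongrightarrow> a k" unfolding convergent_def by metis
  have bound: "L2_set (\<lambda>k. a k - x n k) {..<K} \<le> 3 / 2 * (1/3) ^ n" for n K
  proof (rule LIMSEQ_le_const2)
    show "(\<lambda>m. L2_set (\<lambda>k. x (n + m) k - x n k) {..<K}) \<longlonglongrightarrow> L2_set (\<lambda>k. a k - x n k) {..<K}"
      unfolding L2_set_def
      by (intro tendsto_intros) (simp add: LIMSEQ_ignore_initial_segment[OF a] add.commute[of n])
    show "\<exists>N. \<forall>m\<ge>N. L2_set (\<lambda>k. x (n + m) k - x n k) {..<K} \<le> 3 / 2 * (1/3) ^ n"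
      using diff[of n _ K] by (intro exI[of _ 0] allI impI order_trans[OF diff]) simp
  qed
  have d: "l2_seq (\<lambda>k. a k - x n k)" "l2_norm (\<lambda>k. a k - x n k) \<le> 3 / 2 * (1/3) ^ n" for n
    by (rule l2_seqI[OF bound])+
  have "l2_seq (\<lambda>k. x 0 k + 1 * (a k - x 0 k))" by (rule l2_add_scale[OF x d(1)])
  then have "l2_seq a" by simp
  then show ?thesis using d by blast
qed

text \<open>
  Sokal's argument: along \<open>\<plusminus>3\<^sup>-\<^sup>n u\<^sub>n\<close>, with \<open>u\<^sub>n\<close> almost norming for \<open>\<phi>\<^sub>n\<close> and the sign chosen by convexity,
  the values of \<open>\<phi>\<^sub>n\<close> cannot be cancelled by the remaining terms.
\<close>

lemma l2_uniform_boundedness: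
  fixes \<Phi> :: "((nat \<Rightarrow> real) \<Rightarrow> real) set"
  assumes lin: "\<And>\<phi> a b c. \<phi> \<in> \<Phi> \<Longrightarrow> l2_seq a \<Longrightarrow> l2_seq b \<Longrightarrow> \<phi> (\<lambda>k. a k + c * b k) = \<phi> a + c * \<phi> b"
    and bnd: "\<And>\<phi>. \<phi> \<in> \<Phi> \<Longrightarrow> \<exists>B. \<forall>a. l2_seq a \<longrightarrow> \<bar>\<phi> a\<bar> \<le> B * l2_norm a"
    and ptw: "\<And>a. l2_seq a \<Longrightarrow> \<exists>M. \<forall>\<phi>\<in>\<Phi>. \<bar>\<phi> a\<bar> \<le> M"
  obtains C where "C > 0" "\<And>\<phi> a. \<phi> \<in> \<Phi> \<Longrightarrow> l2_seq a \<Longrightarrow> \<bar>\<phi> a\<bar> \<le> C * l2_norm a"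
proof (rule ccontr)
  assume contra: "\<not> thesis"
  define ball where "ball = {a. l2_seq a \<and> l2_norm a \<le> 1}"
  define op where "op \<phi> = Sup ((\<lambda>a. \<bar>\<phi> a\<bar>) ` ball)" for \<phi> :: "(nat \<Rightarrow> real) \<Rightarrow> real"
  have zero_ball: "(\<lambda>k. 0) \<in> ball" by (simp add: ball_def l2_zero)
  have hom: "\<phi> (\<lambda>k. c * b k) = c * \<phi> b" if "\<phi> \<in> \<Phi>" "l2_seq b" for \<phi> c b
    using lin[OF that(1) l2_zero(1) that(2), of c] lin[OF that(1) that(2) that(2), of "-1"] by simp
  have bddop: "bdd_above ((\<lambda>a. \<bar>\<phi> a\<bar>) ` ball)" if "\<phi> \<in> \<Phi>" for \<phi>
  proof -
    from bnd[OF that] obtain B where B: "\<And>a. l2_seq a \<Longrightarrow> \<bar>\<phi> a\<bar> \<le> B * l2_norm a" by blast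
    have "\<bar>\<phi> a\<bar> \<le> \<bar>B\<bar>" if "a \<in> ball" for a
    proof -
      have a: "l2_seq a" "l2_norm a \<le> 1" using that by (auto simp: ball_def)
      have "\<bar>\<phi> a\<bar> \<le> \<bar>B\<bar> * l2_norm a"
        using B[OF a(1)] mult_right_mono[OF abs_ge_self[of B] l2_norm_nonneg[OF a(1)]] by linarith
      also have "\<dots> \<le> \<bar>B\<bar> * 1" using a by (intro mult_left_mono) auto
      finally show ?thesis by simp
    qed
    then show ?thesis by (intro bdd_aboveI2) auto
  qed
  have op_bound: "\<bar>\<phi> a\<bar> \<le> op \<phi> * l2_norm a" if "\<phi> \<in> \<Phi>" "l2_seq a" for \<phi> a
  proof (cases "l2_norm a = 0")
    case True
    from bnd[OF that(1)] obtain B where "\<And>a. l2_seq a \<Longrightarrow> \<bar>\<phi> a\<bar> \<le> B * l2_norm a" by blast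
    from this[OF that(2)] show ?thesis using True by simp
  next
    case False
    then have pos: "l2_norm a > 0" using l2_norm_nonneg[OF that(2)] by simp
    have "(\<lambda>k. 1 / l2_norm a * a k) \<in> ball"
      using l2_scale[OF that(2), of "1 / l2_norm a"] pos by (simp add: ball_def)
    then have "\<bar>\<phi> (\<lambda>k. 1 / l2_norm a * a k)\<bar> \<le> op \<phi>"
      unfolding op_def by (intro cSUP_upper bddop that)
    then show ?thesis using pos by (simp only: hom[OF that]) (simp add: abs_mult field_simps)
  qed
  have op_approx: "\<exists>u\<in>ball. 2 / 3 * op \<phi> \<le> \<bar>\<phi> u\<bar>" if "\<phi> \<in> \<Phi>" "op \<phi> > 0" for \<phi>
  proof -
    have "2 / 3 * op \<phi> < op \<phi>" using that by simp
    then have "2 / 3 * op \<phi> < Sup ((\<lambda>a. \<bar>\<phi> a\<bar>) ` ball)" by (simp add: op_def)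
    moreover have "(\<lambda>a. \<bar>\<phi> a\<bar>) ` ball \<noteq> {}" using zero_ball by blast
    ultimately obtain v where "v \<in> (\<lambda>a. \<bar>\<phi> a\<bar>) ` ball" "2 / 3 * op \<phi> < v"
      using less_cSupD by meson
    then show ?thesis by (auto intro: less_imp_le)
  qed
  \<comment> \<open>Any base above 3 would do: the norms must outgrow the shrinking steps
    \<open>(1/3) ^ n\<close>.\<close>
  have "\<exists>\<phi>\<in>\<Phi>. 4 ^ n < op \<phi>" for n :: nat
  proof (rule ccontr)
    assume "\<not> ?thesis"
    then have "op \<phi> \<le> 4 ^ n" if "\<phi> \<in> \<Phi>" for \<phi> using that by (auto simp: not_less)
    then have "\<bar>\<phi> a\<bar> \<le> 4 ^ n * l2_norm a" if "\<phi> \<in> \<Phi>" "l2_seq a" for \<phi> a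
      using op_bound[OF that] mult_right_mono[OF _ l2_norm_nonneg[OF that(2)]] that(1) by (meson order_trans)
    then show False using contra that[of "4 ^ n"] by simp
  qed
  then obtain \<phi> where \<phi>: "\<And>n::nat. \<phi> n \<in> \<Phi>" and big: "\<And>n. 4 ^ n < op (\<phi> n)" by metis
  have oppos: "op (\<phi> n) > 0" for n using big[of n] by (meson less_trans zero_less_numeral zero_less_power)
  obtain u where u: "\<And>n. u n \<in> ball" and un: "\<And>n. 2 / 3 * op (\<phi> n) \<le> \<bar>\<phi> n (u n)\<bar>"
    using op_approx[OF \<phi> oppos] by metis
  have ul2: "l2_seq (u n)" "l2_norm (u n) \<le> 1" for n using u by (auto simp: ball_def)
  define step where "step n y = (if \<bar>\<phi> n (\<lambda>k. y k + (1/3) ^ n * u n k)\<bar> \<ge> (1/3) ^ n * \<bar>\<phi> n (u n)\<bar>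
      then (1/3::real) ^ n else - ((1/3) ^ n))" for n :: nat and y :: "nat \<Rightarrow> real"
  define x where "x = rec_nat (\<lambda>k. 0::real) (\<lambda>n y k. y k + step n y * u n k)"
  have x0: "x 0 = (\<lambda>k. 0)" and xS: "x (Suc n) = (\<lambda>k. x n k + step n (x n) * u n k)" for n
    by (simp_all add: x_def)
  have absstep: "\<bar>step n y\<bar> = (1/3) ^ n" for n y by (simp add: step_def)
  have xl2: "l2_seq (x n)" for n
    by (induction n) (auto simp: x0 xS intro!: l2_add_scale ul2)
  have large: "(1/3) ^ n * \<bar>\<phi> n (u n)\<bar> \<le> \<bar>\<phi> n (x (Suc n))\<bar>" for n
  proof (cases "\<bar>\<phi> n (\<lambda>k. x n k + (1/3) ^ n * u n k)\<bar> \<ge> (1/3) ^ n * \<bar>\<phi> n (u n)\<bar>")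
    case True
    then show ?thesis by (simp add: xS step_def)
  next
    case False
    define q where "q = (1/3) ^ n * \<phi> n (u n)"
    have lin': "\<phi> n (\<lambda>k. x n k + c * u n k) = \<phi> n (x n) + c * \<phi> n (u n)" for c
      by (rule lin[OF \<phi> xl2 ul2(1)])
    have q: "\<bar>q\<bar> = (1/3) ^ n * \<bar>\<phi> n (u n)\<bar>" by (simp add: q_def abs_mult)
    have "\<bar>\<phi> n (x n) + q\<bar> < \<bar>q\<bar>"
      using False unfolding lin' q by (simp add: q_def)
    then have "\<bar>q\<bar> \<le> \<bar>\<phi> n (x n) - q\<bar>" by linarith
    also have "\<phi> n (x n) - q = \<phi> n (x (Suc n))"
      using False lin'[of "- ((1/3) ^ n)"] by (simp add: xS step_def q_def)
    finally show ?thesis by (simp only: q)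
  qed
  have stepb: "l2_norm (\<lambda>k. x (Suc n) k - x n k) \<le> (1/3) ^ n" for n
  proof -
    have "l2_norm (\<lambda>k. x (Suc n) k - x n k) = (1/3) ^ n * l2_norm (u n)"
      using l2_scale(2)[OF ul2(1), of "step n (x n)" n] by (simp add: xS absstep)
    also have "\<dots> \<le> (1/3) ^ n * 1" using ul2 by (intro mult_left_mono) auto
    finally show ?thesis by simp
  qed
  obtain a where a: "l2_seq a" and ad: "\<And>n. l2_seq (\<lambda>k. a k - x n k)"
      and an: "\<And>n. l2_norm (\<lambda>k. a k - x n k) \<le> 3 / 2 * (1/3) ^ n"
    using l2_limit[OF xl2 stepb] by blast
  obtain M where M: "\<And>\<psi>. \<psi> \<in> \<Phi> \<Longrightarrow> \<bar>\<psi> a\<bar> \<le> M" using ptw[OF a] by blast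
  \<comment> \<open>Of \<open>(1/3) ^ n * op (\<phi> n)\<close>, step \<open>n\<close> secures 2/3
    and the later steps take back at most \<open>3/2 * 1/3 = 1/2\<close>, which leaves 1/6.\<close>
  have lower: "1 / 6 * (4 / 3) ^ n \<le> M" for n :: nat
  proof -
    have "\<phi> n (\<lambda>k. x (Suc n) k + 1 * (a k - x (Suc n) k)) = \<phi> n (x (Suc n)) + 1 * \<phi> n (\<lambda>k. a k - x (Suc n) k)"
      by (rule lin[OF \<phi> xl2 ad])
    then have eq: "\<phi> n a = \<phi> n (x (Suc n)) + \<phi> n (\<lambda>k. a k - x (Suc n) k)" by simp
    have "\<bar>\<phi> n (\<lambda>k. a k - x (Suc n) k)\<bar> \<le> op (\<phi> n) * l2_norm (\<lambda>k. a k - x (Suc n) k)"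
      by (rule op_bound[OF \<phi> ad])
    also have "\<dots> \<le> op (\<phi> n) * (3 / 2 * (1/3) ^ Suc n)"
      using oppos[of n] by (intro mult_left_mono an) auto
    finally have r: "\<bar>\<phi> n (\<lambda>k. a k - x (Suc n) k)\<bar> \<le> (1/3) ^ n * (1 / 2 * op (\<phi> n))"
      by (simp add: mult.commute)
    have "(1/3) ^ n * (2 / 3 * op (\<phi> n)) \<le> (1/3) ^ n * \<bar>\<phi> n (u n)\<bar>" by (intro mult_left_mono un) auto
    also have "\<dots> \<le> \<bar>\<phi> n (x (Suc n))\<bar>" by (rule large)
    also have "\<dots> \<le> \<bar>\<phi> n a\<bar> + \<bar>\<phi> n (\<lambda>k. a k - x (Suc n) k)\<bar>" using eq by linarith
    also have "\<dots> \<le> M + (1/3) ^ n * (1 / 2 * op (\<phi> n))" by (intro add_mono M \<phi> r)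
    finally have "(1/3) ^ n * (1 / 6 * op (\<phi> n)) \<le> M" by (simp add: algebra_simps)
    moreover have "(1/3) ^ n * (1 / 6 * 4 ^ n) \<le> (1/3) ^ n * (1 / 6 * op (\<phi> n))"
      using big[of n] by (intro mult_left_mono) auto
    moreover have "(1/3) ^ n * (1 / 6 * 4 ^ n) = 1 / 6 * (4 / 3 :: real) ^ n"
      by (simp add: power_divide)
    ultimately show ?thesis by linarith
  qed
  obtain n :: nat where "6 * M < (4 / 3) ^ n" using real_arch_pow[of "4/3" "6 * M"] by auto
  then show False using lower[of n] by linarith
qed

subsection \<open>Domination by Rademacher sums\<close>

lemma upper_tail_lower_bound: "l2_seq a \<Longrightarrow> x \<le> l2_norm a / 2 \<Longrightarrow> 1 / 12 \<le> upper_tail a x"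
  using upper_tail_rad_sum[of a] upper_tail_antimono[of x "l2_norm a / 2" a] by (simp add: upper_tail_def)

lemma l2_norm_trunc_const:
  assumes "\<And>k. k < L \<Longrightarrow> b k = c" "c \<ge> 0"
  shows "l2_norm (trunc_seq L b) = c * sqrt (real L)"
proof -
  have "(\<Sum>k. (trunc_seq L b k)\<^sup>2) = (\<Sum>k<L. (trunc_seq L b k)\<^sup>2)"
    by (rule suminf_finite) (auto simp: trunc_seq_def)
  also have "\<dots> = c\<^sup>2 * real L" using assms by (simp add: trunc_seq_def)
  finally show ?thesis using assms by (simp add: l2_norm_def real_sqrt_mult)
qed

text \<open>A group of \<open>L\<close> coefficients \<open>c\<close> has norm
  \<open>c * sqrt L\<close> and reaches half of it with measure at least 1/12. The \<open>m\<close>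
  groups multiply; the extra factor makes the rest of the series nonnegative.\<close>

lemma upper_tail_groups:
  assumes "l2_seq b" "\<And>k. k < m * L \<Longrightarrow> b k = c" "c \<ge> 0"
  shows "(1 / 12) ^ Suc m \<le> upper_tail b (real m * (c * sqrt (real L) / 2))"
  using assms
proof (induction m arbitrary: b)
  case 0
  then show ?case using upper_tail_lower_bound[of b 0] l2_norm_nonneg[of b] by simp
next
  case (Suc m)
  let ?b = "\<lambda>k. b (L + k)" and ?x = "c * sqrt (real L) / 2"
  have b': "l2_seq ?b" using Suc.prems(1) summable_iff_shift[of "\<lambda>k. (b k)\<^sup>2" L] by (simp add: add.commute)
  have "1 / 12 \<le> upper_tail (trunc_seq L b) ?x"
  proof (rule upper_tail_lower_bound[OF l2_trunc_seq])
    have "l2_norm (trunc_seq L b) = c * sqrt (real L)"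
      using Suc.prems by (intro l2_norm_trunc_const) auto
    then show "?x \<le> l2_norm (trunc_seq L b) / 2" by simp
  qed
  moreover have "(1 / 12) ^ Suc m \<le> upper_tail ?b (real m * ?x)"
    using Suc.prems by (intro Suc.IH b') auto
  ultimately have "1 / 12 * (1 / 12) ^ Suc m \<le> upper_tail (trunc_seq L b) ?x * upper_tail ?b (real m * ?x)"
    by (intro mult_mono) (auto simp: upper_tail_nonneg)
  also have "\<dots> \<le> upper_tail b (?x + real m * ?x)" by (rule upper_tail_product[OF Suc.prems(1)])
  also have "?x + real m * ?x = real (Suc m) * ?x" by (simp add: algebra_simps)
  finally show ?case by simp
qed

text \<open>One more factor 1/12 makes the sum of the first \<open>n\<close> terms
  nonnegative.\<close>

lemma upper_tail_offset_groups:
  assumes a: "l2_seq a" and "\<And>k. k < m * L \<Longrightarrow> a (n + k) = c" "c \<ge> 0"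
  shows "(1 / 12) ^ (m + 2) \<le> upper_tail a (real m * (c * sqrt (real L) / 2))"
proof -
  let ?b = "\<lambda>k. a (n + k)" and ?y = "real m * (c * sqrt (real L) / 2)"
  have b: "l2_seq ?b" using a summable_iff_shift[of "\<lambda>k. (a k)\<^sup>2" n] by (simp add: add.commute)
  have "1 / 12 \<le> upper_tail (trunc_seq n a) 0"
    using l2_norm_nonneg[OF l2_trunc_seq] by (intro upper_tail_lower_bound l2_trunc_seq) simp
  moreover have "(1 / 12) ^ Suc m \<le> upper_tail ?b ?y" by (rule upper_tail_groups[OF b assms(2,3)])
  ultimately have "1 / 12 * (1 / 12) ^ Suc m \<le> upper_tail (trunc_seq n a) 0 * upper_tail ?b ?y"
    by (intro mult_mono) (auto simp: upper_tail_nonneg)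
  also have "\<dots> \<le> upper_tail a (0 + ?y)" by (rule upper_tail_product[OF a])
  finally show ?thesis by simp
qed

text \<open>
  Block \<open>j\<close> consists of \<open>4 ^ q j\<close> equal coefficients and has \<open>\<ell>\<^sub>2\<close>-norm \<open>2\<^sup>-\<^sup>j\<close>. Splitting it into \<open>4 ^ i\<close>
  groups of equal size and asking all of them to be large simultaneously produces the Gaussian lower
  tail at height \<open>2 ^ i / 2 ^ j\<close>, for every \<open>i \<le> q j\<close>.
\<close>

lemma block_sequence:
  fixes q :: "nat \<Rightarrow> nat"
  obtains a where "l2_seq a" "0 < l2_norm a"
    "\<And>i j. i \<le> q j \<Longrightarrow> (1 / 12) ^ (4 ^ i + 2) \<le> upper_tail a (2 ^ i / 2 ^ j / 2)"
proof -
  define s :: "nat \<Rightarrow> nat" where "s j = (\<Sum>i<j. 4 ^ q i)" for j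
  have sS: "s (Suc j) = s j + 4 ^ q j" for j by (simp add: s_def)
  have mono: "s i \<le> s j" if "i \<le> j" for i j using that unfolding s_def by (intro sum_mono2) auto
  define blk where "blk k = (LEAST j. k < s (Suc j))" for k
  define a where "a k = (1 / 2 :: real) ^ (blk k + q (blk k))" for k
  have blk: "blk k = j" if "s j \<le> k" "k < s (Suc j)" for j k
    unfolding blk_def
  proof (rule Least_equality)
    fix y assume "k < s (Suc y)"
    show "j \<le> y"
    proof (rule ccontr)
      assume "\<not> j \<le> y"
      then have "s (Suc y) \<le> s j" by (intro mono) auto
      then show False using that \<open>k < s (Suc y)\<close> by simp
    qed
  qed fact
  have ablk: "a (s j + k) = (1 / 2) ^ (j + q j)" if "k < 4 ^ q j" for j k
    using blk[of j "s j + k"] that by (simp add: a_def sS)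
  have sumJ: "(\<Sum>k<s J. (a k)\<^sup>2) = 4 / 3 - 4 / 3 * (1 / 4) ^ J" for J
  proof (induction J)
    case (Suc J)
    have "{..<s (Suc J)} = {..<s J} \<union> {s J..<s J + 4 ^ q J}" by (auto simp: sS)
    then have "(\<Sum>k<s (Suc J). (a k)\<^sup>2) = (\<Sum>k<s J. (a k)\<^sup>2) + (\<Sum>k=s J..<s J + 4 ^ q J. (a k)\<^sup>2)"
      by (simp add: sum.union_disjoint ivl_disj_int)
    also have "(\<Sum>k=s J..<s J + 4 ^ q J. (a k)\<^sup>2) = (\<Sum>k<4 ^ q J. (a (s J + k))\<^sup>2)"
      using sum.shift_bounds_nat_ivl[of "\<lambda>k. (a k)\<^sup>2" 0 "s J" "4 ^ q J"]
      by (simp add: lessThan_atLeast0 add.commute)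
    also have "\<dots> = (\<Sum>k<(4::nat) ^ q J. ((1 / 2) ^ (J + q J))\<^sup>2)" by (intro sum.cong) (auto simp: ablk)
    also have "\<dots> = 4 ^ q J * ((1 / 2) ^ (J + q J))\<^sup>2" by simp
    also have "\<dots> = (1 / 4) ^ J"
    proof -
      have "((1 / 2 :: real) ^ (J + q J))\<^sup>2 = (1 / 4) ^ J * (1 / 4) ^ q J"
      proof -
        have quarter: "(1 / 4 :: real) ^ n = (1 / 2) ^ n * (1 / 2) ^ n" for n
          by (simp flip: power_mult_distrib)
        show ?thesis unfolding quarter power2_eq_square power_add by (simp only: mult_ac)
      qed
      then show ?thesis by (simp add: power_one_over)
    qed
    finally show ?case using Suc by simp
  qed (simp add: s_def)
  have sn: "n \<le> s n" for n
  proof (induction n)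
    case (Suc n)
    have "(1::nat) \<le> 4 ^ q n" by simp
    then show ?case using Suc unfolding sS by linarith
  qed simp
  have a: "l2_seq a"
  proof (rule summableI_nonneg_bounded)
    fix n
    have "sq_sum n a \<le> (\<Sum>k<s n. (a k)\<^sup>2)" using sn by (intro sum_mono2) auto
    also have "\<dots> \<le> 4 / 3" unfolding sumJ by simp
    finally show "sq_sum n a \<le> 4 / 3" .
  qed simp
  have "0 < (sq_sum 1 a)" by (simp add: a_def)
  also have "\<dots> \<le> (l2_norm a)\<^sup>2" by (rule sum_square_le[OF a])
  finally have pos: "0 < l2_norm a" using l2_norm_nonneg[OF a] by (cases "l2_norm a = 0") auto
  have "(1 / 12) ^ (4 ^ i + 2) \<le> upper_tail a (2 ^ i / 2 ^ j / 2)" if "i \<le> q j" for i j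
  proof -
    \<comment> \<open>The groups have size \<open>4 ^ d\<close>, hence norm
      \<open>2^-(j + i)\<close>; half of it, times \<open>4 ^ i\<close> groups, is the asserted
      height.\<close>
    define d where "d = q j - i"
    have q: "q j = i + d" using that by (simp add: d_def)
    have "(1 / 12) ^ (4 ^ i + 2) \<le> upper_tail a (real (4 ^ i) * ((1 / 2) ^ (j + q j) * sqrt (real (4 ^ d)) / 2))"
    proof (rule upper_tail_offset_groups[OF a])
      show "a (s j + k) = (1 / 2) ^ (j + q j)" if "k < 4 ^ i * 4 ^ d" for k
        using that by (intro ablk) (simp add: q power_add)
    qed simp
    also have "real (4 ^ i) * ((1 / 2) ^ (j + q j) * sqrt (real (4 ^ d)) / 2) = 2 ^ i / 2 ^ j / 2"
    proof -
      have "sqrt (real (4 ^ d)) = 2 ^ d" by (simp add: real_sqrt_power)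
      moreover have "real (4 ^ i) = 2 ^ i * 2 ^ i" by (simp flip: power_mult_distrib)
      ultimately show ?thesis by (simp add: q power_add power_one_over)
    qed
    finally show ?thesis .
  qed
  then show thesis using that a pos by blast
qed

text \<open>The order \<open>2 * 4 ^ j * ln 12\<close> yields the square of the right side at this
  height; one of the two factors absorbs \<open>K\<close> once \<open>i\<close> is large.\<close>

lemma gauss_tail_dyadic:
  assumes "gauss_tail f"
  shows "\<exists>I. \<forall>i\<ge>I. distr_fun f (2 ^ i / 2 ^ j) \<le> (1 / 12) ^ (4 ^ i)"
proof -
  define \<beta> where "\<beta> = 2 * 4 ^ j * ln (12::real)"
  obtain K where K: "\<And>\<tau>. \<tau> \<ge> 0 \<Longrightarrow> distr_fun f \<tau> \<le> K * exp (- (\<beta> * \<tau>\<^sup>2))"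
    using assms unfolding gauss_tail_def by blast
  obtain I where I: "K < 12 ^ I" using real_arch_pow[of 12 K] by auto
  have "distr_fun f (2 ^ i / 2 ^ j) \<le> (1 / 12) ^ (4 ^ i)" if "i \<ge> I" for i
  proof -
    let ?p = "(1 / 12 :: real) ^ (4 ^ i)"
    have "exp (- (\<beta> * (2 ^ i / 2 ^ j)\<^sup>2)) = ?p * ?p"
    proof -
      have "(2 ^ i / 2 ^ j :: real)\<^sup>2 = 4 ^ i / 4 ^ j"
        by (simp add: power_divide power2_eq_square flip: power_mult_distrib)
      then have "\<beta> * (2 ^ i / 2 ^ j)\<^sup>2 = real (4 ^ i) * ln 12 + real (4 ^ i) * ln 12"
        by (simp add: \<beta>_def)
      moreover have "exp (- (real (4 ^ i) * ln 12)) = ?p"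
      proof -
        have "exp (real (4 ^ i) * ln 12) = (12::real) ^ (4 ^ i)" by (subst exp_of_nat_mult) simp
        then show ?thesis by (simp only: exp_minus power_one_over inverse_eq_divide)
      qed
      ultimately show ?thesis by (simp only: minus_add_distrib exp_add)
    qed
    then have "distr_fun f (2 ^ i / 2 ^ j) \<le> K * ?p * ?p" using K[of "2 ^ i / 2 ^ j"] by simp
    also have "\<dots> \<le> 1 * ?p"
    proof (rule mult_right_mono)
      have "I \<le> 4 ^ i" using that less_exp[of i] power_mono[of "2::nat" 4 i] by linarith
      then have "K \<le> 12 ^ (4 ^ i)" using I power_increasing[of I "4 ^ i" "12::real"] by linarith
      then show "K * ?p \<le> 1" by (simp add: power_one_over field_simps)
    qed simp
    finally show ?thesis by simp
  qed
  then show ?thesis by blast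
qed

text \<open>Block \<open>j\<close> is responsible for the heights \<open>2 ^ i / 2 ^ j\<close> with
  \<open>I j \<le> i \<le> I (Suc j)\<close>: from \<open>I j\<close> on the tail of
  \<open>f\<close> is below \<open>(1 / 12) ^ (4 ^ i)\<close>, and up to \<open>I (Suc j)\<close>
  the block is long enough for the matching lower bound, short of \<open>12^2 = 144\<close>.\<close>

lemma gauss_tail_dominated_by_rad_sum:
  assumes f: "gauss_tail f"
  obtains a K where "l2_seq a" "K > 0"
    "\<And>\<tau>. \<tau> > 0 \<Longrightarrow> distr_fun f \<tau> \<le> 144 * distr_fun (\<lambda>t. K * rad_sum a t) \<tau>"
proof -
  have fm: "f \<in> meas01" using f by (simp add: gauss_tail_def)
  obtain I0 where I0: "\<And>i j. i \<ge> I0 j \<Longrightarrow> distr_fun f (2 ^ i / 2 ^ j) \<le> (1 / 12) ^ (4 ^ i)"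
    using gauss_tail_dyadic[OF f] by metis
  \<comment> \<open>Increasing and at least \<open>I0\<close>; the added 2 gives
    \<open>I j \<ge> 2 * j\<close>, so the heights \<open>2 ^ I j / 2 ^ j\<close> are
    unbounded.\<close>
  define I where "I j = (\<Sum>l\<le>j. I0 l + 2)" for j
  have I: "I j \<ge> I0 j" "I j \<ge> 2 * j" "I j \<le> I (Suc j)" for j
  proof -
    show "I0 j \<le> I j" unfolding I_def using member_le_sum[of j "{..j}" "\<lambda>l. I0 l + 2"] by simp
    show "2 * j \<le> I j" unfolding I_def by (induction j) auto
    show "I j \<le> I (Suc j)" by (simp add: I_def)
  qed
  obtain a where a: "l2_seq a" "0 < l2_norm a"
    and lower: "\<And>i j. i \<le> I (Suc j) \<Longrightarrow> (1 / 12) ^ (4 ^ i + 2) \<le> upper_tail a (2 ^ i / 2 ^ j / 2)"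
    using block_sequence[of "\<lambda>j. I (Suc j)"] by blast
  \<comment> \<open>The 4 covers the factor 2 between successive heights and the 1/2 in
    \<open>lower\<close>; the second term settles all \<open>\<tau> < 2 ^ I 0\<close> by the tail
    1/12 at \<open>l2_norm a / 2\<close>.\<close>
  define K where "K = max 4 (2 * 2 ^ I 0 / l2_norm a)"
  have K: "K \<ge> 4" "2 * 2 ^ I 0 / l2_norm a \<le> K" by (auto simp: K_def)
  have ut: "upper_tail a x \<le> distr_fun (\<lambda>t. K * rad_sum a t) \<tau>" if "\<tau> / K < x" for x \<tau>
  proof -
    have "upper_tail a x \<le> distr_fun (rad_sum a) (\<tau> / K)"
      unfolding upper_tail_def distr_fun_def using that
      by (intro prob_mono sets_superlevel) auto
    then show ?thesis using K by (simp add: distr_fun_scale)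
  qed
  have "distr_fun f \<tau> \<le> 144 * distr_fun (\<lambda>t. K * rad_sum a t) \<tau>" if "\<tau> > 0" for \<tau>
  proof (cases "\<tau> < 2 ^ I 0")
    case True
    have "\<tau> / K < l2_norm a / 2"
    proof -
      have "\<tau> * 2 < 2 * 2 ^ I 0" using True by simp
      also have "\<dots> \<le> K * l2_norm a" using K(2) a(2) by (simp add: field_simps)
      finally show ?thesis using K(1) by (simp add: field_simps)
    qed
    then have "1 / 12 \<le> distr_fun (\<lambda>t. K * rad_sum a t) \<tau>"
      using ut upper_tail_lower_bound[OF a(1) order_refl] by (meson order_trans)
    then show ?thesis using distr_fun_bounds(2)[of f \<tau>] by linarith
  next
    case False
    define P where "P j \<longleftrightarrow> \<tau> < 2 ^ I j / 2 ^ j" for j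
    have "\<exists>j. P j"
    proof -
      obtain n :: nat where n: "\<tau> < 2 ^ n" using real_arch_pow[of 2 \<tau>] by auto
      have "(2::real) ^ n * 2 ^ n = 2 ^ (2 * n)" by (simp add: mult_2 power_add)
      also have "\<dots> \<le> 2 ^ I n" using I(2) by (intro power_increasing) auto
      finally have "(2::real) ^ n \<le> 2 ^ I n / 2 ^ n" by (simp add: field_simps)
      then have "P n" using n unfolding P_def by linarith
      then show ?thesis by blast
    qed
    then have "P (LEAST j. P j)" by (rule LeastI_ex)
    moreover have "\<not> P 0" using False by (simp add: P_def)
    ultimately obtain j where j: "(LEAST j. P j) = Suc j" by (metis not0_implies_Suc)
    have Pj: "P (Suc j)" "\<not> P j"
      using \<open>P (LEAST j. P j)\<close> not_less_Least[of j P] j by auto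
    \<comment> \<open>Inside block \<open>j\<close> this selects \<open>i\<close> with
      \<open>2 ^ i / 2 ^ j \<le> \<tau> < 2 * (2 ^ i / 2 ^ j)\<close>.\<close>
    define R where "R i \<longleftrightarrow> \<tau> < 2 ^ i / 2 ^ j" for i :: nat
    have RI: "R (I (Suc j))"
    proof -
      have "(2::real) ^ I (Suc j) / 2 ^ Suc j \<le> 2 ^ I (Suc j) / 2 ^ j" by (intro divide_left_mono) auto
      then show ?thesis using Pj(1) by (simp add: R_def P_def)
    qed
    have nR: "\<not> R i" if "i \<le> I j" for i
    proof -
      have "(2::real) ^ i / 2 ^ j \<le> 2 ^ I j / 2 ^ j"
        using that by (intro divide_right_mono power_increasing) auto
      then show ?thesis using Pj(2) by (simp add: R_def P_def)
    qed
    have LR: "R (LEAST i. R i)" using RI by (rule LeastI)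
    then have "\<not> (LEAST i. R i) \<le> I j" using nR by blast
    then obtain i where i: "(LEAST i. R i) = Suc i" "I j \<le> i" by (cases "LEAST i. R i") auto
    have "\<not> R i" using not_less_Least[of i R] i by simp
    have iI: "i \<le> I (Suc j)" using Least_le[of R, OF RI] i by simp
    have "distr_fun f \<tau> \<le> distr_fun f (2 ^ i / 2 ^ j)"
      using \<open>\<not> R i\<close> by (intro distr_fun_antimono[OF fm]) (simp add: R_def)
    also have "\<dots> \<le> (1 / 12) ^ (4 ^ i)" using I(1)[of j] i by (intro I0) simp
    also have "\<dots> = 144 * (1 / 12) ^ (4 ^ i + 2)" by (simp add: power_add power2_eq_square)
    also have "\<dots> \<le> 144 * upper_tail a (2 ^ i / 2 ^ j / 2)" using lower[OF iI] by simp
    also have "\<dots> \<le> 144 * distr_fun (\<lambda>t. K * rad_sum a t) \<tau>"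
    proof -
      have "\<tau> < 2 * (2 ^ i / 2 ^ j)" using LR i by (simp add: R_def)
      then have "\<tau> / K < 2 * (2 ^ i / 2 ^ j) / K" using K by (intro divide_strict_right_mono) auto
      also have "\<dots> \<le> 2 * (2 ^ i / 2 ^ j) / 4" using K by (intro divide_left_mono) auto
      also have "\<dots> = 2 ^ i / 2 ^ j / 2" by simp
      finally have "\<tau> / K < 2 ^ i / 2 ^ j / 2" .
      then show ?thesis by (intro mult_left_mono ut) simp_all
    qed
    finally show ?thesis .
  qed
  then show thesis using that[of a K] a(1) K(1) by simp
qed

subsection \<open>Weighted spaces and multiplicators\<close>

text \<open>Large values become 0 and are not clipped: multiplying \<open>S\<close> by
  \<open>trunc_at n (w t * y t)\<close> restricts \<open>w S y\<close> to a set, so it remains a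
  pairing of \<open>y\<close> with an element of \<open>X\<close> dominated by
  \<open>w S\<close>.\<close>

definition trunc_at :: "nat \<Rightarrow> real \<Rightarrow> real" where
  "trunc_at n x = (if \<bar>x\<bar> \<le> real n then x else 0)"

lemma trunc_at_measurable [measurable]: "trunc_at n \<in> borel_measurable borel"
  unfolding trunc_at_def[abs_def] by measurable

lemma abs_trunc_at_le: "\<bar>trunc_at n x\<bar> \<le> real n" "\<bar>trunc_at n x\<bar> \<le> \<bar>x\<bar>"
  by (auto simp: trunc_at_def)

lemma trunc_at_LIMSEQ: "(\<lambda>n. trunc_at n x) \<longlonglongrightarrow> x"
proof (rule tendsto_eventually)
  obtain N :: nat where "\<bar>x\<bar> \<le> real N" using real_arch_simple by blast
  then show "eventually (\<lambda>n. trunc_at n x = x) sequentially"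
    by (auto simp: eventually_sequentially trunc_at_def intro!: exI[of _ N])
qed

section \<open>The upper estimate in the weighted space\<close>

context
  fixes X :: fspace and w :: "real \<Rightarrow> real"
  assumes X: "symmetric_space X" and w: "w \<in> meas01"
begin

lemma integrable_rad_trunc:
  assumes a: "l2_seq a" and y: "y \<in> meas01"
  shows "integrable leb01 (\<lambda>t. rad_sum a t * trunc_at n (w t * y t))"
proof (rule Bochner_Integration.integrable_bound)
  show "integrable leb01 (\<lambda>t. real n * \<bar>rad_sum a t\<bar>)" using rad_sum_moment(1)[OF a] by simp
  show "(\<lambda>t. rad_sum a t * trunc_at n (w t * y t)) \<in> meas01"
    using w y by measurable
  show "AE t in leb01. norm (rad_sum a t * trunc_at n (w t * y t)) \<le> norm (real n * \<bar>rad_sum a t\<bar>)"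
    using abs_trunc_at_le(1)
    by (intro AE_I2) (simp add: abs_mult mult.commute[of "real n"] mult_left_mono)
qed

lemma weighted_rad_sum_upper_bound:
  assumes bidual: "\<forall>x\<in>carr X. nrm X x = nrm (koethe_dual (koethe_dual X)) x"
    and carr: "\<And>a. l2_seq a \<Longrightarrow> (\<lambda>t. rad_sum a t * w t) \<in> carr X"
  obtains C where "C > 0" "\<And>a. l2_seq a \<Longrightarrow> nrm X (\<lambda>t. rad_sum a t * w t) \<le> C * l2_norm a"
proof -
  define F where "F y n a = (LINT t|leb01. rad_sum a t * trunc_at n (w t * y t))" for y n a
  define Y where "Y = {y \<in> carr (koethe_dual X). nrm (koethe_dual X) y \<le> 1}"
  have ym: "y \<in> meas01" if "y \<in> Y" for y
    using that koethe_dual_carr[OF X] by (simp add: Y_def)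
  have lin: "F y n (\<lambda>k. a k + c * b k) = F y n a + c * F y n b" if "y \<in> Y" "l2_seq a" "l2_seq b" for y n a b c
  proof -
    note [measurable] = w ym[OF that(1)]
    have "F y n (\<lambda>k. a k + c * b k) =
        (LINT t|leb01. rad_sum a t * trunc_at n (w t * y t) + c * (rad_sum b t * trunc_at n (w t * y t)))"
      unfolding F_def
    proof (rule integral_cong_AE)
      show "AE t in leb01. rad_sum (\<lambda>k. a k + c * b k) t * trunc_at n (w t * y t) =
          rad_sum a t * trunc_at n (w t * y t) + c * (rad_sum b t * trunc_at n (w t * y t))"
        using AE_rad_sum_linear[OF that(2,3), of c] by eventually_elim (simp add: algebra_simps)
    qed measurable
    also have "\<dots> = F y n a + c * F y n b"
      unfolding F_def using integrable_rad_trunc that ym by simp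
    finally show ?thesis .
  qed
  have bnd: "\<bar>F y n a\<bar> \<le> real n * l2_norm a" if "y \<in> Y" "l2_seq a" for y n a
  proof -
    have "\<bar>F y n a\<bar> \<le> (LINT t|leb01. \<bar>rad_sum a t * trunc_at n (w t * y t)\<bar>)"
      unfolding F_def by (rule integral_abs_bound)
    also have "\<dots> \<le> (LINT t|leb01. real n * \<bar>rad_sum a t\<bar>)"
    proof (rule integral_mono)
      show "integrable leb01 (\<lambda>t. \<bar>rad_sum a t * trunc_at n (w t * y t)\<bar>)"
        using integrable_rad_trunc that ym by simp
      show "integrable leb01 (\<lambda>t. real n * \<bar>rad_sum a t\<bar>)" using rad_sum_moment(1) that by simp
      show "\<bar>rad_sum a t * trunc_at n (w t * y t)\<bar> \<le> real n * \<bar>rad_sum a t\<bar>" for t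
        using abs_trunc_at_le(1) by (simp add: abs_mult mult.commute[of "real n"] mult_left_mono)
    qed
    also have "\<dots> \<le> real n * l2_norm a" using rad_sum_moment(2)[OF that(2)] by (simp add: mult_left_mono)
    finally show ?thesis .
  qed
  \<comment> \<open>Unlike the previous bound, this one is uniform in \<open>y\<close> and
    \<open>n\<close>, but not yet controlled by the norm of \<open>a\<close>.\<close>
  have ptw: "\<bar>F y n a\<bar> \<le> nrm X (\<lambda>t. rad_sum a t * w t)" if "y \<in> Y" "l2_seq a" for y n a
  proof -
    note [measurable] = ym[OF that(1)] w
    define z where "z t = (if \<bar>w t * y t\<bar> \<le> real n then rad_sum a t * w t else 0)" for t
    have zm: "z \<in> meas01" unfolding z_def by measurable
    have z: "z \<in> carr X" "nrm X z \<le> nrm X (\<lambda>t. rad_sum a t * w t)"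
      by (rule carr_AE_mono[OF X carr[OF that(2)] zm]; simp add: z_def)+
    have "F y n a = (LINT t|leb01. z t * y t)"
      unfolding F_def by (rule Bochner_Integration.integral_cong) (auto simp: z_def trunc_at_def)
    then show ?thesis
      using koethe_dual_holder[OF X _ _ z(1), of y] z(2) that by (simp add: Y_def)
  qed
  obtain C where C: "C > 0" "\<And>\<phi> a. \<phi> \<in> {F y n | y n. y \<in> Y} \<Longrightarrow> l2_seq a \<Longrightarrow> \<bar>\<phi> a\<bar> \<le> C * l2_norm a"
  proof (rule l2_uniform_boundedness[of "{F y n | y n. y \<in> Y}"])
    show "\<phi> (\<lambda>k. a k + c * b k) = \<phi> a + c * \<phi> b" if "\<phi> \<in> {F y n | y n. y \<in> Y}" "l2_seq a" "l2_seq b" for \<phi> a b c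
      using that lin by auto
    show "\<exists>B. \<forall>a. l2_seq a \<longrightarrow> \<bar>\<phi> a\<bar> \<le> B * l2_norm a" if "\<phi> \<in> {F y n | y n. y \<in> Y}" for \<phi>
      using that bnd by blast
    show "\<exists>M. \<forall>\<phi>\<in>{F y n | y n. y \<in> Y}. \<bar>\<phi> a\<bar> \<le> M" if "l2_seq a" for a
      using that ptw by blast
  qed blast
  have "nrm X (\<lambda>t. rad_sum a t * w t) \<le> C * l2_norm a" if a: "l2_seq a" for a
  proof (rule nrm_le_via_bidual[OF X _ carr[OF a]])
    show "nrm X (\<lambda>t. rad_sum a t * w t) = nrm (koethe_dual (koethe_dual X)) (\<lambda>t. rad_sum a t * w t)"
      using bidual carr[OF a] by blast
    fix y assume "y \<in> carr (koethe_dual X)" "nrm (koethe_dual X) y \<le> 1"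
    then have y: "y \<in> Y" by (simp add: Y_def)
    note [measurable] = ym[OF y] w
    have "(\<lambda>n. F y n a) \<longlonglongrightarrow> (LINT t|leb01. rad_sum a t * w t * y t)"
      unfolding F_def
    proof (rule integral_dominated_convergence)
      have "integrable leb01 (\<lambda>t. rad_sum a t * w t * y t)"
        using y carr[OF a] koethe_dual_carr[OF X, of y] by (simp add: Y_def)
      then show "integrable leb01 (\<lambda>t. \<bar>rad_sum a t * w t * y t\<bar>)" by (rule integrable_abs)
      show "AE t in leb01. (\<lambda>n. rad_sum a t * trunc_at n (w t * y t)) \<longlonglongrightarrow> rad_sum a t * w t * y t"
        unfolding mult.assoc by (intro AE_I2 tendsto_mult tendsto_const trunc_at_LIMSEQ)
      show "AE t in leb01. norm (rad_sum a t * trunc_at n (w t * y t)) \<le> \<bar>rad_sum a t * w t * y t\<bar>" for n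
      proof (rule AE_I2)
        fix t
        have "\<bar>rad_sum a t\<bar> * \<bar>trunc_at n (w t * y t)\<bar> \<le> \<bar>rad_sum a t\<bar> * \<bar>w t * y t\<bar>"
          by (intro mult_left_mono abs_trunc_at_le) simp
        then show "norm (rad_sum a t * trunc_at n (w t * y t)) \<le> \<bar>rad_sum a t * w t * y t\<bar>"
          by (simp add: abs_mult mult.assoc)
      qed
    qed measurable
    moreover have "F y n a \<le> C * l2_norm a" for n
      using C(2)[of "F y n" a] y a by (auto simp: abs_le_iff)
    ultimately show "(LINT t|leb01. rad_sum a t * w t * y t) \<le> C * l2_norm a"
      by (intro LIMSEQ_le_const2) auto
  qed
  then show thesis using that C(1) by blast
qed

end

text \<open>Under the hypothesis the test series of \<open>multiplicator_space\<close> are exactly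
  those with square-summable coefficients, because almost everywhere convergence forces square
  summability.\<close>

lemma multiplicator_carr_iff:
  assumes "\<And>a. l2_seq a \<Longrightarrow> rad_sum a \<in> carr X"
  shows "f \<in> carr (multiplicator_space X) \<longleftrightarrow>
    f \<in> meas01 \<and> (\<forall>a. l2_seq a \<longrightarrow> (\<lambda>t. f t * rad_sum a t) \<in> carr X)"
  using assms rad_convergent_l2 l2_of_rad_convergent by (auto simp: multiplicator_space_def)

theorem theorem3p1:
  fixes X :: fspace and w N2 :: "real \<Rightarrow> real" and G :: "(real \<Rightarrow> real) set"
  assumes "symmetric_space X"
    and "\<forall>x\<in>carr X. nrm X x = nrm (koethe_dual (koethe_dual X)) x"
    and "orlicz_function N2" and "orlicz_equivalent N2 (\<lambda>u. exp (u\<^sup>2) - 1)"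
    and "G = closure_L_inf (orlicz_space N2)"
    and "G \<subseteq> carr X"
    and "w \<in> borel_measurable leb01" and "AE t in leb01. w t > 0"
    and "L_inf \<subseteq> carr (weighted_space X w)" and "carr (weighted_space X w) \<subseteq> L_1"
  shows "(rademacher_spans_l2 (weighted_space X w) \<longleftrightarrow> w \<in> carr (multiplicator_space X)) \<and>
         (G \<subseteq> carr (weighted_space X w) \<longleftrightarrow> w \<in> carr (symmetric_kernel X))"
proof -
  note X = assms(1) and w = assms(7)
  note [measurable] = w
  have G: "f \<in> G \<longleftrightarrow> gauss_tail f" for f
    unfolding assms(5) by (rule closure_L_inf_iff_gauss_tail[OF assms(3,4)])
  have radX: "rad_sum a \<in> carr X" if "l2_seq a" for a
    using gauss_tail_rad_sum[OF that] G assms(6) by blast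
  have mult: "f \<in> carr (multiplicator_space X) \<longleftrightarrow>
      f \<in> meas01 \<and> (\<forall>a. l2_seq a \<longrightarrow> (\<lambda>t. f t * rad_sum a t) \<in> carr X)" for f
    by (rule multiplicator_carr_iff[OF radX])
  have "rademacher_spans_l2 (weighted_space X w)" if "w \<in> carr (multiplicator_space X)"
  proof -
    have carr: "(\<lambda>t. rad_sum a t * w t) \<in> carr X" if "l2_seq a" for a
      using \<open>w \<in> carr (multiplicator_space X)\<close> that mult[of w] by (simp add: mult.commute)
    obtain C where C: "C > 0" "\<And>a. l2_seq a \<Longrightarrow> nrm X (\<lambda>t. rad_sum a t * w t) \<le> C * l2_norm a"
      using weighted_rad_sum_upper_bound[OF X w assms(2) carr] by blast
    obtain D where D: "D > 0" "\<And>f. f \<in> carr (weighted_space X w) \<Longrightarrow>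
        (LINT t|leb01. \<bar>f t\<bar>) \<le> D * nrm X (\<lambda>t. f t * w t)"
      using weighted_L1_bound[OF X w assms(8,10)] by blast
    have mem: "rad_sum a \<in> carr (weighted_space X w)" if "l2_seq a" for a
      using carr[OF that] by (simp add: weighted_space_def)
    have "1 / (24 * D) * l2_norm a \<le> nrm X (\<lambda>t. rad_sum a t * w t)" if "l2_seq a" for a
    proof -
      have "l2_norm a / 24 \<le> D * nrm X (\<lambda>t. rad_sum a t * w t)"
        using rad_sum_L1_lower[OF that] D(2)[OF mem[OF that]] by linarith
      then show ?thesis using D(1) by (simp add: field_simps)
    qed
    then show ?thesis
      unfolding rademacher_spans_l2_def l2_norm_def[symmetric]
      using C D(1) mem by (intro exI[of _ "1 / (24 * D)"] conjI exI[of _ C]) (auto simp: weighted_space_def)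
  qed
  moreover have "w \<in> carr (multiplicator_space X)" if "rademacher_spans_l2 (weighted_space X w)"
  proof -
    have "(\<lambda>t. rad_sum a t * w t) \<in> carr X" if "l2_seq a" for a
      using \<open>rademacher_spans_l2 _\<close> that unfolding rademacher_spans_l2_def
      by (auto simp: weighted_space_def)
    then show ?thesis using mult[of w] w by (simp add: mult.commute)
  qed
  moreover have "w \<in> carr (symmetric_kernel X)" if sub: "G \<subseteq> carr (weighted_space X w)"
  proof -
    have "g \<in> carr (multiplicator_space X)" if g: "g \<in> meas01" "equimeasurable g w" for g
      unfolding mult
    proof (intro conjI allI impI g)
      fix a assume a: "l2_seq a"
      \<comment> \<open>The Rademacher sum is the factor moved: its copy \<open>v\<close> is still
        in \<open>G\<close>, so \<open>w v\<close> lies in \<open>X\<close> and controls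
        \<open>g S\<close> for every \<open>g\<close> distributed like \<open>w\<close>.\<close>
      obtain v where v: "v \<in> meas01" "equimeasurable v (rad_sum a)"
        and como: "comonotone_bound w (rad_sum a) v"
        using comonotone_rearrangement[OF w rad_sum_measurable(2)] by blast
      have "gauss_tail v"
        by (rule gauss_tail_mono[OF gauss_tail_rad_sum[OF a] v(1), of 1])
           (use v(2) in \<open>simp add: equimeasurable_def\<close>)
      then have "v \<in> carr (weighted_space X w)" using sub G by blast
      then have wv: "(\<lambda>t. w t * v t) \<in> carr X" by (simp add: weighted_space_def mult.commute)
      show "(\<lambda>t. g t * rad_sum a t) \<in> carr X"
      proof (rule carr_dilation[OF X wv])
        show "(\<lambda>t. g t * rad_sum a t) \<in> meas01" using g(1) by measurable
        show "distr_fun (\<lambda>t. g t * rad_sum a t) \<tau> \<le> 2 * 1 * distr_fun (\<lambda>t. w t * v t) \<tau>" if "\<tau> > 0" for \<tau>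
          by (rule distr_fun_mult_le[OF w rad_sum_measurable(2) v(1) g(1) rad_sum_measurable(2) como])
             (use g(2) that in \<open>auto simp: equimeasurable_def\<close>)
      qed
    qed
    then show ?thesis using w by (auto simp: symmetric_kernel_def equimeasurable_def)
  qed
  moreover have "G \<subseteq> carr (weighted_space X w)" if sym: "w \<in> carr (symmetric_kernel X)"
  proof
    fix f assume "f \<in> G"
    then have f: "gauss_tail f" using G by blast
    then have fm[measurable]: "f \<in> meas01" by (simp add: gauss_tail_def)
    obtain a K where a: "l2_seq a" and K: "K > 0"
      "\<And>\<tau>. \<tau> > 0 \<Longrightarrow> distr_fun f \<tau> \<le> 144 * distr_fun (\<lambda>t. K * rad_sum a t) \<tau>"
      using gauss_tail_dominated_by_rad_sum[OF f] by blast
    have um: "(\<lambda>t. K * rad_sum a t) \<in> meas01" by measurable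
    \<comment> \<open>Here \<open>w\<close> is moved: its copy \<open>v\<close> is a multiplicator
      because \<open>w\<close> is in the kernel, and the product of \<open>v\<close> with the
      dominating sum controls \<open>f w\<close>.\<close>
    obtain v where v: "v \<in> meas01" "equimeasurable v w"
      and como: "comonotone_bound (\<lambda>t. K * rad_sum a t) w v"
      using comonotone_rearrangement[OF um w] by blast
    have "v \<in> carr (multiplicator_space X)" using sym v by (auto simp: symmetric_kernel_def)
    then have "(\<lambda>t. K * (v t * rad_sum a t)) \<in> carr X"
      using a mult[of v] by (intro scale_in_carr[OF X]) blast
    then have uv: "(\<lambda>t. K * rad_sum a t * v t) \<in> carr X" by (simp add: mult_ac)
    have "(\<lambda>t. f t * w t) \<in> carr X"
    proof (rule carr_dilation[OF X uv])
      show "(\<lambda>t. f t * w t) \<in> meas01" by measurable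
      show "distr_fun (\<lambda>t. f t * w t) \<tau> \<le> 2 * 144 * distr_fun (\<lambda>t. K * rad_sum a t * v t) \<tau>" if "\<tau> > 0" for \<tau>
      proof (rule distr_fun_mult_le[OF um w v(1) fm w como _ K(2) _ that])
        \<comment> \<open>The product estimate has one constant for both factors, so the 144 of
          \<open>f\<close> is granted to \<open>w\<close> too.\<close>
        show "distr_fun w \<sigma> \<le> 144 * distr_fun w \<sigma>" for \<sigma> using distr_fun_bounds(1)[of w \<sigma>] by simp
      qed auto
    qed
    then show "f \<in> carr (weighted_space X w)" by (simp add: weighted_space_def)
  qed
  ultimately show ?thesis by blast
qed

end
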